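(* Let $\mathcal C$ be a regular (generalized) cluster structure on the quasi-affine variety $V=\mathbb A^s\setminus\bigcup_{i\in I}\{g_i=0\}$ with initial cluster $F\cup G=\{f_l\}_{l=1}^s$, $G=\{g_i\}_{i\in I}$ frozen, and let $\Psi:\mathbb A^r\dashrightarrow\mathbb A^s$ and the distinguished polynomials $\{\mathtt q_k\}_{k\in K}=\mathtt G\cup\mathtt H$ be as in the context. Let $\hat{\mathtt F}$ be the family of polynomials $\hat{\mathtt f}_l$ corresponding to the variables $f_l\in F$ of the initial cluster. If for every $k\in K$ the family $(\hat{\mathtt F}\cup\mathtt G\cup\mathtt H)\setminus\{\mathtt q_k\}$ is algebraically independent on $\{\mathtt q_k=0\}\subset\mathbb A^r$, then there exists a coherent pullback of $\mathcal C$; that is, for every seed $\Sigma$ of $\mathcal C$ and every mutable index $m$, with $\Sigma'$ the seed adjacent to $\Sigma$ in direction $m$, $$\prod_{k\in K}\mathtt q_k^{\lambda_k(f_m^\Sigma)+\lambda_k(f_m^{\Sigma'})-\Lambda_k(P_m^{\Sigma,\Sigma'})}=1,$$ and for every seed $\Sigma$ the family $\hat{\mathtt F}^\Sigma\cup\mathtt G\cup\mathtt H$ is algebraically independent on $\mathbb A^r$.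
   Context: All varieties are over $\mathbb C$. Generalized cluster structure. A seed $\Sigma=(Q,\{f_l\}_{l=1}^s,\mathcal P)$ consists of: a quiver with multiplicities $Q=(Q,d_1,\dots,d_n)$ on vertices $1,\dots,s$ without loops and 2-cycles, vertices $1,\dots,n$ mutable with multiplicities $d_m\ge1$, vertices $n+1,\dots,s$ frozen; a cluster $f_1,\dots,f_s$ (algebraically independent generators of the field of rational functions; $f_{n+1},\dots,f_s$ are the frozen variables); and strings $(p_{mr})_{0\le r\le d_m}$ of exchange coefficients depending only on frozen variables, $p_{m0}=p_{md_m}=1$. Let $b_{ml}$ be the number of arrows from $m$ to $l$. The adjacent seed $\Sigma'$ in direction $m\in[1,n]$ replaces $f_m$ by $f_m'$ given by $f_mf_m'=P_m=\sum_{r=0}^{d_m}T_r$, $$T_r=p_{mr}\prod_{l\le n}f_l^{rb_{ml}}\prod_{l>n}f_l^{\lfloor rb_{ml}/d_m\rfloor}\prod_{l\le n}f_l^{(d_m-r)b_{lm}}\prod_{l>n}f_l^{\lfloor(d_m-r)b_{lm}/d_m\rfloor}.$$ Coefficients mutate by $p'_{mr}=p_{m,d_m-r}$, the others unchanged. Quiver mutation at $m$: each path $i\to m\to j$ contributes $d_m$ arrows $i\to j$ if $i,j$ are both mutable, and $d_a$ arrows $i\to j$ if exactly one of $i,j$ is mutable, $a$ being the mutable one; then arrows at $m$ are reversed and 2-cycles deleted; multiplicities do not change. An ordinary cluster structure is the case of all $d_m=1$. The seeds of $\mathcal C$ are all those obtained from the initial one by sequences of mutations. $\mathcal C$ is regular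 on $V$ if every variable in every cluster is a regular function on $V$. Setting. $G=\{g_i\}_{i\in I}$ is a finite collection of distinct irreducible polynomials on $\mathbb A^s$ (coordinates $y_1,\dots,y_s$), and $V=\mathbb A^s\setminus\bigcup_{i\in I}\{g_i=0\}$. Any regular function $f$ on $V$ is uniquely $f=\hat f\prod_{i\in I}g_i^{-\lambda_i(f)}$ with $\hat f\in\mathbb C[y_1,\dots,y_s]$ not divisible by any $g_i$, $\lambda_i(f)\in\mathbb Z$. Let $r\ge s$ and let $\Psi:\mathbb A^r\dashrightarrow\mathbb A^s$ be a dominant rational map ($\mathbb A^r$ has coordinates $x_1,\dots,x_r$) such that there is a family $\mathtt H=\{\mathtt h_j\}_{j\in J}$ of $r-s$ irreducible algebraically independent polynomials in $\mathbb C[x_1,\dots,x_r]$ with $\Psi^*y_m=\mathtt y_m\prod_{j\in J}\mathtt h_j^{-\kappa_j(y_m)}$, $\mathtt y_m$ a polynomial not divisible by any $\mathtt h_j$, $\kappa_j(y_m)\in\mathbb Z$, for all $m\in[1,s]$. Then for any polynomial $p$ on $\mathbb A^s$ there is a unique polynomial $\mathtt p$ not divisible by any $\mathtt h_j$ with $\Psi^*p=\mathtt p\prod_{j\in J}\mathtt h_j^{-\kappa_j(p)}$; for $p=g_i$ it is denoted $\mathtt g_i$, and $\mathtt G=\{\mathtt g_i\}_{i\in I}$. The distinguished polynomials are $\mathtt q_k$, $k\in K=I\sqcup J$, with $\mathtt q_k=\mathtt g_k$ for $k\in I$ and $\mathtt q_k=\mathtt h_k$ for $k\in J$. The initial cluster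 of $\mathcal C$ is $F\cup G=\{f_l\}_{l=1}^s$, with all $g_i$ frozen ($F$ may contain other frozen variables). For every cluster variable (and exchange coefficient) $f$ one writes $\Psi^*f=\hat{\mathtt f}\prod_{k\in K}\mathtt q_k^{-\lambda_k(f)}$ with $\hat{\mathtt f}\in\mathbb C[x_1,\dots,x_r]$ not divisible by any $\mathtt q_k$, $\lambda_k(f)\in\mathbb Z$ (for $k\in I$, $\lambda_k(f)$ is the exponent of $g_k^{-1}$ in the unique representation $f=\hat f\prod_{i\in I}g_i^{-\lambda_i(f)}$ of $f$ as a regular function on $V$, with $\hat f\in\mathbb C[y_1,\dots,y_s]$ not divisible by any $g_i$). For a seed $\Sigma$ with cluster $\{f_l^\Sigma\}$, $\hat{\mathtt F}^\Sigma$ is the family of $\hat{\mathtt f}_l^\Sigma$ over all $l$ with $f_l^\Sigma\notin G$. For adjacent seeds $\Sigma,\Sigma'$ in direction $m$, the exchange relation is $f_m^\Sigma f_m^{\Sigma'}=P_m^{\Sigma,\Sigma'}$ with $P_m^{\Sigma,\Sigma'}\in\mathbb C[\{f_l^\Sigma\}_{l\ne m},\{g_i^{\pm1}\}_{i\in I}]$. Substituting $\Psi^*f_l^\Sigma=\hat{\mathtt f}_l^\Sigma\prod_{k\in K}\mathtt q_k^{-\lambda_k(f_l^\Sigma)}$ and $\Psi^*g_i=\mathtt g_i\prod_{j\in J}\mathtt h_j^{-\kappa_j(g_i)}$, one writes the pullback of $P_m^{\Sigma,\Sigma'}$ as $\tilde{\mathtt P}_m^{\Sigma,\Sigma'}\big/\prod_{k\in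 K}\mathtt q_k^{\Lambda_k(P_m^{\Sigma,\Sigma'})}$, where $\tilde{\mathtt P}_m^{\Sigma,\Sigma'}$ is a polynomial in the variables $\hat{\mathtt f}_l^\Sigma$ ($l\ne m$), $\mathtt g_i$, $\mathtt h_j$ which, in the ring of polynomials in these (formal) variables, is not divisible by any of the $\mathtt q_k$. A family $\{\varphi_m\}_{m=1}^p$ is algebraically dependent on a subvariety $W\subset\mathbb A^r$ if some nonzero polynomial $R$ in $p$ variables is such that $R(\varphi_1,\dots,\varphi_p)$ vanishes identically on $W$, and algebraically independent on $W$ otherwise. *)

theory Defs
  imports Complex_Main
    "HOL-Library.Poly_Mapping"
    "HOL-Computational_Algebra.Polynomial_Factorial"
begin

section \<open>Polynomials and rational functions\<close>

text \<open>
  All polynomials live in one ring with variables indexed by \<^typ>\<open>nat\<close>; the coordinates of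
  affine \<open>d\<close>-space are those with index in \<open>{1..d}\<close>, and the polynomial ring in the variables
  from \<open>A\<close> is the subring \<open>mpolys A\<close>. This subring contains all divisors of its
  nonzero elements, and all the units, so \<open>dvd\<close> (for a nonzero dividend) and \<open>irreducible\<close>
  of the big ring have their usual meaning in \<open>mpolys A\<close>.
\<close>

type_synonym mpoly = "(nat \<Rightarrow>\<^sub>0 nat) \<Rightarrow>\<^sub>0 complex"
type_synonym rfun = "mpoly fract"

definition Const :: "complex \<Rightarrow> mpoly" where
  "Const c = Poly_Mapping.single 0 c"

definition Var :: "nat \<Rightarrow> mpoly" where
  "Var i = Poly_Mapping.single (Poly_Mapping.single i 1) 1"

definition mpolys :: "nat set \<Rightarrow> mpoly set" where
  "mpolys A = {p. \<forall>m \<in> Poly_Mapping.keys p. Poly_Mapping.keys m \<subseteq> A}"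

definition rfuns :: "nat set \<Rightarrow> rfun set" where
  "rfuns A = {Fract p q | p q. p \<in> mpolys A \<and> q \<in> mpolys A \<and> q \<noteq> 0}"

definition insertion :: "(complex \<Rightarrow> 'a::comm_semiring_1) \<Rightarrow> (nat \<Rightarrow> 'a) \<Rightarrow> mpoly \<Rightarrow> 'a" where
  "insertion c \<phi> p = (\<Sum>m \<in> Poly_Mapping.keys p. c (Poly_Mapping.lookup p m) *
     (\<Prod>i \<in> Poly_Mapping.keys m. \<phi> i ^ Poly_Mapping.lookup m i))"

definition mpoly_eval :: "(nat \<Rightarrow> complex) \<Rightarrow> mpoly \<Rightarrow> complex" where
  "mpoly_eval x p = insertion (\<lambda>c. c) x p"

definition mpoly_subst :: "(nat \<Rightarrow> rfun) \<Rightarrow> mpoly \<Rightarrow> rfun" where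
  "mpoly_subst \<phi> p = insertion (\<lambda>c. to_fract (Const c)) \<phi> p"

text \<open>
  Substitution into a rational function. The value does not depend on the chosen fraction, and
  one exists whenever \<open>\<phi>\<close> is algebraically independent on the variables of \<open>f\<close>.
\<close>

definition rsubst :: "(nat \<Rightarrow> rfun) \<Rightarrow> rfun \<Rightarrow> rfun" where
  "rsubst \<phi> f = (THE u. \<exists>p q. q \<noteq> 0 \<and> f = Fract p q \<and> mpoly_subst \<phi> q \<noteq> 0 \<and>
     u = mpoly_subst \<phi> p / mpoly_subst \<phi> q)"


section \<open>Affine spaces, regular functions, rational maps\<close>

definition affine_space :: "nat \<Rightarrow> (nat \<Rightarrow> complex) set" where
  "affine_space d = {x. \<forall>i. i \<notin> {1..d} \<longrightarrow> x i = 0}"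

definition zero_set :: "nat \<Rightarrow> mpoly \<Rightarrow> (nat \<Rightarrow> complex) set" where
  "zero_set d p = {x \<in> affine_space d. mpoly_eval x p = 0}"

definition regular_at :: "nat \<Rightarrow> (nat \<Rightarrow> complex) \<Rightarrow> rfun \<Rightarrow> bool" where
  "regular_at d x f \<longleftrightarrow> (\<exists>p \<in> mpolys {1..d}. \<exists>q \<in> mpolys {1..d}. f = Fract p q \<and> mpoly_eval x q \<noteq> 0)"

definition rvalue :: "nat \<Rightarrow> rfun \<Rightarrow> (nat \<Rightarrow> complex) \<Rightarrow> complex" where
  "rvalue d f x = (THE v. \<exists>p \<in> mpolys {1..d}. \<exists>q \<in> mpolys {1..d}.
     f = Fract p q \<and> mpoly_eval x q \<noteq> 0 \<and> v = mpoly_eval x p / mpoly_eval x q)"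

definition regular_on :: "nat \<Rightarrow> (nat \<Rightarrow> complex) set \<Rightarrow> rfun \<Rightarrow> bool" where
  "regular_on d V f \<longleftrightarrow> (\<forall>x \<in> V. regular_at d x f)"

definition zariski_dense :: "nat \<Rightarrow> (nat \<Rightarrow> complex) set \<Rightarrow> bool" where
  "zariski_dense d X \<longleftrightarrow> (\<forall>p \<in> mpolys {1..d}. X \<subseteq> zero_set d p \<longrightarrow> zero_set d p = affine_space d)"

definition ratmap_image :: "nat \<Rightarrow> nat \<Rightarrow> (nat \<Rightarrow> rfun) \<Rightarrow> (nat \<Rightarrow> complex) set" where
  "ratmap_image r s \<Psi> = {(\<lambda>i. if i \<in> {1..s} then rvalue r (\<Psi> i) x else 0) | x.
     x \<in> affine_space r \<and> (\<forall>i \<in> {1..s}. regular_at r x (\<Psi> i))}"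

definition dominant_ratmap :: "nat \<Rightarrow> nat \<Rightarrow> (nat \<Rightarrow> rfun) \<Rightarrow> bool" where
  "dominant_ratmap r s \<Psi> \<longleftrightarrow>
     (\<forall>i \<in> {1..s}. \<Psi> i \<in> rfuns {1..r}) \<and> zariski_dense s (ratmap_image r s \<Psi>)"

definition alg_indep :: "nat set \<Rightarrow> (nat \<Rightarrow> rfun) \<Rightarrow> bool" where
  "alg_indep A \<phi> \<longleftrightarrow> (\<forall>R \<in> mpolys A. R \<noteq> 0 \<longrightarrow> mpoly_subst \<phi> R \<noteq> 0)"

definition alg_indep_on :: "(nat \<Rightarrow> complex) set \<Rightarrow> nat set \<Rightarrow> (nat \<Rightarrow> mpoly) \<Rightarrow> bool" where
  "alg_indep_on W A \<phi> \<longleftrightarrow>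
     (\<forall>R \<in> mpolys A. R \<noteq> 0 \<longrightarrow> \<not> (\<forall>x \<in> W. mpoly_eval (\<lambda>l. mpoly_eval x (\<phi> l)) R = 0))"


section \<open>Generalized cluster structures\<close>

text \<open>
  Vertices are \<open>{1..s}\<close>, the mutable ones \<open>{1..n}\<close>. \<open>arrows S i j\<close> is the number of arrows from
  \<open>i\<close> to \<open>j\<close>, \<open>mult S m\<close> the multiplicity \<open>d\<^sub>m\<close>. Since frozen variables never change, the
  exchange coefficients \<open>coef S m k\<close> are stored as elements of the field, like the cluster.
\<close>

record seed =
  arrows :: "nat \<Rightarrow> nat \<Rightarrow> nat"
  mult :: "nat \<Rightarrow> nat"
  cluster :: "nat \<Rightarrow> rfun"
  coef :: "nat \<Rightarrow> nat \<Rightarrow> rfun"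

text \<open>The ring generated over the complex numbers by all \<open>\<phi> l\<close>, \<open>l \<in> A\<close>, and the inverses of
  \<open>\<phi> i\<close>, \<open>i \<in> I\<close>, for \<open>I \<subseteq> A\<close>.\<close>

definition localized_ring :: "nat set \<Rightarrow> nat set \<Rightarrow> (nat \<Rightarrow> rfun) \<Rightarrow> rfun set" where
  "localized_ring A I \<phi> = {mpoly_subst \<phi> N * (\<Prod>i\<in>I. \<phi> i powi e i) | N e. N \<in> mpolys A}"

definition generates_field :: "nat \<Rightarrow> (nat \<Rightarrow> rfun) \<Rightarrow> bool" where
  "generates_field s \<phi> \<longleftrightarrow> (\<forall>u \<in> rfuns {1..s}. \<exists>p \<in> mpolys {1..s}. \<exists>q \<in> mpolys {1..s}.
     mpoly_subst \<phi> q \<noteq> 0 \<and> u = mpoly_subst \<phi> p / mpoly_subst \<phi> q)"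

text \<open>\<open>I\<close> is the set of those frozen vertices whose variables are invertible: the exchange
  coefficients are polynomials in the frozen variables and in the inverses of those in \<open>I\<close>.\<close>

definition is_seed :: "nat \<Rightarrow> nat \<Rightarrow> nat set \<Rightarrow> seed \<Rightarrow> bool" where
  "is_seed n s I S \<longleftrightarrow> n \<le> s \<and>
     (\<forall>i \<in> {1..s}. arrows S i i = 0) \<and>
     (\<forall>i \<in> {1..s}. \<forall>j \<in> {1..s}. arrows S i j = 0 \<or> arrows S j i = 0) \<and>
     (\<forall>m \<in> {1..n}. mult S m \<ge> 1) \<and>
     (\<forall>l \<in> {1..s}. cluster S l \<in> rfuns {1..s}) \<and>
     alg_indep {1..s} (cluster S) \<and> generates_field s (cluster S) \<and>
     (\<forall>m \<in> {1..n}. coef S m 0 = 1 \<and> coef S m (mult S m) = 1 \<and>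
        (\<forall>k \<le> mult S m. coef S m k \<in> localized_ring {n<..s} I (cluster S)))"

definition exchange_term :: "nat \<Rightarrow> nat \<Rightarrow> seed \<Rightarrow> nat \<Rightarrow> nat \<Rightarrow> rfun" where
  "exchange_term n s S m k = coef S m k *
     (\<Prod>l \<in> {1..n}. cluster S l ^ (k * arrows S m l)) *
     (\<Prod>l \<in> {n<..s}. cluster S l ^ (k * arrows S m l div mult S m)) *
     (\<Prod>l \<in> {1..n}. cluster S l ^ ((mult S m - k) * arrows S l m)) *
     (\<Prod>l \<in> {n<..s}. cluster S l ^ ((mult S m - k) * arrows S l m div mult S m))"

definition exchange_poly :: "nat \<Rightarrow> nat \<Rightarrow> seed \<Rightarrow> nat \<Rightarrow> rfun" where
  "exchange_poly n s S m = (\<Sum>k = 0..mult S m. exchange_term n s S m k)"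

text \<open>Arrows contributed by one path \<open>i \<rightarrow> m \<rightarrow> j\<close>; none between two frozen vertices.\<close>

definition path_weight :: "nat \<Rightarrow> (nat \<Rightarrow> nat) \<Rightarrow> nat \<Rightarrow> nat \<Rightarrow> nat \<Rightarrow> nat" where
  "path_weight n d m i j =
     (if i \<le> n \<and> j \<le> n then d m else if i \<le> n then d i else if j \<le> n then d j else 0)"

text \<open>The truncated subtraction deletes the 2-cycles.\<close>

definition mutate_arrows ::
    "nat \<Rightarrow> (nat \<Rightarrow> nat) \<Rightarrow> nat \<Rightarrow> (nat \<Rightarrow> nat \<Rightarrow> nat) \<Rightarrow> nat \<Rightarrow> nat \<Rightarrow> nat" where
  "mutate_arrows n d m b i j = (if i = m \<or> j = m then b j i
     else (b i j + path_weight n d m i j * (b i m * b m j))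
        - (b j i + path_weight n d m j i * (b j m * b m i)))"

definition mutate :: "nat \<Rightarrow> nat \<Rightarrow> nat \<Rightarrow> seed \<Rightarrow> seed" where
  "mutate n s m S = S\<lparr>
     arrows := mutate_arrows n (mult S) m (arrows S),
     cluster := (cluster S)(m := exchange_poly n s S m / cluster S m),
     coef := (coef S)(m := (\<lambda>k. coef S m (mult S m - k)))\<rparr>"

inductive_set seeds :: "nat \<Rightarrow> nat \<Rightarrow> seed \<Rightarrow> seed set" for n s :: nat and S0 :: seed where
  initial: "S0 \<in> seeds n s S0"
| adjacent: "S \<in> seeds n s S0 \<Longrightarrow> m \<in> {1..n} \<Longrightarrow> mutate n s m S \<in> seeds n s S0"

text \<open>A mutation of a seed is again a seed unless the exchange polynomial is zero, which the
  exchange coefficients do not rule out by themselves; hence the condition on all seeds.\<close>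

definition gen_cluster_structure :: "nat \<Rightarrow> nat \<Rightarrow> nat set \<Rightarrow> seed \<Rightarrow> bool" where
  "gen_cluster_structure n s I S0 \<longleftrightarrow> (\<forall>S \<in> seeds n s S0. is_seed n s I S)"


section \<open>Pullback data\<close>

text \<open>
  \<open>sdim\<close> and \<open>rdim\<close> are \<open>s\<close> and \<open>r\<close>. The set \<open>gind\<close> indexing the polynomials \<open>g\<^sub>i\<close> is a set of
  vertices (\<open>g\<^sub>i\<close> is the frozen variable at the vertex \<open>i\<close>) and the \<open>h\<^sub>j\<close> are indexed by \<open>{s<..r}\<close>.
  Thus the index sets are disjoint subsets of \<open>{1..r}\<close>, and \<open>psi D i\<close> is the pullback of
  the coordinate \<open>y\<^sub>i\<close>.
\<close>

record pullback_data =
  sdim :: nat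
  rdim :: nat
  gind :: "nat set"
  gpol :: "nat \<Rightarrow> mpoly"
  hpol :: "nat \<Rightarrow> mpoly"
  psi :: "nat \<Rightarrow> rfun"

definition hind :: "pullback_data \<Rightarrow> nat set" where
  "hind D = {sdim D<..rdim D}"

definition kind :: "pullback_data \<Rightarrow> nat set" where
  "kind D = gind D \<union> hind D"

definition quasi_affine :: "pullback_data \<Rightarrow> (nat \<Rightarrow> complex) set" where
  "quasi_affine D = affine_space (sdim D) - (\<Union>i \<in> gind D. zero_set (sdim D) (gpol D i))"

definition pole_form ::
    "nat \<Rightarrow> nat set \<Rightarrow> (nat \<Rightarrow> mpoly) \<Rightarrow> rfun \<Rightarrow> mpoly \<Rightarrow> (nat \<Rightarrow> int) \<Rightarrow> bool" where
  "pole_form d K q u p e \<longleftrightarrow> p \<in> mpolys {1..d} \<and> (\<forall>k \<in> K. \<not> q k dvd p) \<and>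
     (\<forall>k. k \<notin> K \<longrightarrow> e k = 0) \<and> u = to_fract p * (\<Prod>k\<in>K. to_fract (q k) powi (- e k))"

definition valid_pullback_data :: "pullback_data \<Rightarrow> bool" where
  "valid_pullback_data D \<longleftrightarrow>
     sdim D \<le> rdim D \<and>
     gind D \<subseteq> {1..sdim D} \<and> inj_on (gpol D) (gind D) \<and>
     (\<forall>i \<in> gind D. gpol D i \<in> mpolys {1..sdim D} \<and> irreducible (gpol D i)) \<and>
     (\<forall>j \<in> hind D. hpol D j \<in> mpolys {1..rdim D} \<and> irreducible (hpol D j)) \<and>
     alg_indep (hind D) (\<lambda>j. to_fract (hpol D j)) \<and>
     dominant_ratmap (rdim D) (sdim D) (psi D) \<and>
     (\<forall>m \<in> {1..sdim D}. \<exists>y \<kappa>. pole_form (rdim D) (hind D) (hpol D) (psi D m) y \<kappa>)"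

definition pullback :: "pullback_data \<Rightarrow> rfun \<Rightarrow> rfun" where
  "pullback D f = rsubst (psi D) f"

definition kappa :: "pullback_data \<Rightarrow> mpoly \<Rightarrow> nat \<Rightarrow> int" where
  "kappa D p = (THE \<kappa>. \<exists>p'. pole_form (rdim D) (hind D) (hpol D) (pullback D (to_fract p)) p' \<kappa>)"

definition pullback_poly :: "pullback_data \<Rightarrow> mpoly \<Rightarrow> mpoly" where
  "pullback_poly D p =
     (THE p'. \<exists>\<kappa>. pole_form (rdim D) (hind D) (hpol D) (pullback D (to_fract p)) p' \<kappa>)"

definition qpol :: "pullback_data \<Rightarrow> nat \<Rightarrow> mpoly" where
  "qpol D k = (if k \<in> gind D then pullback_poly D (gpol D k) else hpol D k)"

text \<open>
  The pullbacks of the irreducible \<open>g\<^sub>i\<close> may be reducible and may have common factors, so that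
  non-divisibility by them does not determine the exponents; those with index in \<open>gind D\<close> are
  the exponents of \<open>f\<close> as a regular function on the quasi-affine variety, and the others
  are then determined by non-divisibility by the \<open>h\<^sub>j\<close>. Non-divisibility of \<open>p\<close> by the
  pullbacks of the \<open>g\<^sub>i\<close> is not required here: it may fail in general (blow-up:
  \<open>x\<^sub>1 x\<^sub>2\<close> is the pullback of \<open>y\<^sub>2\<close> under \<open>y\<^sub>1 = x\<^sub>1, y\<^sub>2 = x\<^sub>1 x\<^sub>2\<close>, with \<open>g\<^sub>1 = y\<^sub>1\<close>), and is
  a consequence of the independence hypothesis of the theorem.
\<close>

definition pullback_form :: "pullback_data \<Rightarrow> rfun \<Rightarrow> mpoly \<Rightarrow> (nat \<Rightarrow> int) \<Rightarrow> bool" where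
  "pullback_form D f p e \<longleftrightarrow>
     p \<in> mpolys {1..rdim D} \<and> (\<forall>j \<in> hind D. \<not> hpol D j dvd p) \<and>
     (\<forall>k. k \<notin> kind D \<longrightarrow> e k = 0) \<and>
     (\<exists>f' e'. pole_form (sdim D) (gind D) (gpol D) f f' e' \<and> (\<forall>i \<in> gind D. e i = e' i)) \<and>
     pullback D f = to_fract p * (\<Prod>k \<in> kind D. to_fract (qpol D k) powi (- e k))"

definition hat :: "pullback_data \<Rightarrow> rfun \<Rightarrow> mpoly" where
  "hat D f = (THE p. \<exists>e. pullback_form D f p e)"

definition lam :: "pullback_data \<Rightarrow> rfun \<Rightarrow> nat \<Rightarrow> int" where
  "lam D f = (THE e. \<exists>p. pullback_form D f p e)"

text \<open>The hatted cluster variables outside \<open>G\<close> together with the distinguished polynomials, as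
  one family indexed by \<open>{1..r}\<close>.\<close>

definition pullback_family :: "pullback_data \<Rightarrow> seed \<Rightarrow> nat \<Rightarrow> mpoly" where
  "pullback_family D S l = (if l \<in> kind D then qpol D l else hat D (cluster S l))"

text \<open>
  Formal variables: \<open>Var l\<close> stands for the hatted variable \<open>l\<close> if \<open>l \<in> {1..s} - gind D\<close>, and
  \<open>Var k\<close> for the distinguished polynomial \<open>k\<close> if \<open>k \<in> kind D\<close>. \<open>formal_pullback D S l\<close> is the
  expression of the pullback of the cluster variable \<open>l\<close> through them.
\<close>

definition formal_pullback :: "pullback_data \<Rightarrow> seed \<Rightarrow> nat \<Rightarrow> rfun" where
  "formal_pullback D S l = to_fract (Var l) *
     (if l \<in> gind D
      then \<Prod>j \<in> hind D. to_fract (Var j) powi (- kappa D (gpol D l) j)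
      else \<Prod>k \<in> kind D. to_fract (Var k) powi (- lam D (cluster S l) k))"

text \<open>\<open>N\<close> and \<open>a\<close> express the exchange polynomial through the cluster variables other than \<open>m\<close> and
  the inverses of the \<open>g\<^sub>i\<close>; this expression is then pulled back formally.\<close>

definition exchange_form ::
    "nat \<Rightarrow> pullback_data \<Rightarrow> seed \<Rightarrow> nat \<Rightarrow> mpoly \<Rightarrow> (nat \<Rightarrow> int) \<Rightarrow> bool" where
  "exchange_form n D S m P e \<longleftrightarrow>
     P \<in> mpolys ({1..rdim D} - {m}) \<and> (\<forall>k \<in> kind D. \<not> Var k dvd P) \<and>
     (\<forall>k. k \<notin> kind D \<longrightarrow> e k = 0) \<and>
     (\<exists>N \<in> mpolys ({1..sdim D} - {m}). \<exists>a :: nat \<Rightarrow> int.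
        exchange_poly n (sdim D) S m =
          mpoly_subst (cluster S) N * (\<Prod>i \<in> gind D. cluster S i powi a i) \<and>
        mpoly_subst (formal_pullback D S) N * (\<Prod>i \<in> gind D. formal_pullback D S i powi a i) =
          to_fract P / (\<Prod>k \<in> kind D. to_fract (Var k) powi e k))"

definition Lam :: "nat \<Rightarrow> pullback_data \<Rightarrow> seed \<Rightarrow> nat \<Rightarrow> nat \<Rightarrow> int" where
  "Lam n D S m = (THE e. \<exists>P. exchange_form n D S m P e)"

definition coherent_pullback :: "nat \<Rightarrow> pullback_data \<Rightarrow> seed \<Rightarrow> bool" where
  "coherent_pullback n D S0 \<longleftrightarrow> (\<forall>S \<in> seeds n (sdim D) S0.
     (\<forall>m \<in> {1..n}. (\<Prod>k \<in> kind D. to_fract (qpol D k) powi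
        (lam D (cluster S m) k + lam D (cluster (mutate n (sdim D) m S) m) k - Lam n D S m k)) = 1) \<and>
     alg_indep_on (affine_space (rdim D)) {1..rdim D} (pullback_family D S))"

end

theory Submission
  imports Defs "HOL-Computational_Algebra.Fundamental_Theorem_Algebra"
begin

text \<open>
  Let \<open>f\<close> and \<open>f'\<close> be exchanged, and let \<open>P\<close> be the formal exchange polynomial. Pulled back, the
  exchange relation says that the product of the hatted polynomials of \<open>f\<close> and \<open>f'\<close> is the value of
  \<open>P\<close> times the monomial in the \<open>q\<^sub>k\<close> with the exponents \<open>\<epsilon>\<^sub>k\<close> that have to vanish. If some \<open>\<epsilon>\<^sub>k\<close> were
  negative, clearing denominators would make \<open>P\<close> times a product of other \<open>q\<^sub>l\<close> vanish where
  \<open>q\<^sub>k = 0\<close>, contrary to independence there, because the variable \<open>k\<close> does not divide \<open>P\<close>. The \<open>h\<^sub>j\<close> are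
  prime and divide neither hatted polynomial, so \<open>\<epsilon>\<^sub>j\<close> is not positive. The pullbacks of the
  \<open>g\<^sub>i\<close> need not be prime, but the \<open>g\<^sub>i\<close> are, and the exchange relation before pulling back gives
  the same bound for \<open>\<epsilon>\<^sub>i\<close>. Hence the product of the hatted polynomials is exactly the value of
  \<open>P\<close>, and since \<open>P\<close> stays nonzero where \<open>q\<^sub>k = 0\<close>, independence on these hypersurfaces passes to
  the adjacent seed.
\<close>


section \<open>Ring homomorphisms and evaluation of polynomials\<close>

text \<open>The invariant of the induction over seeds is independence on every hypersurface
  \<open>q k = 0\<close>. Independence on all of affine space would be too weak, as it says nothing
  about what vanishes on a single hypersurface; it is recovered afterwards from any one
  \<open>k\<close>. When there is no \<open>k\<close> at all, the hypothesis is empty, but then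
  \<open>r = s\<close> and dominance gives independence directly.

  The exponents \<open>Lam\<close> are a definite description over all ways of writing the exchange
  polynomial through \<open>N\<close> and \<open>a\<close>, and no canonical way is singled out.
  Uniqueness is therefore not sought among formal expressions: every exchange form turns out to have
  the exponents \<open>lam f + lam f'\<close>, which gives uniqueness and coherence in one stroke.

  Two algebraic facts carry the rest. That irreducible polynomials are prime makes exponents along
  the \<open>g i\<close> and the \<open>h j\<close> well defined. That a polynomial not divisible by
  an irreducible \<open>u\<close> is nonzero at some zero of \<open>u\<close> shows that functions
  regular on the complement of the \<open>g i\<close> have no other denominators.\<close>

locale ring_map =
  fixes h :: "'a::comm_ring_1 \<Rightarrow> 'b::comm_ring_1"
  assumes add: "h (x + y) = h x + h y"
    and mult: "h (x * y) = h x * h y"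
    and one: "h 1 = 1"
begin

lemma zero: "h 0 = 0"
  using add[of 0 0] by simp

lemma sum: "h (sum f A) = (\<Sum>i\<in>A. h (f i))"
  by (induction A rule: infinite_finite_induct) (auto simp: zero add)

lemma prod: "h (prod f A) = (\<Prod>i\<in>A. h (f i))"
  by (induction A rule: infinite_finite_induct) (auto simp: one mult)

lemma power: "h (x ^ n) = h x ^ n"
  by (induction n) (auto simp: one mult)

lemma uminus: "h (- x) = - h x"
proof -
  have "h (- x) + h x = 0"
    using add[of "- x" x] zero by simp
  then show ?thesis
    by (simp add: eq_neg_iff_add_eq_0)
qed

lemma diff: "h (x - y) = h x - h y"
  using add[of x "- y"] by (simp add: uminus)

lemma dvd: "x dvd y \<Longrightarrow> h x dvd h y"
  by (auto simp: dvd_def mult)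

end

lemma ring_map_comp: "ring_map h \<Longrightarrow> ring_map g \<Longrightarrow> ring_map (\<lambda>x. h (g x))"
  by (auto simp: ring_map_def)

lemma ring_map_id: "ring_map (\<lambda>x. x)"
  by (auto simp: ring_map_def)

lemma ring_map_Const: "ring_map Const"
  by (auto simp: ring_map_def Const_def single_add mult_single)

lemma ring_map_to_fract: "ring_map to_fract"
  by (auto simp: ring_map_def)

lemma ring_map_const_poly: "ring_map (\<lambda>c. [:c:])"
  by (auto simp: ring_map_def one_pCons)

lemma ring_map_poly: "ring_map (\<lambda>p. poly p x)"
  by (auto simp: ring_map_def)

definition monom_value :: "(nat \<Rightarrow> 'a::comm_semiring_1) \<Rightarrow> (nat \<Rightarrow>\<^sub>0 nat) \<Rightarrow> 'a" where
  "monom_value \<phi> m = (\<Prod>i \<in> Poly_Mapping.keys m. \<phi> i ^ Poly_Mapping.lookup m i)"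

lemma monom_value_superset:
  assumes "finite B" "Poly_Mapping.keys m \<subseteq> B"
  shows "monom_value \<phi> m = (\<Prod>i\<in>B. \<phi> i ^ Poly_Mapping.lookup m i)"
  unfolding monom_value_def using assms
  by (intro prod.mono_neutral_left) (auto simp: in_keys_iff)

lemma monom_value_add: "monom_value \<phi> (m + m') = monom_value \<phi> m * monom_value \<phi> m'"
proof -
  let ?B = "Poly_Mapping.keys m \<union> Poly_Mapping.keys m'"
  have "monom_value \<phi> (m + m') = (\<Prod>i\<in>?B. \<phi> i ^ Poly_Mapping.lookup (m + m') i)"
    by (rule monom_value_superset) (auto dest: subsetD[OF keys_add])
  also have "\<dots> = monom_value \<phi> m * monom_value \<phi> m'"
    by (subst (1 2) monom_value_superset[where B = ?B])
      (auto simp: lookup_add power_add prod.distrib)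
  finally show ?thesis .
qed

text \<open>Vanishing coefficients contribute nothing because \<open>c 0 = 0\<close>, so two
  polynomials can be summed over a common support.\<close>

lemma insertion_superset:
  assumes "ring_map c" "finite B" "Poly_Mapping.keys p \<subseteq> B"
  shows "insertion c \<phi> p = (\<Sum>m\<in>B. c (Poly_Mapping.lookup p m) * monom_value \<phi> m)"
  unfolding insertion_def monom_value_def using assms
  by (intro sum.mono_neutral_left) (auto simp: in_keys_iff ring_map.zero)

lemma insertion_add:
  assumes "ring_map c"
  shows "insertion c \<phi> (p + q) = insertion c \<phi> p + insertion c \<phi> q"
proof -
  let ?B = "Poly_Mapping.keys p \<union> Poly_Mapping.keys q"
  have "insertion c \<phi> (p + q) = (\<Sum>m\<in>?B. c (Poly_Mapping.lookup (p + q) m) * monom_value \<phi> m)"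
    using assms by (intro insertion_superset) (auto dest: subsetD[OF keys_add])
  also have "\<dots> = insertion c \<phi> p + insertion c \<phi> q"
    using assms by (subst (1 2) insertion_superset[where B = ?B])
      (auto simp: lookup_add ring_map.add distrib_right sum.distrib)
  finally show ?thesis .
qed

lemma insertion_single:
  "ring_map c \<Longrightarrow> insertion c \<phi> (Poly_Mapping.single m a) = c a * monom_value \<phi> m"
  by (subst insertion_superset[where B = "{m}"]) auto

lemma poly_mapping_sum_single:
  "p = (\<Sum>m\<in>Poly_Mapping.keys p. Poly_Mapping.single m (Poly_Mapping.lookup p m))"
  by (rule poly_mapping_eqI) (auto simp: lookup_sum lookup_single when_def in_keys_iff)

lemma insertion_0: "insertion c \<phi> 0 = 0"
  by (simp add: insertion_def)

lemma insertion_sum: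
  "ring_map c \<Longrightarrow> insertion c \<phi> (sum f A) = (\<Sum>i\<in>A. insertion c \<phi> (f i))"
  by (induction A rule: infinite_finite_induct) (auto simp: insertion_add insertion_0)

lemma insertion_mult:
  assumes c: "ring_map c"
  shows "insertion c \<phi> (p * q) = insertion c \<phi> p * insertion c \<phi> q"
proof -
  have "p * q = (\<Sum>m\<in>Poly_Mapping.keys p. \<Sum>m'\<in>Poly_Mapping.keys q.
      Poly_Mapping.single (m + m') (Poly_Mapping.lookup p m * Poly_Mapping.lookup q m'))"
    by (subst poly_mapping_sum_single[of p], subst poly_mapping_sum_single[of q])
      (simp add: sum_product mult_single)
  then have "insertion c \<phi> (p * q) = (\<Sum>m\<in>Poly_Mapping.keys p. \<Sum>m'\<in>Poly_Mapping.keys q.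
      c (Poly_Mapping.lookup p m) * monom_value \<phi> m * (c (Poly_Mapping.lookup q m') * monom_value \<phi> m'))"
    using c by (simp add: insertion_sum insertion_single ring_map.mult monom_value_add mult_ac)
  also have "\<dots> = insertion c \<phi> p * insertion c \<phi> q"
    using c by (subst (1 2) insertion_superset[OF _ finite_keys order_refl]) (auto simp: sum_product)
  finally show ?thesis .
qed

lemma insertion_Const: "ring_map c \<Longrightarrow> insertion c \<phi> (Const a) = c a"
  by (simp add: Const_def insertion_single monom_value_def)

lemma insertion_Var: "ring_map c \<Longrightarrow> insertion c \<phi> (Var i) = \<phi> i"
  by (simp add: Var_def insertion_single monom_value_def ring_map.one)

lemma Const_0 [simp]: "Const 0 = 0" and Const_1 [simp]: "Const 1 = 1"
  by (simp_all add: Const_def)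

lemma Const_eq_0_iff [simp]: "Const a = 0 \<longleftrightarrow> a = 0"
  unfolding Const_def by (metis lookup_single_eq lookup_zero single_zero)

lemma Const_mult: "Const (a * b) = Const a * Const b"
  by (rule ring_map.mult[OF ring_map_Const])

lemma ring_map_insertion: "ring_map c \<Longrightarrow> ring_map (insertion c \<phi>)"
  using insertion_Const[of c \<phi> 1] ring_map.one[of c]
  by (auto simp: ring_map_def[of "insertion c \<phi>"] insertion_add insertion_mult)

lemma insertion_cong:
  assumes "p \<in> mpolys A" "\<And>i. i \<in> A \<Longrightarrow> \<phi> i = \<psi> i"
  shows "insertion c \<phi> p = insertion c \<psi> p"
  unfolding insertion_def using assms
  by (intro sum.cong prod.cong arg_cong2[where f = "(*)"] arg_cong2[where f = "(^)"] refl)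
    (auto simp: mpolys_def)

lemma insertion_comp:
  assumes "ring_map h"
  shows "h (insertion c \<phi> p) = insertion (\<lambda>a. h (c a)) (\<lambda>i. h (\<phi> i)) p"
  unfolding insertion_def
  by (simp add: ring_map.sum[OF assms] ring_map.mult[OF assms] ring_map.prod[OF assms]
      ring_map.power[OF assms])

lemma insertion_id: "insertion Const Var p = p"
proof -
  have eq: "monom_value Var m = Poly_Mapping.single m 1" for m
  proof -
    have Vp: "Var i ^ k = Poly_Mapping.single (Poly_Mapping.single i k) 1" for i k
      by (induction k) (auto simp: Var_def mult_single single_add[symmetric])
    have "(\<Prod>i\<in>B. Poly_Mapping.single (f i) (1::complex)) = Poly_Mapping.single (sum f B) 1"
      if "finite B" for f :: "nat \<Rightarrow> (nat \<Rightarrow>\<^sub>0 nat)" and B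
      using that by (induction B rule: finite_induct) (auto simp: mult_single)
    then have "monom_value Var m = Poly_Mapping.single
        (\<Sum>i\<in>Poly_Mapping.keys m. Poly_Mapping.single i (Poly_Mapping.lookup m i)) 1"
      by (simp add: monom_value_def Vp)
    then show ?thesis
      by (metis poly_mapping_sum_single)
  qed
  have "insertion Const Var p = (\<Sum>m\<in>Poly_Mapping.keys p.
      Poly_Mapping.single m (Poly_Mapping.lookup p m))"
    by (subst insertion_superset[OF ring_map_Const finite_keys order_refl])
      (simp add: eq Const_def mult_single)
  then show ?thesis
    by (simp flip: poly_mapping_sum_single)
qed

section \<open>Subrings generated by variables, and induction on polynomials\<close>

definition semiring_closed :: "'a::comm_semiring_1 set \<Rightarrow> bool" where
  "semiring_closed S \<longleftrightarrow> 0 \<in> S \<and> 1 \<in> S \<and> (\<forall>x\<in>S. \<forall>y\<in>S. x + y \<in> S \<and> x * y \<in> S)"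

lemma
  assumes "semiring_closed S"
  shows semiring_closed_0: "0 \<in> S" and semiring_closed_1: "1 \<in> S"
    and semiring_closed_add: "x \<in> S \<Longrightarrow> y \<in> S \<Longrightarrow> x + y \<in> S"
    and semiring_closed_mult: "x \<in> S \<Longrightarrow> y \<in> S \<Longrightarrow> x * y \<in> S"
  using assms by (auto simp: semiring_closed_def)

lemma semiring_closed_sum:
  "semiring_closed S \<Longrightarrow> (\<And>i. i \<in> A \<Longrightarrow> f i \<in> S) \<Longrightarrow> sum f A \<in> S"
  by (induction A rule: infinite_finite_induct) (auto simp: semiring_closed_def)

lemma semiring_closed_prod:
  "semiring_closed S \<Longrightarrow> (\<And>i. i \<in> A \<Longrightarrow> f i \<in> S) \<Longrightarrow> prod f A \<in> S"
  by (induction A rule: infinite_finite_induct) (auto simp: semiring_closed_def)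

lemma semiring_closed_power: "semiring_closed S \<Longrightarrow> x \<in> S \<Longrightarrow> x ^ n \<in> S"
  by (induction n) (auto simp: semiring_closed_def)

lemma insertion_closed:
  assumes "semiring_closed S" "\<And>a. c a \<in> S" "\<And>i. i \<in> A \<Longrightarrow> \<phi> i \<in> S" "p \<in> mpolys A"
  shows "insertion c \<phi> p \<in> S"
  unfolding insertion_def using assms
  by (intro semiring_closed_sum semiring_closed_mult semiring_closed_prod semiring_closed_power)
    (auto simp: mpolys_def)

text \<open>The induction principle for polynomials, with \<open>S\<close> as the set where the
  claim holds. It follows from \<open>insertion_closed\<close> because a polynomial is its own value
  at the variables.\<close>

lemma mpolys_generated:
  assumes "p \<in> mpolys A" "semiring_closed S" "\<And>a. Const a \<in> S" "\<And>i. i \<in> A \<Longrightarrow> Var i \<in> S"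
  shows "p \<in> S"
  using insertion_closed[of S Const A Var p] assms by (simp add: insertion_id)

lemma semiring_closed_mpolys: "semiring_closed (mpolys A)"
proof -
  have "p * q \<in> mpolys A" if "p \<in> mpolys A" "q \<in> mpolys A" for p q
  proof -
    have "Poly_Mapping.keys m \<subseteq> A" if "m \<in> Poly_Mapping.keys (p * q)" for m
    proof -
      obtain a b where "m = a + b" "a \<in> Poly_Mapping.keys p" "b \<in> Poly_Mapping.keys q"
        using keys_mult[of p q] \<open>m \<in> _\<close> by blast
      then have "Poly_Mapping.keys a \<subseteq> A" "Poly_Mapping.keys b \<subseteq> A"
        using \<open>p \<in> mpolys A\<close> \<open>q \<in> mpolys A\<close> by (auto simp: mpolys_def)
      then show ?thesis
        using keys_add[of a b] \<open>m = a + b\<close> by blast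
    qed
    then show ?thesis
      by (simp add: mpolys_def)
  qed
  moreover have "p + q \<in> mpolys A" if "p \<in> mpolys A" "q \<in> mpolys A" for p q
  proof -
    have "m \<in> Poly_Mapping.keys p \<union> Poly_Mapping.keys q" if "m \<in> Poly_Mapping.keys (p + q)" for m
      using keys_add[of p q] that by blast
    then show ?thesis
      using \<open>p \<in> mpolys A\<close> \<open>q \<in> mpolys A\<close> by (auto simp: mpolys_def)
  qed
  moreover have "0 \<in> mpolys A" "1 \<in> mpolys A"
    by (simp_all add: mpolys_def)
  ultimately show ?thesis
    unfolding semiring_closed_def by blast
qed

lemmas mpolys_0 [simp] = semiring_closed_0[OF semiring_closed_mpolys]
lemmas mpolys_1 [simp] = semiring_closed_1[OF semiring_closed_mpolys]
lemmas mpolys_add = semiring_closed_add[OF semiring_closed_mpolys]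
lemmas mpolys_mult = semiring_closed_mult[OF semiring_closed_mpolys]
lemmas mpolys_power = semiring_closed_power[OF semiring_closed_mpolys]
lemmas mpolys_prod = semiring_closed_prod[OF semiring_closed_mpolys]
lemmas mpolys_sum = semiring_closed_sum[OF semiring_closed_mpolys]

lemma Const_mpolys [simp]: "Const a \<in> mpolys A"
  by (auto simp: Const_def mpolys_def)

lemma Var_mpolys [simp]: "Var i \<in> mpolys A \<longleftrightarrow> i \<in> A"
  by (auto simp: Var_def mpolys_def)

lemma mpolys_uminus: "p \<in> mpolys A \<Longrightarrow> - p \<in> mpolys A"
  by (auto simp: mpolys_def in_keys_iff)

lemma mpolys_diff: "p \<in> mpolys A \<Longrightarrow> q \<in> mpolys A \<Longrightarrow> p - q \<in> mpolys A"
  using mpolys_add[of p A "- q"] mpolys_uminus by fastforce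

lemma mpolys_mono: "p \<in> mpolys A \<Longrightarrow> A \<subseteq> B \<Longrightarrow> p \<in> mpolys B"
  by (auto simp: mpolys_def)

lemma mpolys_Int: "p \<in> mpolys A \<Longrightarrow> p \<in> mpolys B \<Longrightarrow> p \<in> mpolys (A \<inter> B)"
  by (auto simp: mpolys_def)

lemma mpolys_finite: obtains B where "finite B" "p \<in> mpolys B"
  by (rule that[of "\<Union> (Poly_Mapping.keys ` Poly_Mapping.keys p)"]) (auto simp: mpolys_def)

lemma mpolys_empty: "p \<in> mpolys {} \<Longrightarrow> \<exists>a. p = Const a"
proof -
  assume "p \<in> mpolys {}"
  then have "p \<in> range Const"
  proof (rule mpolys_generated)
    show "semiring_closed (range Const)"
      unfolding semiring_closed_def
      by (force simp: image_iff Const_mult[symmetric] ring_map.add[OF ring_map_Const, symmetric]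
          intro: exI[of _ 0] exI[of _ 1])
  qed auto
  then show ?thesis
    by blast
qed

lemma ring_map_mpoly_eval: "ring_map (mpoly_eval x)"
  unfolding mpoly_eval_def[abs_def] by (intro ring_map_insertion ring_map_id)

lemmas mpoly_eval_add [simp] = ring_map.add[OF ring_map_mpoly_eval]
lemmas mpoly_eval_mult [simp] = ring_map.mult[OF ring_map_mpoly_eval]
lemmas mpoly_eval_1 [simp] = ring_map.one[OF ring_map_mpoly_eval]
lemmas mpoly_eval_0 [simp] = ring_map.zero[OF ring_map_mpoly_eval]
lemmas mpoly_eval_prod = ring_map.prod[OF ring_map_mpoly_eval]
lemmas mpoly_eval_sum = ring_map.sum[OF ring_map_mpoly_eval]
lemmas mpoly_eval_power [simp] = ring_map.power[OF ring_map_mpoly_eval]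

lemma mpoly_eval_Const [simp]: "mpoly_eval x (Const a) = a"
  and mpoly_eval_Var [simp]: "mpoly_eval x (Var i) = x i"
  by (simp_all add: mpoly_eval_def insertion_Const insertion_Var ring_map_id)

lemma ring_map_mpoly_subst: "ring_map (mpoly_subst \<phi>)"
  unfolding mpoly_subst_def[abs_def]
  by (intro ring_map_insertion ring_map_comp[OF ring_map_to_fract ring_map_Const])

lemmas mpoly_subst_add = ring_map.add[OF ring_map_mpoly_subst]
lemmas mpoly_subst_diff = ring_map.diff[OF ring_map_mpoly_subst]
lemmas mpoly_subst_mult = ring_map.mult[OF ring_map_mpoly_subst]
lemmas mpoly_subst_1 [simp] = ring_map.one[OF ring_map_mpoly_subst]
lemmas mpoly_subst_0 [simp] = ring_map.zero[OF ring_map_mpoly_subst]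

lemma mpoly_subst_Const [simp]: "mpoly_subst \<phi> (Const a) = to_fract (Const a)"
  and mpoly_subst_Var [simp]: "mpoly_subst \<phi> (Var i) = \<phi> i"
  by (simp_all add: mpoly_subst_def insertion_Const insertion_Var
      ring_map_comp[OF ring_map_to_fract ring_map_Const])

lemma mpoly_subst_cong:
  "p \<in> mpolys A \<Longrightarrow> (\<And>i. i \<in> A \<Longrightarrow> \<phi> i = \<psi> i) \<Longrightarrow> mpoly_subst \<phi> p = mpoly_subst \<psi> p"
  unfolding mpoly_subst_def by (rule insertion_cong)

lemma mpoly_eval_cong:
  "p \<in> mpolys A \<Longrightarrow> (\<And>i. i \<in> A \<Longrightarrow> x i = y i) \<Longrightarrow> mpoly_eval x p = mpoly_eval y p"
  unfolding mpoly_eval_def by (rule insertion_cong)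

definition psubst :: "(nat \<Rightarrow> mpoly) \<Rightarrow> mpoly \<Rightarrow> mpoly" where
  "psubst \<sigma> p = insertion Const \<sigma> p"

lemma mpoly_subst_to_fract: "mpoly_subst (\<lambda>i. to_fract (\<sigma> i)) p = to_fract (psubst \<sigma> p)"
  unfolding mpoly_subst_def psubst_def by (rule insertion_comp[OF ring_map_to_fract, symmetric])

lemma mpoly_eval_psubst: "mpoly_eval x (psubst \<sigma> p) = mpoly_eval (\<lambda>i. mpoly_eval x (\<sigma> i)) p"
  unfolding psubst_def by (subst insertion_comp[OF ring_map_mpoly_eval]) (simp add: mpoly_eval_def insertion_Const ring_map_id)

lemma psubst_mpolys:
  "p \<in> mpolys A \<Longrightarrow> (\<And>i. i \<in> A \<Longrightarrow> \<sigma> i \<in> mpolys B) \<Longrightarrow> psubst \<sigma> p \<in> mpolys B"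
  unfolding psubst_def by (intro insertion_closed[where A = A] semiring_closed_mpolys) auto


section \<open>A polynomial as a univariate polynomial in one of its variables\<close>

text \<open>The coefficients stay in the full polynomial ring, so that one type serves every
  \<open>x\<close>; that they do not contain \<open>x\<close> is the separate fact
  \<open>coeff_upoly_mpolys\<close>.\<close>

definition upoly :: "nat \<Rightarrow> mpoly \<Rightarrow> mpoly poly" where
  "upoly x = insertion (\<lambda>c. [:Const c:]) (\<lambda>i. if i = x then [:0, 1:] else [:Var i:])"

abbreviation deg_in :: "nat \<Rightarrow> mpoly \<Rightarrow> nat" where
  "deg_in x p \<equiv> degree (upoly x p)"

lemma ring_map_Const_poly: "ring_map (\<lambda>c. [:Const c:])"
  by (rule ring_map_comp[OF ring_map_const_poly ring_map_Const])

lemma ring_map_upoly: "ring_map (upoly x)"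
  unfolding upoly_def by (intro ring_map_insertion ring_map_Const_poly)

lemmas upoly_add [simp] = ring_map.add[OF ring_map_upoly]
lemmas upoly_diff [simp] = ring_map.diff[OF ring_map_upoly]
lemmas upoly_mult [simp] = ring_map.mult[OF ring_map_upoly]
lemmas upoly_1 [simp] = ring_map.one[OF ring_map_upoly]
lemmas upoly_0 [simp] = ring_map.zero[OF ring_map_upoly]
lemmas upoly_power = ring_map.power[OF ring_map_upoly]
lemmas upoly_sum = ring_map.sum[OF ring_map_upoly]

lemma upoly_Const [simp]: "upoly x (Const a) = [:Const a:]"
  unfolding upoly_def by (rule insertion_Const[OF ring_map_Const_poly])

lemma upoly_Var: "upoly x (Var i) = (if i = x then [:0, 1:] else [:Var i:])"
  unfolding upoly_def by (rule insertion_Var[OF ring_map_Const_poly])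

text \<open>This left inverse of \<open>upoly\<close> gives injectivity and carries divisibility
  back from univariate polynomials.\<close>

lemma poly_upoly: "poly (upoly x p) (Var x) = p"
proof -
  have "poly (upoly x p) (Var x) = insertion (\<lambda>c. poly [:Const c:] (Var x))
      (\<lambda>i. poly (if i = x then [:0, 1:] else [:Var i:]) (Var x)) p"
    unfolding upoly_def by (rule insertion_comp[OF ring_map_poly])
  also have "\<dots> = insertion Const Var p"
    by (rule arg_cong3[where f = insertion]) auto
  finally show ?thesis
    by (simp add: insertion_id)
qed

lemma upoly_eq_iff [simp]: "upoly x p = upoly x q \<longleftrightarrow> p = q"
  by (metis poly_upoly)

lemma upoly_eq_0_iff [simp]: "upoly x p = 0 \<longleftrightarrow> p = 0"
  using upoly_eq_iff[of x p 0] by simp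

lemma upoly_free:
  assumes "p \<in> mpolys A" "x \<notin> A"
  shows "upoly x p = [:p:]"
proof -
  have "upoly x p = insertion (\<lambda>c. [:Const c:]) (\<lambda>i. [:Var i:]) p"
    unfolding upoly_def using assms by (intro insertion_cong[where A = A]) auto
  also have "\<dots> = [:insertion Const Var p:]"
    by (rule insertion_comp[OF ring_map_const_poly, symmetric])
  finally show ?thesis
    by (simp add: insertion_id)
qed

lemma coeff_upoly_mpolys:
  assumes "p \<in> mpolys A"
  shows "coeff (upoly x p) k \<in> mpolys (A - {x})"
proof -
  let ?S = "{p. \<forall>k. coeff (upoly x p) k \<in> mpolys (A - {x})}"
  have "p \<in> ?S"
  proof (rule mpolys_generated[OF assms])
    show "semiring_closed ?S"
      by (auto simp: semiring_closed_def coeff_mult intro!: mpolys_add mpolys_sum mpolys_mult)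
  qed (auto simp: coeff_pCons upoly_Var split: nat.splits)
  then show ?thesis
    by blast
qed

lemma mpolys_free_iff: "deg_in x p = 0 \<longleftrightarrow> p \<in> mpolys (- {x})"
proof
  assume "deg_in x p = 0"
  then obtain c where "upoly x p = [:c:]"
    by (rule degree_eq_zeroE)
  then have "p = coeff (upoly x p) 0"
    using poly_upoly[of x p] by simp
  moreover have "coeff (upoly x p) 0 \<in> mpolys (UNIV - {x})"
    by (intro coeff_upoly_mpolys) (auto simp: mpolys_def)
  ultimately show "p \<in> mpolys (- {x})"
    by (simp add: Compl_eq_Diff_UNIV)
next
  assume "p \<in> mpolys (- {x})"
  then show "deg_in x p = 0"
    by (simp add: upoly_free[of p "- {x}" x])
qed

lemma mpolys_iff_deg_in: "p \<in> mpolys A \<longleftrightarrow> (\<forall>x. x \<notin> A \<longrightarrow> deg_in x p = 0)"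
proof
  assume r: "\<forall>x. x \<notin> A \<longrightarrow> deg_in x p = 0"
  then have "p \<in> mpolys (- {x})" if "x \<notin> A" for x
    using that mpolys_free_iff by blast
  then show "p \<in> mpolys A"
    unfolding mpolys_def by blast
qed (auto simp: mpolys_free_iff intro: mpolys_mono)

lemma deg_in_mult: "p \<noteq> 0 \<Longrightarrow> q \<noteq> 0 \<Longrightarrow> deg_in x (p * q) = deg_in x p + deg_in x q"
  by (simp add: degree_mult_eq)

text \<open>The degree in each variable is additive on products of nonzero polynomials, so a factor
  has degree 0 in every variable in which the product has degree 0.\<close>

lemma dvd_mpolys:
  assumes "p dvd q" "q \<noteq> 0" "q \<in> mpolys A"
  shows "p \<in> mpolys A"
  using assms by (auto simp: mpolys_iff_deg_in dvd_def deg_in_mult degree_mult_eq)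

lemma dvd_upoly_iff: "p dvd q \<longleftrightarrow> upoly x p dvd upoly x q" if "p \<in> mpolys (- {x})"
proof
  assume "upoly x p dvd upoly x q"
  then show "p dvd q"
    using ring_map.dvd[OF ring_map_poly, of "upoly x p" "upoly x q" "Var x"]
    by (simp add: poly_upoly)
qed (rule ring_map.dvd[OF ring_map_upoly])

lemma free_dvd_iff: "p dvd q \<longleftrightarrow> (\<forall>k. p dvd coeff (upoly x q) k)" if "p \<in> mpolys (- {x})"
  using that by (subst dvd_upoly_iff[OF that]) (simp add: upoly_free[OF that] const_poly_dvd_iff)

lemma Var_dvd_iff: "Var x dvd p \<longleftrightarrow> coeff (upoly x p) 0 = 0"
proof
  assume "coeff (upoly x p) 0 = 0"
  then obtain q where "upoly x p = pCons 0 q"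
    by (metis coeff_pCons_0 pCons_cases)
  then have "p = Var x * poly q (Var x)"
    using poly_upoly[of x p] by simp
  then show "Var x dvd p"
    by simp
qed (auto simp: dvd_def upoly_Var coeff_mult)


section \<open>Unique factorization\<close>

text \<open>Irreducible polynomials are prime, by induction on the set of variables. Let \<open>p\<close> be
  irreducible of positive degree in \<open>x\<close> and let \<open>a\<close> not be a multiple of \<open>p\<close>. By pseudo-division, an element
  \<open>c\<close> of the ideal \<open>(a, p)\<close> of minimal degree in \<open>x\<close> divides both generators up to factors free of
  \<open>x\<close>. These factors cancel by the induction hypothesis, so \<open>c\<close> is free of \<open>x\<close>. The same
  relation \<open>u a + v p = c\<close> yields the Nullstellensatz for hypersurfaces.\<close>

lemma mpoly_unit_iff: "p dvd 1 \<longleftrightarrow> (\<exists>a. a \<noteq> 0 \<and> p = Const a)"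
proof
  assume p: "p dvd 1"
  then obtain a where "p = Const a"
    using dvd_mpolys[OF p _ mpolys_1[of "{}"]] mpolys_empty[of p] by auto
  with p show "\<exists>a. a \<noteq> 0 \<and> p = Const a"
    by (cases "a = 0") auto
next
  assume "\<exists>a. a \<noteq> 0 \<and> p = Const a"
  then obtain a where "a \<noteq> 0" "p = Const a"
    by blast
  then have "1 = p * Const (inverse a)"
    by (simp flip: Const_mult)
  then show "p dvd 1"
    by (rule dvdI)
qed

text \<open>Descent to proper divisors terminates: a nonzero nonunit cofactor has positive degree in
  some variable of the finite set \<open>B\<close>, so the sum of the degrees over \<open>B\<close>
  drops.\<close>

lemma dvd_wellfounded_induct [consumes 1, case_names dvd]:
  fixes p :: mpoly
  assumes "p \<noteq> 0"
    and step: "\<And>p. p \<noteq> 0 \<Longrightarrow> (\<And>q r. p = q * r \<Longrightarrow> \<not> r dvd 1 \<Longrightarrow> P q) \<Longrightarrow> P p"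
  shows "P p"
proof -
  obtain B where B: "finite B" "p \<in> mpolys B"
    by (rule mpolys_finite)
  have "P p" if "p \<in> mpolys B" "p \<noteq> 0" for p
    using that
  proof (induction "\<Sum>x\<in>B. deg_in x p" arbitrary: p rule: less_induct)
    case less
    show ?case
    proof (rule step[OF \<open>p \<noteq> 0\<close>])
      fix q r assume p: "p = q * r" and r: "\<not> r dvd 1"
      have nz: "q \<noteq> 0" "r \<noteq> 0" and mem: "q \<in> mpolys B" "r \<in> mpolys B"
        using less.prems p by (auto intro: dvd_mpolys[of _ p])
      have "\<exists>x\<in>B. deg_in x r \<noteq> 0"
      proof (rule ccontr)
        assume "\<not> (\<exists>x\<in>B. deg_in x r \<noteq> 0)"
        with mem(2) have "r \<in> mpolys {}"
          by (auto simp: mpolys_iff_deg_in)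
        then obtain a where "r = Const a"
          using mpolys_empty by blast
        with nz r show False
          by (auto simp: mpoly_unit_iff)
      qed
      then have "(\<Sum>x\<in>B. deg_in x q) < (\<Sum>x\<in>B. deg_in x p)"
        using \<open>finite B\<close> nz by (intro sum_strict_mono_ex1) (auto simp: p deg_in_mult degree_mult_eq)
      then show "P q"
        using mem(1) nz(1) less.hyps by blast
    qed
  qed
  then show ?thesis
    using B \<open>p \<noteq> 0\<close> by blast
qed

lemma ex_irreducible_dvd:
  fixes p :: mpoly
  assumes "p \<noteq> 0" "\<not> p dvd 1"
  shows "\<exists>u. irreducible u \<and> u dvd p"
  using assms
proof (induction p rule: dvd_wellfounded_induct)
  case (dvd p)
  show ?case
  proof (cases "irreducible p")
    case False
    then obtain a b where "p = a * b" "\<not> a dvd 1" "\<not> b dvd 1"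
      using dvd.prems \<open>p \<noteq> 0\<close> by (auto simp: irreducible_def)
    then show ?thesis
      using dvd.IH[of a b] by (auto intro: dvd_trans)
  qed auto
qed

text \<open>Factors \<open>q k\<close> are split off one at a time as long as possible. Only
  \<open>q k\<close> being a nonunit matters, so the lemma also applies before primality is known;
  it makes no claim about uniqueness of the exponents.\<close>

lemma ex_primitive_factorization:
  fixes p :: mpoly and q :: "'i \<Rightarrow> mpoly"
  assumes "p \<noteq> 0" "finite K" "\<And>k. k \<in> K \<Longrightarrow> \<not> q k dvd 1"
  shows "\<exists>p' c. p = p' * (\<Prod>k\<in>K. q k ^ c k) \<and> (\<forall>k\<in>K. \<not> q k dvd p')"
  using assms(1)
proof (induction p rule: dvd_wellfounded_induct)
  case (dvd p)
  show ?case
  proof (cases "\<exists>k\<in>K. q k dvd p")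
    case True
    then obtain k p1 where k: "k \<in> K" "p = p1 * q k"
      by (auto simp: dvd_def mult.commute)
    obtain p' c where p': "p1 = p' * (\<Prod>k\<in>K. q k ^ c k)" "\<forall>k\<in>K. \<not> q k dvd p'"
      using dvd.IH[OF k(2)] assms(3)[OF k(1)] by blast
    have "(\<Prod>k\<in>K. q k ^ c k) * q k = (\<Prod>j\<in>K. q j ^ (c(k := Suc (c k))) j)"
      using \<open>finite K\<close> k(1) by (simp add: prod.remove[of K k] mult_ac)
    then have "p = p' * (\<Prod>j\<in>K. q j ^ (c(k := Suc (c k))) j)"
      by (simp only: k p'(1) mult.assoc)
    with p'(2) show ?thesis
      by blast
  next
    case False
    then show ?thesis
      by (intro exI[of _ p] exI[of _ "\<lambda>_. 0"]) auto
  qed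
qed

lemma irreducible_dvd_irreducible:
  fixes p :: "'a::comm_semiring_1"
  assumes "irreducible p" "irreducible q" "p dvd q"
  shows "q dvd p"
proof -
  obtain r where r: "q = p * r"
    using assms(3) by blast
  then have "r dvd 1"
    using assms irreducibleD[of q p r] by (auto simp: irreducible_def)
  then obtain s where "1 = r * s"
    by blast
  then have "p = q * s"
    by (metis mult.assoc mult.right_neutral r)
  then show ?thesis
    by simp
qed

text \<open>Primality tested only against polynomials in the variables \<open>B\<close>, a form in
  which variables can be added one at a time.\<close>

definition primes_in :: "nat set \<Rightarrow> bool" where
  "primes_in B \<longleftrightarrow> (\<forall>p\<in>mpolys B. \<forall>a\<in>mpolys B. \<forall>b\<in>mpolys B.
     irreducible p \<longrightarrow> p dvd a * b \<longrightarrow> p dvd a \<or> p dvd b)"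

context
  fixes B :: "nat set" and x :: nat
  assumes B: "primes_in B" and x: "x \<notin> B"
begin

lemma free_mpolys: "p \<in> mpolys B \<Longrightarrow> p \<in> mpolys (- {x})"
  using x by (auto intro: mpolys_mono)

lemma coeff_mpolys: "p \<in> mpolys (insert x B) \<Longrightarrow> coeff (upoly x p) k \<in> mpolys B"
  using coeff_upoly_mpolys[of p "insert x B" x k] x by simp

text \<open>Gauss's lemma. If \<open>u\<close> divides neither factor, take in each the first
  coefficient that \<open>u\<close> does not divide; their product is, modulo \<open>u\<close>, a
  coefficient of \<open>a * b\<close>, against primality of \<open>u\<close> over
  \<open>B\<close>.\<close>

lemma primes_in_free:
  assumes u: "u \<in> mpolys B" "irreducible u" "u dvd a * b"
    and ab: "a \<in> mpolys (insert x B)" "b \<in> mpolys (insert x B)"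
  shows "u dvd a \<or> u dvd b"
proof (rule ccontr)
  let ?a = "coeff (upoly x a)" and ?b = "coeff (upoly x b)"
  assume "\<not> ?thesis"
  then have ex: "\<exists>i. \<not> u dvd ?a i" "\<exists>j. \<not> u dvd ?b j"
    using free_dvd_iff[OF free_mpolys[OF u(1)]] by blast+
  define i where "i = (LEAST i. \<not> u dvd ?a i)"
  define j where "j = (LEAST j. \<not> u dvd ?b j)"
  have i: "\<not> u dvd ?a i" "\<And>k. k < i \<Longrightarrow> u dvd ?a k"
    using LeastI_ex[OF ex(1)] not_less_Least unfolding i_def by blast+
  have j: "\<not> u dvd ?b j" "\<And>k. k < j \<Longrightarrow> u dvd ?b k"
    using LeastI_ex[OF ex(2)] not_less_Least unfolding j_def by blast+
  have "coeff (upoly x (a * b)) (i + j) = (\<Sum>k\<le>i + j. ?a k * ?b (i + j - k))"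
    by (simp add: coeff_mult)
  also have "\<dots> = ?a i * ?b j + (\<Sum>k\<in>{..i + j} - {i}. ?a k * ?b (i + j - k))"
    by (subst sum.remove[of _ i]) auto
  finally have eq: "?a i * ?b j =
      coeff (upoly x (a * b)) (i + j) - (\<Sum>k\<in>{..i + j} - {i}. ?a k * ?b (i + j - k))"
    by simp
  \<comment> \<open>If \<open>k < i\<close>, minimality of \<open>i\<close> applies; otherwise
    \<open>k > i\<close>, hence \<open>i + j - k < j\<close>, and minimality of \<open>j\<close>
    applies.\<close>
  have "u dvd ?a k * ?b (i + j - k)" if "k \<in> {..i + j} - {i}" for k
    using that i(2)[of k] j(2)[of "i + j - k"] by (cases "k < i") auto
  then have "u dvd (\<Sum>k\<in>{..i + j} - {i}. ?a k * ?b (i + j - k))"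
    by (rule dvd_sum)
  moreover have "u dvd coeff (upoly x (a * b)) (i + j)"
    using u(3) free_dvd_iff[OF free_mpolys[OF u(1)]] by blast
  ultimately have "u dvd ?a i * ?b j"
    unfolding eq by (rule dvd_diff[rotated])
  then show False
    using i(1) j(1) B[unfolded primes_in_def, rule_format, OF u(1)
        coeff_mpolys[OF ab(1)] coeff_mpolys[OF ab(2)] u(2)] by blast
qed

text \<open>The irreducible factors \<open>u\<close> of \<open>s\<close> are cancelled one by one.
  Each is prime by \<open>primes_in_free\<close> and cannot divide \<open>p\<close>, since it would
  be associated to \<open>p\<close>, which has positive degree in \<open>x\<close>; so it divides
  the cofactor.\<close>

lemma cancel_free_dvd:
  assumes s: "s \<noteq> 0" "s \<in> mpolys B" and dvd: "p dvd s * a"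
    and p: "irreducible p" "p \<in> mpolys (insert x B)" "deg_in x p > 0"
    and a: "a \<in> mpolys (insert x B)"
  shows "p dvd a"
  using s dvd
proof (induction s rule: dvd_wellfounded_induct)
  case (dvd s)
  show ?case
  proof (cases "a = 0 \<or> s dvd 1")
    case True
    then show ?thesis
    proof
      assume "s dvd 1"
      then obtain t where "1 = s * t"
        by blast
      then have "a = t * (s * a)"
        by (simp flip: mult.assoc add: mult.commute[of t])
      then show ?thesis
        using dvd.prems(2) dvd_mult by metis
    qed simp
  next
    case False
    then obtain u where u: "irreducible u" "u dvd s"
      using ex_irreducible_dvd \<open>s \<noteq> 0\<close> by blast
    then obtain s' where s': "s = s' * u"
      by (auto simp: dvd_def mult.commute)
    obtain w where w: "s * a = p * w"
      using dvd.prems(2) by blast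
    have nz: "s * a \<noteq> 0"
      using False \<open>s \<noteq> 0\<close> by simp
    have mem: "u \<in> mpolys B" "s' \<in> mpolys B"
      using dvd.prems(1) s' \<open>s \<noteq> 0\<close> by (auto intro: dvd_mpolys[of _ s])
    have "s * a \<in> mpolys (insert x B)"
      using a mpolys_mono[OF dvd.prems(1)] by (auto intro!: mpolys_mult)
    then have wm: "w \<in> mpolys (insert x B)"
      using w nz by (metis dvd_mpolys dvd_triv_right)
    have "u dvd p * w"
      using u(2) w by (metis dvd_mult2)
    then consider "u dvd p" | "u dvd w"
      using primes_in_free mem(1) u(1) p(2) wm by blast
    then show ?thesis
    proof cases
      case 1
      then have "p dvd u"
        using irreducible_dvd_irreducible u(1) p(1) by blast
      then have "p \<in> mpolys (- {x})"
        using dvd_mpolys u(1) free_mpolys[OF mem(1)] by (metis irreducible_def)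
      then show ?thesis
        using p(3) mpolys_free_iff[of x p] by simp
    next
      case 2
      then obtain w' where "w = w' * u"
        by (auto simp: dvd_def mult.commute)
      then have "u * (s' * a) = u * (p * w')"
        using w s' by (simp add: mult_ac)
      then have "p dvd s' * a"
        using u(1) by (auto simp: irreducible_def)
      then show ?thesis
        using dvd.IH[OF s'] u(1) mem by (auto simp: irreducible_def)
    qed
  qed
qed

text \<open>The irreducible factors of \<open>s\<close> are cancelled against \<open>q\<close> or
  \<open>c\<close>. Being free of \<open>x\<close> they leave the degree of \<open>c\<close> in
  \<open>x\<close> positive, so \<open>c\<close> never becomes a unit; once \<open>s\<close> is a
  unit, irreducibility of \<open>p\<close> makes the remaining \<open>q\<close> a unit.\<close>

lemma irreducible_dvd_of_free_multiple:
  assumes s: "s \<noteq> 0" "s \<in> mpolys B" and eq: "s * p = q * c" and c: "deg_in x c > 0"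
    and p: "irreducible p" "p \<in> mpolys (insert x B)"
  shows "p dvd c"
  using s eq c
proof (induction s arbitrary: q c rule: dvd_wellfounded_induct)
  case (dvd s)
  have p0: "p \<noteq> 0"
    using p(1) by auto
  show ?case
  proof (cases "s dvd 1")
    case True
    then obtain t where t: "1 = s * t"
      by blast
    have "p = (t * q) * c"
      using dvd.prems(2) t by (metis mult.assoc mult.commute mult.left_neutral)
    then have "t * q dvd 1 \<or> c dvd 1"
      using p(1) irreducibleD by blast
    moreover have "\<not> c dvd 1"
      using dvd.prems(3) by (auto simp: mpoly_unit_iff)
    ultimately obtain v where "1 = t * q * v"
      by blast
    moreover have "p * v = (t * q * v) * c"
      by (subst \<open>p = (t * q) * c\<close>) (simp only: mult_ac)
    ultimately have "c = p * v"
      by simp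
    then show ?thesis
      by simp
  next
    case False
    then obtain u where u: "irreducible u" "u dvd s"
      using ex_irreducible_dvd \<open>s \<noteq> 0\<close> by blast
    then obtain s' where s': "s = s' * u"
      by (auto simp: dvd_def mult.commute)
    have mem: "u \<in> mpolys B" "s' \<in> mpolys B"
      using dvd.prems(1) s' \<open>s \<noteq> 0\<close> by (auto intro: dvd_mpolys[of _ s])
    have nz: "s * p \<noteq> 0" "u \<noteq> 0" "c \<noteq> 0"
      using \<open>s \<noteq> 0\<close> p0 u dvd.prems(3) by auto
    have "s * p \<in> mpolys (insert x B)"
      using p(2) mpolys_mono[OF dvd.prems(1)] by (auto intro!: mpolys_mult)
    then have qc: "q \<in> mpolys (insert x B)" "c \<in> mpolys (insert x B)"
      using dvd.prems(2) nz by (metis dvd_mpolys dvd_triv_right dvd_triv_left)+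
    have "u dvd q * c"
      using u(2) dvd.prems(2) by (metis dvd_mult2)
    then consider "u dvd q" | "u dvd c"
      using primes_in_free mem(1) u(1) qc by blast
    then show ?thesis
    proof cases
      case 1
      then obtain q' where "q = q' * u"
        by (auto simp: dvd_def mult.commute)
      then have "u * (s' * p) = u * (q' * c)"
        using dvd.prems(2) s' by (simp add: mult_ac)
      then have "s' * p = q' * c"
        using nz by simp
      then show ?thesis
        using dvd.IH[OF s'] u(1) mem dvd.prems(3) by (auto simp: irreducible_def)
    next
      case 2
      then obtain c' where c': "c = c' * u"
        by (auto simp: dvd_def mult.commute)
      then have "u * (s' * p) = u * (q * c')"
        using dvd.prems(2) s' by (simp add: mult_ac)
      then have eq': "s' * p = q * c'"
        using nz by simp
      have "deg_in x u = 0"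
        using free_mpolys[OF mem(1)] mpolys_free_iff by blast
      then have "deg_in x c' > 0"
        using dvd.prems(3) c' nz by (auto simp: degree_mult_eq)
      then have "p dvd c'"
        using dvd.IH[OF s' _ _ eq'] u(1) mem by (auto simp: irreducible_def)
      then show ?thesis
        by (simp add: c')
    qed
  qed
qed

lemma bezout_free:
  assumes p: "irreducible p" "p \<in> mpolys (insert x B)" "deg_in x p > 0"
    and a: "a \<in> mpolys (insert x B)" "\<not> p dvd a"
  shows "\<exists>u\<in>mpolys (insert x B). \<exists>v\<in>mpolys (insert x B). u * a + v * p \<noteq> 0 \<and> u * a + v * p \<in> mpolys B"
proof -
  let ?R = "mpolys (insert x B)"
  define I where "I = {u * a + v * p | u v. u \<in> ?R \<and> v \<in> ?R}"
  have "a = 1 * a + 0 * p" "p = 0 * a + 1 * p"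
    by simp_all
  then have aI: "a \<in> I" and pI: "p \<in> I"
    unfolding I_def by (blast intro: mpolys_0 mpolys_1)+
  have IR: "I \<subseteq> ?R"
    unfolding I_def using p a by (auto intro!: mpolys_add mpolys_mult)
  have I_comb: "s * f - t * g \<in> I" if f: "f \<in> I" and g: "g \<in> I" and st: "s \<in> ?R" "t \<in> ?R" for f g s t
  proof -
    obtain u v u' v' where uv: "u \<in> ?R" "v \<in> ?R" "u' \<in> ?R" "v' \<in> ?R"
      and fg: "f = u * a + v * p" "g = u' * a + v' * p"
      using f g unfolding I_def by auto
    have "s * f - t * g = (s * u - t * u') * a + (s * v - t * v') * p"
      by (simp add: fg algebra_simps)
    then show ?thesis
      unfolding I_def using st uv by (blast intro: mpolys_diff mpolys_mult)
  qed
  have "p \<in> I \<and> p \<noteq> 0"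
    using pI p(1) by auto
  \<comment> \<open>\<open>c\<close> plays the role of a greatest common divisor of \<open>a\<close>
    and \<open>p\<close> over the fractions of \<open>mpolys B\<close>.\<close>
  then obtain c where c: "c \<in> I" "c \<noteq> 0" and min: "\<And>f. f \<in> I \<Longrightarrow> f \<noteq> 0 \<Longrightarrow> deg_in x c \<le> deg_in x f"
    using ex_has_least_nat[of "\<lambda>f. f \<in> I \<and> f \<noteq> 0" p "deg_in x"] by blast
  let ?lc = "\<lambda>f. lead_coeff (upoly x f)"
  have lcB: "?lc f \<in> mpolys B" if "f \<in> I" for f
    using that IR coeff_mpolys by blast
  have mB: "f \<in> ?R" if "f \<in> mpolys B" for f
    using that by (rule mpolys_mono) auto
  have pseudo: "\<exists>s\<in>mpolys B. s \<noteq> 0 \<and> c dvd s * f" if "f \<in> I" for f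
    using that
  proof (induction "deg_in x f" arbitrary: f rule: less_induct)
    case less
    show ?case
    proof (cases "f = 0")
      case True
      then show ?thesis
        by (intro bexI[of _ 1]) auto
    next
      case False
      define k where "k = deg_in x f - deg_in x c"
      have k: "deg_in x f = k + deg_in x c"
        using min[OF less.prems False] by (simp add: k_def)
      \<comment> \<open>One step of pseudo-division: multiplying \<open>f\<close> by the leading
        coefficient of \<open>c\<close> avoids fractions, and the leading terms in \<open>x\<close>
        cancel.\<close>
      define f1 where "f1 = ?lc c * f - ?lc f * Var x ^ k * c"
      have f1I: "f1 \<in> I"
        unfolding f1_def using less.prems c(1) lcB mB
        by (intro I_comb mpolys_mult mpolys_power) auto
      have up: "upoly x (?lc f) = [:?lc f:]" "upoly x (?lc c) = [:?lc c:]"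
        using lcB[OF less.prems] lcB[OF c(1)] x by (auto intro!: upoly_free)
      have X: "upoly x (Var x) = monom 1 1"
        by (simp add: upoly_Var monom_altdef)
      have u1: "upoly x f1 = smult (?lc c) (upoly x f) - monom (?lc f) k * upoly x c"
        by (simp add: f1_def up upoly_power X monom_power smult_monom flip: mult.assoc)
      have "\<exists>s\<in>mpolys B. s \<noteq> 0 \<and> c dvd s * f1"
      proof (cases "f1 = 0")
        case True
        then show ?thesis
          by (intro bexI[of _ 1]) auto
      next
        case False
        have "coeff (upoly x f1) j = 0" if "j \<ge> deg_in x f" for j
        proof (cases "j = deg_in x f")
          case True
          have "deg_in x f - k = deg_in x c" "\<not> deg_in x f < k"
            using k by auto
          then show ?thesis
            by (simp add: u1 True coeff_monom_mult)
        next
          case False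
          then have "j > deg_in x f" "j - k > deg_in x c"
            using that k by auto
          then show ?thesis
            by (simp add: u1 coeff_monom_mult coeff_eq_0)
        qed
        moreover have "?lc f1 \<noteq> 0"
          using False by simp
        ultimately have "deg_in x f1 < deg_in x f"
          using not_le by blast
        then show ?thesis
          using less.hyps f1I by blast
      qed
      then obtain s where s: "s \<in> mpolys B" "s \<noteq> 0" "c dvd s * f1"
        by blast
      have "s * ?lc c * f = s * f1 + s * ?lc f * Var x ^ k * c"
        by (simp add: f1_def algebra_simps)
      then have "c dvd s * ?lc c * f"
        using s(3) by (simp add: dvd_add)
      moreover have "s * ?lc c \<noteq> 0" "s * ?lc c \<in> mpolys B"
        using s c lcB by (auto intro: mpolys_mult)
      ultimately show ?thesis
        by blast
    qed
  qed
  have "deg_in x c = 0"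
  proof (rule ccontr)
    assume "deg_in x c \<noteq> 0"
    obtain s q where "s \<in> mpolys B" "s \<noteq> 0" "s * p = q * c"
      using pseudo[OF pI] by (auto simp: dvd_def mult.commute)
    then have "p dvd c"
      using irreducible_dvd_of_free_multiple \<open>deg_in x c \<noteq> 0\<close> p by blast
    moreover obtain s' where "s' \<in> mpolys B" "s' \<noteq> 0" "c dvd s' * a"
      using pseudo[OF aI] by blast
    ultimately have "p dvd a"
      using cancel_free_dvd p a dvd_trans by blast
    with a(2) show False
      by blast
  qed
  then have "c \<in> mpolys (insert x B \<inter> - {x})"
    using c(1) IR mpolys_free_iff by (intro mpolys_Int) auto
  then have "c \<in> mpolys B"
    by (rule mpolys_mono) auto
  with c show ?thesis
    unfolding I_def by blast
qed

lemma primes_in_insert: "primes_in (insert x B)"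
  unfolding primes_in_def
proof (intro ballI impI)
  fix p a b
  assume mem: "p \<in> mpolys (insert x B)" "a \<in> mpolys (insert x B)" "b \<in> mpolys (insert x B)"
    and p: "irreducible p" "p dvd a * b"
  show "p dvd a \<or> p dvd b"
  proof (cases "deg_in x p = 0")
    case True
    then have "p \<in> mpolys (insert x B \<inter> - {x})"
      using mem(1) mpolys_free_iff by (intro mpolys_Int) auto
    then have "p \<in> mpolys B"
      by (rule mpolys_mono) auto
    then show ?thesis
      using primes_in_free p mem by blast
  next
    case False
    show ?thesis
    proof (cases "p dvd a")
      case False
      then obtain u v where c: "u * a + v * p \<noteq> 0" "u * a + v * p \<in> mpolys B"
        using bezout_free[OF p(1) mem(1) _ mem(2)] \<open>deg_in x p \<noteq> 0\<close> by blast
      \<comment> \<open>The relation is multiplied by \<open>b\<close>: now \<open>p\<close> divides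
        the left side, whose first factor is free of \<open>x\<close> and cancels.\<close>
      have "(u * a + v * p) * b = u * (a * b) + v * b * p"
        by (simp add: algebra_simps)
      then have "p dvd (u * a + v * p) * b"
        using p(2) by (simp add: dvd_add)
      then show ?thesis
        using cancel_free_dvd[OF c] p(1) mem \<open>deg_in x p \<noteq> 0\<close> by blast
    qed auto
  qed
qed

end

lemma primes_in_finite: "finite B \<Longrightarrow> primes_in B"
proof (induction B rule: finite_induct)
  case empty
  \<comment> \<open>Constants are zero or units, so without variables the claim is vacuous.\<close>
  have "\<not> irreducible p" if "p \<in> mpolys {}" for p :: mpoly
  proof -
    obtain c where "p = Const c"
      using mpolys_empty \<open>p \<in> mpolys {}\<close> by blast
    then show ?thesis
      using mpoly_unit_iff by (cases "c = 0") (auto simp: irreducible_def)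
  qed
  then show ?case
    by (auto simp: primes_in_def)
qed (rule primes_in_insert)

theorem mpoly_irreducible_imp_prime_elem:
  fixes p :: mpoly
  assumes "irreducible p"
  shows "prime_elem p"
proof -
  have "p dvd a \<or> p dvd b" if "p dvd a * b" for a b
  proof -
    obtain A B C where "finite A" "p \<in> mpolys A" "finite B" "a \<in> mpolys B" "finite C" "b \<in> mpolys C"
      by (metis mpolys_finite)
    then have "primes_in (A \<union> B \<union> C)" "p \<in> mpolys (A \<union> B \<union> C)" "a \<in> mpolys (A \<union> B \<union> C)"
      "b \<in> mpolys (A \<union> B \<union> C)"
      by (auto intro: primes_in_finite mpolys_mono)
    then show ?thesis
      using that assms unfolding primes_in_def by blast
  qed
  then show ?thesis
    using assms by (auto simp: prime_elem_def irreducible_def)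
qed

lemma prime_elem_dvd_prodD:
  fixes p :: "'a::comm_semiring_1"
  assumes "prime_elem p" "p dvd (\<Prod>k\<in>K. f k)"
  shows "\<exists>k\<in>K. p dvd f k"
  using assms(2)
proof (induction K rule: infinite_finite_induct)
  case (insert k K)
  then show ?case
    using assms(1) by (auto dest: prime_elem_dvd_multD)
qed (use assms(1) in \<open>auto simp: prime_elem_def\<close>)


section \<open>Zeros of polynomials and regular functions\<close>

lemma mpoly_eval_upd_sum:
  "mpoly_eval (y(x := t)) p = (\<Sum>i\<le>deg_in x p. mpoly_eval y (coeff (upoly x p) i) * t ^ i)"
proof -
  let ?c = "\<lambda>i. coeff (upoly x p) i"
  have "mpoly_eval (y(x := t)) (?c i) = mpoly_eval y (?c i)" for i
    using coeff_upoly_mpolys[of p UNIV x i]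
    by (intro mpoly_eval_cong[where A = "UNIV - {x}"]) (auto simp: mpolys_def)
  then have "mpoly_eval (y(x := t)) (poly (upoly x p) (Var x)) =
      (\<Sum>i\<le>deg_in x p. mpoly_eval y (?c i) * t ^ i)"
    by (simp add: poly_altdef mpoly_eval_sum)
  then show ?thesis
    by (simp add: poly_upoly)
qed

lemma mpoly_eval_upd:
  "mpoly_eval (y(x := t)) p = poly (map_poly (mpoly_eval y) (upoly x p)) t"
  unfolding mpoly_eval_upd_sum poly_altdef[of "map_poly _ _"]
  by (rule sum.mono_neutral_cong_right) (auto simp: map_poly_degree_leq le_degree
      coeff_map_poly[of "mpoly_eval y", OF mpoly_eval_0, symmetric])

text \<open>The other variables are first given values at which the leading coefficient in
  \<open>x\<close> survives; the resulting nonzero univariate polynomial cannot vanish at all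
  complex numbers.\<close>

lemma ex_nonzero_value:
  assumes "finite A" "p \<in> mpolys A" "p \<noteq> 0"
  shows "\<exists>y. (\<forall>i. i \<notin> A \<longrightarrow> y i = 0) \<and> mpoly_eval y p \<noteq> 0"
  using assms
proof (induction A arbitrary: p rule: finite_induct)
  case empty
  then obtain c where "p = Const c"
    using mpolys_empty by blast
  with empty show ?case
    by (intro exI[of _ "\<lambda>_. 0"]) auto
next
  case (insert x A)
  let ?P = "upoly x p"
  have "lead_coeff ?P \<in> mpolys A"
    using coeff_upoly_mpolys[OF insert.prems(1), of x] insert.hyps by simp
  then obtain y where y: "\<forall>i. i \<notin> A \<longrightarrow> y i = 0" "mpoly_eval y (lead_coeff ?P) \<noteq> 0"
    using insert.IH[of "lead_coeff ?P"] insert.prems by auto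
  then have "coeff (map_poly (mpoly_eval y) ?P) (degree ?P) \<noteq> 0"
    by (simp add: coeff_map_poly)
  then have "map_poly (mpoly_eval y) ?P \<noteq> 0"
    by auto
  then obtain t where "poly (map_poly (mpoly_eval y) ?P) t \<noteq> 0"
    using poly_all_0_iff_0 by blast
  then have "mpoly_eval (y(x := t)) p \<noteq> 0"
    by (simp add: mpoly_eval_upd)
  moreover have "\<forall>i. i \<notin> insert x A \<longrightarrow> (y(x := t)) i = 0"
    using y(1) by simp
  ultimately show ?case
    by blast
qed

text \<open>Fix the coordinates other than \<open>x\<close> so that neither the element
  \<open>c = a * g + b * u\<close> free of \<open>x\<close> nor the leading coefficient of
  \<open>u\<close> vanishes. Then \<open>u\<close> keeps its positive degree in \<open>x\<close> and
  has a complex root; at that root \<open>a * g\<close> equals \<open>c\<close>, so \<open>g\<close>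
  is nonzero.\<close>

lemma hypersurface_nullstellensatz:
  assumes A: "finite A" and u: "irreducible u" "u \<in> mpolys A" and g: "g \<in> mpolys A" "\<not> u dvd g"
  shows "\<exists>y. (\<forall>i. i \<notin> A \<longrightarrow> y i = 0) \<and> mpoly_eval y u = 0 \<and> mpoly_eval y g \<noteq> 0"
proof -
  obtain x where x: "x \<in> A" "deg_in x u > 0"
  proof (rule ccontr)
    assume "\<not> thesis"
    then have "u \<in> mpolys {}"
      using that u(2) by (auto simp: mpolys_iff_deg_in)
    then show False
      using primes_in_finite[of "{}"] mpolys_empty mpoly_unit_iff u(1)
      by (metis Const_0 irreducible_def)
  qed
  define B where "B = A - {x}"
  have AB: "A = insert x B" and xB: "x \<notin> B" and B: "primes_in B" "finite B"
    using x A by (auto simp: B_def intro: primes_in_finite)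
  obtain a b where c: "a * g + b * u \<noteq> 0" "a * g + b * u \<in> mpolys B"
    using bezout_free[OF B(1) xB u(1)] u(2) g x(2) unfolding AB by blast
  let ?c = "a * g + b * u" and ?U = "upoly x u"
  have l: "lead_coeff ?U \<in> mpolys B" "lead_coeff ?U \<noteq> 0"
    using coeff_upoly_mpolys[OF u(2), of x] u(1) unfolding B_def by auto
  obtain y where y: "\<forall>i. i \<notin> B \<longrightarrow> y i = 0" "mpoly_eval y (?c * lead_coeff ?U) \<noteq> 0"
    using ex_nonzero_value[OF B(2) mpolys_mult[OF c(2) l(1)]] c l by auto
  have y': "mpoly_eval y ?c \<noteq> 0" "mpoly_eval y (lead_coeff ?U) \<noteq> 0"
    using y(2) by (simp_all only: mpoly_eval_mult mult_eq_0_iff) auto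
  have "degree (map_poly (mpoly_eval y) ?U) = degree ?U"
    using y'(2) by (rule map_poly_degree_eq)
  then obtain t where t: "poly (map_poly (mpoly_eval y) ?U) t = 0"
    using x(2) alg_closed_imp_poly_has_root by metis
  let ?y = "y(x := t)"
  have "mpoly_eval ?y ?c = mpoly_eval y ?c"
    using c(2) xB by (intro mpoly_eval_cong) auto
  moreover have u0: "mpoly_eval ?y u = 0"
    using t by (simp add: mpoly_eval_upd)
  ultimately have "mpoly_eval ?y g \<noteq> 0"
    using y'(1) by auto
  moreover have "\<forall>i. i \<notin> A \<longrightarrow> ?y i = 0"
    using y(1) unfolding AB by simp
  ultimately show ?thesis
    using u0 by blast
qed

lemma mpolys_zero_set:
  assumes "finite A" "p \<in> mpolys A" "\<And>y. (\<forall>i. i \<notin> A \<longrightarrow> y i = 0) \<Longrightarrow> mpoly_eval y p = 0"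
  shows "p = 0"
  using ex_nonzero_value assms by blast

lemma rfuns_reduced:
  assumes "f \<in> rfuns A"
  shows "\<exists>p\<in>mpolys A. \<exists>q\<in>mpolys A. q \<noteq> 0 \<and> f = Fract p q \<and> (\<forall>u. irreducible u \<longrightarrow> u dvd q \<longrightarrow> \<not> u dvd p)"
proof -
  obtain p q where f: "f = Fract p q" and pq: "q \<noteq> 0" "p \<in> mpolys A" "q \<in> mpolys A"
    using assms unfolding rfuns_def by blast
  show ?thesis
    using pq f
  proof (induction q arbitrary: p rule: dvd_wellfounded_induct)
    case (dvd q)
    show ?case
    proof (cases "\<exists>u. irreducible u \<and> u dvd q \<and> u dvd p")
      case True
      then obtain u p' q' where u: "irreducible u" "q = q' * u" "p = p' * u"
        by (auto simp: dvd_def mult.commute)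
      have "p' \<in> mpolys A"
        using u dvd.prems by (cases "p = 0") (auto intro: dvd_mpolys[of _ p] simp: irreducible_def)
      moreover have "q' \<in> mpolys A"
        using u dvd.prems dvd.hyps by (auto intro: dvd_mpolys[of _ q])
      moreover have "f = Fract p' q'"
        using dvd.prems(3) dvd.hyps u by (simp add: eq_fract mult_ac)
      ultimately show ?thesis
        using dvd.IH[OF u(2)] u(1) by (auto simp: irreducible_def)
    next
      case False
      then show ?thesis
        using dvd by blast
    qed
  qed
qed

text \<open>A denominator that does not vanish at \<open>x\<close> is not divisible by
  \<open>u\<close>, since \<open>u\<close> vanishes there. Cross-multiplying with such a
  representation moves the factor \<open>u\<close> of \<open>q\<close> into
  \<open>p\<close>.\<close>

lemma regular_at_Fract:
  assumes "regular_at d x (Fract p q)" "q \<noteq> 0" "irreducible u" "mpoly_eval x u = 0" "u dvd q"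
  shows "u dvd p"
proof -
  obtain p' q' where eq: "Fract p q = Fract p' q'" and q': "mpoly_eval x q' \<noteq> 0"
    using assms(1) unfolding regular_at_def by blast
  then have "q' \<noteq> 0"
    by auto
  with eq assms(2) have "p * q' = p' * q"
    by (simp add: eq_fract)
  then have "u dvd p * q'"
    using assms(5) by simp
  moreover have "\<not> u dvd q'"
    using assms(4) q' by (auto simp: dvd_def)
  ultimately show ?thesis
    using assms(3) mpoly_irreducible_imp_prime_elem prime_elem_dvd_multD by blast
qed

text \<open>In a reduced fraction, an irreducible factor \<open>u\<close> of the denominator not
  associated to any \<open>g k\<close> has a zero at which no \<open>g k\<close> vanishes.
  Regularity there would make \<open>u\<close> divide the numerator as well.\<close>

lemma regular_pole_form:
  assumes f: "f \<in> rfuns {1..d}" "f \<noteq> 0" and K: "finite K"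
    and g: "\<And>k. k \<in> K \<Longrightarrow> g k \<in> mpolys {1..d}" "\<And>k. k \<in> K \<Longrightarrow> irreducible (g k)"
    and reg: "regular_on d (affine_space d - (\<Union>k\<in>K. zero_set d (g k))) f"
  shows "\<exists>p e. pole_form d K g f p e"
proof -
  obtain p q where pq: "p \<in> mpolys {1..d}" "q \<in> mpolys {1..d}" "q \<noteq> 0" "f = Fract p q"
    and red: "\<And>u. irreducible u \<Longrightarrow> u dvd q \<Longrightarrow> \<not> u dvd p"
    using rfuns_reduced[OF f(1)] by blast
  have p0: "p \<noteq> 0"
    using f(2) pq by (auto simp: fract_collapse)
  have nu: "\<And>k. k \<in> K \<Longrightarrow> \<not> g k dvd 1"
    using g(2) by (simp add: irreducible_def)
  obtain p' b where p': "p = p' * (\<Prod>k\<in>K. g k ^ b k)" "\<forall>k\<in>K. \<not> g k dvd p'"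
    using ex_primitive_factorization[where q = g, OF p0 K nu] by blast
  obtain q' a where q': "q = q' * (\<Prod>k\<in>K. g k ^ a k)" "\<forall>k\<in>K. \<not> g k dvd q'"
    using ex_primitive_factorization[where q = g, OF pq(3) K nu] by blast
  have "q' dvd 1"
  proof (rule ccontr)
    assume "\<not> q' dvd 1"
    moreover have "q' \<noteq> 0"
      using q'(1) pq(3) by auto
    ultimately obtain u where u: "irreducible u" "u dvd q'"
      using ex_irreducible_dvd by blast
    have uq: "u dvd q"
      using u(2) q'(1) by simp
    have um: "u \<in> mpolys {1..d}"
      using dvd_mpolys[OF uq pq(3,2)] .
    have "\<not> u dvd (\<Prod>k\<in>K. g k)"
    proof
      assume "u dvd (\<Prod>k\<in>K. g k)"
      then obtain k where k: "k \<in> K" "u dvd g k"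
        using prime_elem_dvd_prodD mpoly_irreducible_imp_prime_elem u(1) by blast
      then have "g k dvd q'"
        using irreducible_dvd_irreducible[OF u(1) g(2)[OF k(1)] k(2)] u(2) dvd_trans by blast
      with q'(2) k(1) show False
        by blast
    qed
    moreover have "(\<Prod>k\<in>K. g k) \<in> mpolys {1..d}"
      using g(1) by (rule mpolys_prod)
    ultimately obtain x where x: "\<forall>i. i \<notin> {1..d} \<longrightarrow> x i = 0" "mpoly_eval x u = 0"
        "mpoly_eval x (\<Prod>k\<in>K. g k) \<noteq> 0"
      using hypersurface_nullstellensatz[OF finite_atLeastAtMost u(1) um] by blast
    then have "x \<in> affine_space d - (\<Union>k\<in>K. zero_set d (g k))"
      using K by (auto simp: affine_space_def zero_set_def mpoly_eval_prod)
    then have "regular_at d x (Fract p q)"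
      using reg pq(4) by (auto simp: regular_on_def)
    then show False
      using regular_at_Fract[OF _ pq(3) u(1) x(2) uq] red[OF u(1) uq] by blast
  qed
  then obtain w where w: "1 = q' * w"
    by blast
  let ?g = "\<lambda>k. to_fract (g k)"
  have g0: "?g k \<noteq> 0" if "k \<in> K" for k
    using g(2)[OF that] by auto
  \<comment> \<open>Exponents count poles, hence denominator minus numerator.\<close>
  define e where "e k = (if k \<in> K then int (a k) - int (b k) else 0)" for k
  have "?g k powi (- e k) = ?g k ^ b k / ?g k ^ a k" if "k \<in> K" for k
    using g0[OF that] that by (simp add: e_def power_int_diff)
  then have P: "(\<Prod>k\<in>K. ?g k powi (- e k)) = (\<Prod>k\<in>K. ?g k ^ b k) / (\<Prod>k\<in>K. ?g k ^ a k)"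
    by (simp add: prod_dividef)
  have tw: "to_fract q' * to_fract w = 1"
    using arg_cong[OF w, of to_fract] by simp
  have pw: "to_fract (h ^ n) = to_fract h ^ n" for h :: mpoly and n
    by (rule ring_map.power[OF ring_map_to_fract])
  have pr: "to_fract (\<Prod>k\<in>K. g k ^ n k) = (\<Prod>k\<in>K. ?g k ^ n k)" for n
    by (simp add: ring_map.prod[OF ring_map_to_fract] pw)
  have "f = to_fract p / to_fract q"
    by (simp add: pq(4) Fract_conv_to_fract)
  also have "\<dots> = to_fract p' * (\<Prod>k\<in>K. ?g k ^ b k) / (to_fract q' * (\<Prod>k\<in>K. ?g k ^ a k))"
    by (subst p'(1), subst q'(1)) (simp only: to_fract_mult pr)
  also have "\<dots> = to_fract (w * p') * ((\<Prod>k\<in>K. ?g k ^ b k) / (\<Prod>k\<in>K. ?g k ^ a k))"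
    by (simp only: to_fract_mult divide_inverse inverse_mult_distrib inverse_unique[OF tw] mult_ac)
  finally have fe: "f = to_fract (w * p') * (\<Prod>k\<in>K. ?g k powi (- e k))"
    by (simp only: P)
  have p'm: "p' \<in> mpolys {1..d}"
    using p'(1) p0 pq(1) by (auto intro: dvd_mpolys[of _ p])
  have wm: "w \<in> mpolys {1..d}"
  proof (rule dvd_mpolys)
    show "w dvd 1"
      by (subst w) simp
  qed simp_all
  have "\<not> g k dvd w * p'" if "k \<in> K" for k
  proof
    assume "g k dvd w * p'"
    then have "g k dvd q' * (w * p')"
      by simp
    then have "g k dvd p'"
      using w by (metis mult.assoc mult.left_neutral)
    with p'(2) that show False
      by blast
  qed
  then have "pole_form d K g f (w * p') e"
    unfolding pole_form_def using fe p'm wm by (auto simp: e_def intro: mpolys_mult)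
  then show ?thesis
    by blast
qed


section \<open>Substitution into rational functions\<close>

text \<open>The laws of \<open>rsubst\<close> hold only where some fraction keeps a nonzero
  denominator. For an independent family this covers all rational functions in its variables, but
  formal expressions are also specialized along dependent families, such as those with the
  \<open>h j\<close> set to 1.\<close>

definition rsubst_dom :: "(nat \<Rightarrow> rfun) \<Rightarrow> rfun \<Rightarrow> bool" where
  "rsubst_dom \<phi> f \<longleftrightarrow> (\<exists>p q. q \<noteq> 0 \<and> f = Fract p q \<and> mpoly_subst \<phi> q \<noteq> 0)"

lemma rsubst_domE:
  assumes "rsubst_dom \<phi> f"
  obtains p q where "q \<noteq> 0" "f = Fract p q" "mpoly_subst \<phi> q \<noteq> 0"
  using assms unfolding rsubst_dom_def by blast

lemma rsubst_dom_Fract: "q \<noteq> 0 \<Longrightarrow> mpoly_subst \<phi> q \<noteq> 0 \<Longrightarrow> rsubst_dom \<phi> (Fract p q)"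
  unfolding rsubst_dom_def by blast

lemma rsubst_Fract:
  assumes "q \<noteq> 0" "mpoly_subst \<phi> q \<noteq> 0"
  shows "rsubst \<phi> (Fract p q) = mpoly_subst \<phi> p / mpoly_subst \<phi> q"
  unfolding rsubst_def
proof (rule the_equality)
  fix u assume "\<exists>p' q'. q' \<noteq> 0 \<and> Fract p q = Fract p' q' \<and> mpoly_subst \<phi> q' \<noteq> 0 \<and>
    u = mpoly_subst \<phi> p' / mpoly_subst \<phi> q'"
  then obtain p' q' where q': "q' \<noteq> 0" "Fract p q = Fract p' q'" "mpoly_subst \<phi> q' \<noteq> 0"
    and u: "u = mpoly_subst \<phi> p' / mpoly_subst \<phi> q'"
    by blast
  then have "p * q' = p' * q"
    using assms(1) by (simp add: eq_fract)
  then have "mpoly_subst \<phi> p * mpoly_subst \<phi> q' = mpoly_subst \<phi> p' * mpoly_subst \<phi> q"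
    by (metis mpoly_subst_mult)
  then show "u = mpoly_subst \<phi> p / mpoly_subst \<phi> q"
    using q' assms u by (simp add: frac_eq_eq)
qed (use assms in blast)

lemma
  shows rsubst_dom_to_fract [simp]: "rsubst_dom \<phi> (to_fract p)"
    and rsubst_to_fract [simp]: "rsubst \<phi> (to_fract p) = mpoly_subst \<phi> p"
  using rsubst_dom_Fract[of 1 \<phi> p] rsubst_Fract[of 1 \<phi> p] by (simp_all add: to_fract_def)

lemma
  assumes "rsubst_dom \<phi> f" "rsubst_dom \<phi> g"
  shows rsubst_dom_add: "rsubst_dom \<phi> (f + g)"
    and rsubst_add: "rsubst \<phi> (f + g) = rsubst \<phi> f + rsubst \<phi> g"
    and rsubst_dom_mult: "rsubst_dom \<phi> (f * g)"
    and rsubst_mult: "rsubst \<phi> (f * g) = rsubst \<phi> f * rsubst \<phi> g"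
proof -
  obtain p q p' q' where f: "q \<noteq> 0" "f = Fract p q" "mpoly_subst \<phi> q \<noteq> 0"
    and g: "q' \<noteq> 0" "g = Fract p' q'" "mpoly_subst \<phi> q' \<noteq> 0"
    using assms by (elim rsubst_domE)
  have add: "f + g = Fract (p * q' + p' * q) (q * q')" and mult: "f * g = Fract (p * p') (q * q')"
    using f g by simp_all
  have nz: "q * q' \<noteq> 0" "mpoly_subst \<phi> (q * q') \<noteq> 0"
    using f g by (simp_all add: mpoly_subst_mult)
  show "rsubst_dom \<phi> (f + g)" "rsubst_dom \<phi> (f * g)"
    unfolding add mult by (rule rsubst_dom_Fract[OF nz])+
  show "rsubst \<phi> (f + g) = rsubst \<phi> f + rsubst \<phi> g"
    unfolding add rsubst_Fract[OF nz]
    using f g by (simp add: rsubst_Fract mpoly_subst_add mpoly_subst_mult field_simps)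
  show "rsubst \<phi> (f * g) = rsubst \<phi> f * rsubst \<phi> g"
    unfolding mult rsubst_Fract[OF nz]
    using f g by (simp add: rsubst_Fract mpoly_subst_mult)
qed

lemma
  assumes "rsubst_dom \<phi> f" "rsubst \<phi> f \<noteq> 0"
  shows rsubst_dom_inverse: "rsubst_dom \<phi> (inverse f)"
    and rsubst_inverse: "rsubst \<phi> (inverse f) = inverse (rsubst \<phi> f)"
proof -
  obtain p q where f: "q \<noteq> 0" "f = Fract p q" "mpoly_subst \<phi> q \<noteq> 0"
    using assms(1) by (rule rsubst_domE)
  then have "mpoly_subst \<phi> p \<noteq> 0"
    using assms(2) by (auto simp: rsubst_Fract)
  moreover from this have "p \<noteq> 0"
    by auto
  ultimately show "rsubst_dom \<phi> (inverse f)" "rsubst \<phi> (inverse f) = inverse (rsubst \<phi> f)"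
    using f by (simp_all add: rsubst_Fract rsubst_dom_Fract)
qed

lemma
  shows rsubst_dom_1 [simp]: "rsubst_dom \<phi> 1" and rsubst_1 [simp]: "rsubst \<phi> 1 = 1"
  using rsubst_dom_to_fract[of \<phi> 1] rsubst_to_fract[of \<phi> 1] by simp_all

lemma
  assumes "rsubst_dom \<phi> f"
  shows rsubst_dom_power: "rsubst_dom \<phi> (f ^ n)" and rsubst_power: "rsubst \<phi> (f ^ n) = rsubst \<phi> f ^ n"
proof -
  have "rsubst_dom \<phi> (f ^ n) \<and> rsubst \<phi> (f ^ n) = rsubst \<phi> f ^ n"
    by (induction n) (auto simp: assms rsubst_dom_mult rsubst_mult)
  then show "rsubst_dom \<phi> (f ^ n)" "rsubst \<phi> (f ^ n) = rsubst \<phi> f ^ n"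
    by blast+
qed

lemma
  assumes "rsubst_dom \<phi> f" "rsubst \<phi> f \<noteq> 0"
  shows rsubst_dom_powi: "rsubst_dom \<phi> (f powi e)"
    and rsubst_powi: "rsubst \<phi> (f powi e) = rsubst \<phi> f powi e"
  using assms by (auto simp: power_int_def rsubst_dom_power rsubst_power rsubst_dom_inverse rsubst_inverse)

lemma
  assumes "\<And>i. i \<in> A \<Longrightarrow> rsubst_dom \<phi> (f i)"
  shows rsubst_dom_prod: "rsubst_dom \<phi> (\<Prod>i\<in>A. f i)"
    and rsubst_prod: "rsubst \<phi> (\<Prod>i\<in>A. f i) = (\<Prod>i\<in>A. rsubst \<phi> (f i))"
proof -
  have "rsubst_dom \<phi> (\<Prod>i\<in>A. f i) \<and> rsubst \<phi> (\<Prod>i\<in>A. f i) = (\<Prod>i\<in>A. rsubst \<phi> (f i))"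
    using assms
    by (induction A rule: infinite_finite_induct) (auto simp: rsubst_dom_mult rsubst_mult)
  then show "rsubst_dom \<phi> (\<Prod>i\<in>A. f i)" "rsubst \<phi> (\<Prod>i\<in>A. f i) = (\<Prod>i\<in>A. rsubst \<phi> (f i))"
    by blast+
qed

lemma
  assumes "p \<in> mpolys A" "\<And>i. i \<in> A \<Longrightarrow> rsubst_dom \<phi> (\<psi> i)"
  shows rsubst_dom_mpoly_subst: "rsubst_dom \<phi> (mpoly_subst \<psi> p)"
    and rsubst_mpoly_subst: "rsubst \<phi> (mpoly_subst \<psi> p) = mpoly_subst (\<lambda>i. rsubst \<phi> (\<psi> i)) p"
proof -
  let ?S = "{p. rsubst_dom \<phi> (mpoly_subst \<psi> p) \<and>
    rsubst \<phi> (mpoly_subst \<psi> p) = mpoly_subst (\<lambda>i. rsubst \<phi> (\<psi> i)) p}"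
  have "p \<in> ?S"
  proof (rule mpolys_generated[OF assms(1)])
    show "semiring_closed ?S"
      using rsubst_dom_to_fract[of \<phi> 0] rsubst_to_fract[of \<phi> 0]
      by (simp add: semiring_closed_def mpoly_subst_add mpoly_subst_mult rsubst_dom_add rsubst_add
          rsubst_dom_mult rsubst_mult)
  qed (use assms(2) in auto)
  then show "rsubst_dom \<phi> (mpoly_subst \<psi> p)"
    "rsubst \<phi> (mpoly_subst \<psi> p) = mpoly_subst (\<lambda>i. rsubst \<phi> (\<psi> i)) p"
    by blast+
qed


section \<open>Pole forms\<close>

text \<open>Divisibility between primes is association, so the last clause asks for pairwise
  non-associated primes. This is what makes exponents well defined.\<close>

definition prime_family :: "'i set \<Rightarrow> ('i \<Rightarrow> mpoly) \<Rightarrow> bool" where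
  "prime_family K q \<longleftrightarrow> finite K \<and> (\<forall>k\<in>K. prime_elem (q k)) \<and> (\<forall>k\<in>K. \<forall>l\<in>K. q k dvd q l \<longrightarrow> k = l)"

lemma to_fract_power [simp]: "to_fract (p ^ n) = to_fract p ^ n"
  by (rule ring_map.power[OF ring_map_to_fract])

lemma to_fract_prod [simp]: "to_fract (\<Prod>i\<in>A. f i) = (\<Prod>i\<in>A. to_fract (f i))"
  by (rule ring_map.prod[OF ring_map_to_fract])

lemma powi_eq_quotient: "(x::'a::field) \<noteq> 0 \<Longrightarrow> x powi e = x ^ nat e / x ^ nat (- e)"
  by (auto simp: power_int_def field_simps)

lemma prod_powi_add:
  fixes f :: "'i \<Rightarrow> 'a::field"
  assumes "\<And>k. k \<in> K \<Longrightarrow> f k \<noteq> 0"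
  shows "(\<Prod>k\<in>K. f k powi (d k + e k)) = (\<Prod>k\<in>K. f k powi d k) * (\<Prod>k\<in>K. f k powi e k)"
  using assms by (simp add: power_int_add prod.distrib)

text \<open>For each \<open>k\<close> at most one of \<open>nat (e k)\<close> and
  \<open>nat (- e k)\<close> is positive: positive exponents stay on the left, negative ones move to
  the right, and the identity becomes one between polynomials.\<close>

lemma clear_denominators:
  fixes q :: "'i \<Rightarrow> mpoly"
  assumes q: "\<And>k. k \<in> K \<Longrightarrow> q k \<noteq> 0"
    and eq: "to_fract a * (\<Prod>k\<in>K. to_fract (q k) powi e k) = to_fract b"
  shows "a * (\<Prod>k\<in>K. q k ^ nat (e k)) = b * (\<Prod>k\<in>K. q k ^ nat (- e k))"
proof (cases "finite K")
  case True
  let ?q = "\<lambda>k. to_fract (q k)"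
  have "(\<Prod>k\<in>K. ?q k powi e k) = (\<Prod>k\<in>K. ?q k ^ nat (e k)) / (\<Prod>k\<in>K. ?q k ^ nat (- e k))"
    using q by (simp add: powi_eq_quotient flip: prod_dividef)
  moreover have "(\<Prod>k\<in>K. ?q k ^ nat (- e k)) \<noteq> 0"
    using q True by simp
  ultimately have "(\<Prod>k\<in>K. ?q k ^ nat (e k)) = (\<Prod>k\<in>K. ?q k powi e k) * (\<Prod>k\<in>K. ?q k ^ nat (- e k))"
    by simp
  then have "to_fract a * (\<Prod>k\<in>K. ?q k ^ nat (e k)) = to_fract b * (\<Prod>k\<in>K. ?q k ^ nat (- e k))"
    by (simp only: eq flip: mult.assoc)
  then have "to_fract (a * (\<Prod>k\<in>K. q k ^ nat (e k))) = to_fract (b * (\<Prod>k\<in>K. q k ^ nat (- e k)))"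
    by simp
  then show ?thesis
    by (simp only: to_fract_eq_iff)
qed (use eq in simp)

lemma prime_family_nonzero: "prime_family K q \<Longrightarrow> k \<in> K \<Longrightarrow> q k \<noteq> 0"
  by (auto simp: prime_family_def)

text \<open>The single divisibility argument behind both uniqueness of exponents and the upper
  bounds in exchange relations. A positive exponent makes \<open>q k\<close> divide the right side,
  hence some \<open>q l\<close> with negative exponent; non-association gives \<open>l = k\<close>,
  whose exponent is positive.\<close>

lemma prime_family_exponent_nonpos:
  assumes q: "prime_family K q" and k: "k \<in> K"
    and eq: "to_fract a * (\<Prod>k\<in>K. to_fract (q k) powi e k) = to_fract b"
    and b: "\<not> q k dvd b"
  shows "e k \<le> 0"
proof (rule ccontr)
  assume "\<not> e k \<le> 0"
  then have e: "e k > 0"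
    by simp
  have prime: "prime_elem (q k)" and fin: "finite K"
    using q k by (auto simp: prime_family_def)
  have cd: "a * (\<Prod>k\<in>K. q k ^ nat (e k)) = b * (\<Prod>k\<in>K. q k ^ nat (- e k))"
    by (rule clear_denominators[OF prime_family_nonzero[OF q] eq])
  have "q k dvd q k ^ nat (e k)"
    using e by simp
  also have "\<dots> dvd (\<Prod>k\<in>K. q k ^ nat (e k))"
    using fin k by (rule dvd_prodI)
  also have "\<dots> dvd b * (\<Prod>k\<in>K. q k ^ nat (- e k))"
    by (simp flip: cd)
  finally have "q k dvd (\<Prod>k\<in>K. q k ^ nat (- e k))"
    using prime b prime_elem_dvd_multD by blast
  then obtain l where l: "l \<in> K" "q k dvd q l ^ nat (- e l)"
    using prime_elem_dvd_prodD[OF prime] by blast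
  then have "q k dvd q l"
    using prime by (auto dest: prime_elem_dvd_power)
  then have "l = k"
    using q k l(1) by (auto simp: prime_family_def)
  then have "q k dvd 1"
    using l(2) e by simp
  then show False
    using prime by (simp add: prime_elem_def)
qed

text \<open>With all powers moved to one side, the previous bound applies to the differences of the
  exponents in both directions.\<close>

lemma prime_family_form_unique:
  assumes q: "prime_family K q"
    and p: "\<And>k. k \<in> K \<Longrightarrow> \<not> q k dvd p" and p': "\<And>k. k \<in> K \<Longrightarrow> \<not> q k dvd p'"
    and eq: "to_fract p * (\<Prod>k\<in>K. to_fract (q k) powi (- e k)) =
      to_fract p' * (\<Prod>k\<in>K. to_fract (q k) powi (- e' k))"
  shows "p = p' \<and> (\<forall>k\<in>K. e k = e' k)"
proof -
  let ?q = "\<lambda>k. to_fract (q k)"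
  have nz: "?q k \<noteq> 0" if "k \<in> K" for k
    using prime_family_nonzero[OF q that] by simp
  have cancel: "to_fract b * (\<Prod>k\<in>K. ?q k powi (f' k - f k)) = to_fract b'"
    if "to_fract b * (\<Prod>k\<in>K. ?q k powi (- f k)) = to_fract b' * (\<Prod>k\<in>K. ?q k powi (- f' k))"
    for b b' f f'
  proof -
    have "(\<Prod>k\<in>K. ?q k powi (f' k - f k)) = (\<Prod>k\<in>K. ?q k powi (- f k)) * (\<Prod>k\<in>K. ?q k powi f' k)"
      using prod_powi_add[of K ?q "\<lambda>k. - f k" f', OF nz] by simp
    then have "to_fract b * (\<Prod>k\<in>K. ?q k powi (f' k - f k)) =
        to_fract b' * ((\<Prod>k\<in>K. ?q k powi (- f' k)) * (\<Prod>k\<in>K. ?q k powi f' k))"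
      using that by (simp flip: mult.assoc)
    also have "(\<Prod>k\<in>K. ?q k powi (- f' k)) * (\<Prod>k\<in>K. ?q k powi f' k) = 1"
      using prod_powi_add[of K ?q "\<lambda>k. - f' k" f', OF nz] by simp
    finally show ?thesis
      by simp
  qed
  have "e' k - e k \<le> 0" if "k \<in> K" for k
    by (rule prime_family_exponent_nonpos[OF q that cancel[OF eq]]) (rule p'[OF that])
  moreover have "e k - e' k \<le> 0" if "k \<in> K" for k
    by (rule prime_family_exponent_nonpos[OF q that cancel[OF eq[symmetric]]]) (rule p[OF that])
  ultimately have e: "e k = e' k" if "k \<in> K" for k
    using that by fastforce
  then have "(\<Prod>k\<in>K. ?q k powi (e' k - e k)) = 1"
    by simp
  then show ?thesis
    using cancel[OF eq] e by simp
qed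

lemma pole_form_unique:
  assumes "prime_family K q" "pole_form d K q u p e" "pole_form d K q u p' e'"
  shows "p = p' \<and> e = e'"
proof -
  have "p = p' \<and> (\<forall>k\<in>K. e k = e' k)"
    using assms by (intro prime_family_form_unique) (auto simp: pole_form_def)
  moreover have "e k = e' k" if "k \<notin> K" for k
    using assms(2,3) that by (simp add: pole_form_def)
  ultimately show ?thesis
    by blast
qed

lemma ex_form:
  assumes "finite K" "\<And>k. k \<in> K \<Longrightarrow> \<not> q k dvd 1" "\<And>k. k \<in> K \<Longrightarrow> q k \<noteq> 0" "a \<noteq> 0" "a \<in> mpolys A"
    and u: "u = to_fract a * (\<Prod>k\<in>K. to_fract (q k) powi (- e k))"
  shows "\<exists>p e. p \<in> mpolys A \<and> (\<forall>k\<in>K. \<not> q k dvd p) \<and> (\<forall>k. k \<notin> K \<longrightarrow> e k = 0) \<and>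
    u = to_fract p * (\<Prod>k\<in>K. to_fract (q k) powi (- e k))"
proof -
  obtain p c where p: "a = p * (\<Prod>k\<in>K. q k ^ c k)" "\<forall>k\<in>K. \<not> q k dvd p"
    using ex_primitive_factorization[where q = q, OF assms(4,1,2)] by blast
  define e' where "e' k = (if k \<in> K then e k - int (c k) else 0)" for k
  have "(\<Prod>k\<in>K. to_fract (q k) powi (- e' k)) = (\<Prod>k\<in>K. to_fract (q k) powi (int (c k) + - e k))"
    by (rule prod.cong) (auto simp: e'_def)
  also have "\<dots> = (\<Prod>k\<in>K. to_fract (q k) ^ c k) * (\<Prod>k\<in>K. to_fract (q k) powi (- e k))"
    using assms(3) by (subst prod_powi_add) auto
  finally have "u = to_fract p * (\<Prod>k\<in>K. to_fract (q k) powi (- e' k))"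
    using p(1) u by (simp add: mult.assoc)
  moreover have "p \<in> mpolys A"
    using p(1) assms(4,5) by (metis dvd_mpolys dvd_triv_left)
  ultimately show ?thesis
    using p(2) by (intro exI[of _ p] exI[of _ e']) (auto simp: e'_def)
qed


section \<open>Localizations\<close>

text \<open>Inverting a product inverts each of its factors, so the powers of a single
  \<open>Q\<close> can serve as common denominators, which makes closure under sums easy.\<close>

definition localization :: "'a::field set \<Rightarrow> 'a \<Rightarrow> 'a set" where
  "localization S Q = {u. \<exists>M. u * Q ^ M \<in> S}"

context
  fixes S :: "'a::field set" and Q :: 'a
  assumes S: "semiring_closed S" and Q: "Q \<in> S"
begin

lemma subset_localization: "S \<subseteq> localization S Q"
  unfolding localization_def by (auto intro: exI[of _ 0])

lemma semiring_closed_localization: "semiring_closed (localization S Q)"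
proof -
  have "u + v \<in> localization S Q" "u * v \<in> localization S Q"
    if uv: "u \<in> localization S Q" "v \<in> localization S Q" for u v
  proof -
    obtain M N where MN: "u * Q ^ M \<in> S" "v * Q ^ N \<in> S"
      using uv unfolding localization_def by blast
    have eqs: "(u + v) * Q ^ (M + N) = u * Q ^ M * Q ^ N + v * Q ^ N * Q ^ M"
      "(u * v) * Q ^ (M + N) = (u * Q ^ M) * (v * Q ^ N)"
      by (simp_all add: algebra_simps power_add)
    have "(u + v) * Q ^ (M + N) \<in> S" "(u * v) * Q ^ (M + N) \<in> S"
      unfolding eqs using MN S Q
      by (simp_all add: semiring_closed_add semiring_closed_mult semiring_closed_power)
    then show "u + v \<in> localization S Q" "u * v \<in> localization S Q"
      unfolding localization_def by blast+
  qed
  moreover have "0 \<in> localization S Q" "1 \<in> localization S Q"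
    using subset_localization S by (auto simp: semiring_closed_def)
  ultimately show ?thesis
    unfolding semiring_closed_def by blast
qed

lemma powi_localization:
  assumes "q \<in> S" "w \<in> S" "Q = q * w" "Q \<noteq> 0"
  shows "q powi e \<in> localization S Q"
proof -
  have "inverse q * Q ^ 1 = w"
    using assms by simp
  then have "inverse q \<in> localization S Q"
    using assms(2) unfolding localization_def by (intro CollectI exI[of _ 1]) simp
  then show ?thesis
    using subset_localization assms(1)
    by (auto simp: power_int_def intro!: semiring_closed_power[OF semiring_closed_localization])
qed

end

lemma localization_prod_powi:
  assumes S: "semiring_closed S" and K: "finite K" and q: "\<And>k. k \<in> K \<Longrightarrow> q k \<in> S \<and> q k \<noteq> 0"
  shows "k \<in> K \<Longrightarrow> q k powi e \<in> localization S (\<Prod>k\<in>K. q k)"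
proof (rule powi_localization[OF S])
  assume k: "k \<in> K"
  show "(\<Prod>k\<in>K. q k) = q k * (\<Prod>k\<in>K - {k}. q k)"
    using K k by (rule prod.remove)
qed (use S K q in \<open>auto intro!: semiring_closed_prod\<close>)

lemma localizationE:
  fixes q :: "'i \<Rightarrow> 'a::field"
  assumes "u \<in> localization S (\<Prod>k\<in>K. q k)" "finite K" "\<And>k. k \<in> K \<Longrightarrow> q k \<noteq> 0"
  obtains t M where "t \<in> S" "u = t * (\<Prod>k\<in>K. q k powi (- int M))"
proof -
  obtain M where M: "u * (\<Prod>k\<in>K. q k) ^ M \<in> S"
    using assms(1) unfolding localization_def by blast
  have "(\<Prod>k\<in>K. q k powi (- int M)) = inverse ((\<Prod>k\<in>K. q k) ^ M)"
    by (simp add: power_int_minus prod_power_distrib prod_inversef[symmetric] o_def)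
  then have "u = u * (\<Prod>k\<in>K. q k) ^ M * (\<Prod>k\<in>K. q k powi (- int M))"
    using assms(2,3) by simp
  then show ?thesis
    using M that by blast
qed


section \<open>Values of rational functions and dominance\<close>

text \<open>A relational form of \<open>rvalue\<close>: sums and products of values follow from
  arbitrary representatives, and uniqueness is shown once.\<close>

definition has_value :: "(nat \<Rightarrow> complex) \<Rightarrow> rfun \<Rightarrow> complex \<Rightarrow> bool" where
  "has_value x f v \<longleftrightarrow> (\<exists>p q. f = Fract p q \<and> mpoly_eval x q \<noteq> 0 \<and> v = mpoly_eval x p / mpoly_eval x q)"

lemma has_value_unique:
  assumes "has_value x f v" "has_value x f w"
  shows "v = w"
proof -
  obtain p q p' q' where f: "f = Fract p q" "mpoly_eval x q \<noteq> 0" "v = mpoly_eval x p / mpoly_eval x q"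
    and f': "f = Fract p' q'" "mpoly_eval x q' \<noteq> 0" "w = mpoly_eval x p' / mpoly_eval x q'"
    using assms unfolding has_value_def by blast
  have "q \<noteq> 0" "q' \<noteq> 0"
    using f(2) f'(2) by auto
  then have "p * q' = p' * q"
    using f(1) f'(1) by (simp add: eq_fract)
  then have "mpoly_eval x p * mpoly_eval x q' = mpoly_eval x p' * mpoly_eval x q"
    by (metis mpoly_eval_mult)
  then show ?thesis
    using f f' by (simp add: frac_eq_eq)
qed

lemma
  assumes "has_value x f v" "has_value x g w"
  shows has_value_add: "has_value x (f + g) (v + w)"
    and has_value_mult: "has_value x (f * g) (v * w)"
proof -
  obtain p q p' q' where f: "f = Fract p q" "mpoly_eval x q \<noteq> 0" "v = mpoly_eval x p / mpoly_eval x q"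
    and g: "g = Fract p' q'" "mpoly_eval x q' \<noteq> 0" "w = mpoly_eval x p' / mpoly_eval x q'"
    using assms unfolding has_value_def by blast
  have "q \<noteq> 0" "q' \<noteq> 0"
    using f(2) g(2) by auto
  then have "f + g = Fract (p * q' + p' * q) (q * q')" "f * g = Fract (p * p') (q * q')"
    using f(1) g(1) by simp_all
  moreover have "v + w = mpoly_eval x (p * q' + p' * q) / mpoly_eval x (q * q')"
    "v * w = mpoly_eval x (p * p') / mpoly_eval x (q * q')" "mpoly_eval x (q * q') \<noteq> 0"
    using f(2) g(2) by (simp_all add: f(3) g(3) add_frac_eq)
  ultimately show "has_value x (f + g) (v + w)" "has_value x (f * g) (v * w)"
    unfolding has_value_def by blast+
qed

lemma has_value_to_fract: "has_value x (to_fract p) (mpoly_eval x p)"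
  unfolding has_value_def to_fract_def by (intro exI[of _ p] exI[of _ 1]) simp

lemma has_value_mpoly_subst:
  assumes "p \<in> mpolys A" "\<And>i. i \<in> A \<Longrightarrow> has_value x (\<phi> i) (v i)"
  shows "has_value x (mpoly_subst \<phi> p) (mpoly_eval v p)"
proof -
  let ?S = "{p. has_value x (mpoly_subst \<phi> p) (mpoly_eval v p)}"
  have "p \<in> ?S"
  proof (rule mpolys_generated[OF assms(1)])
    show "semiring_closed ?S"
      using has_value_to_fract[of x 0] has_value_to_fract[of x 1]
      by (simp add: semiring_closed_def mpoly_subst_add mpoly_subst_mult has_value_add has_value_mult)
    show "Const a \<in> ?S" for a
      using has_value_to_fract[of x "Const a"] by simp
  qed (use assms(2) in auto)
  then show ?thesis
    by blast
qed

lemma has_value_rvalue: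
  assumes "regular_at d x f"
  shows "has_value x f (rvalue d f x)"
proof -
  obtain p q where pq: "p \<in> mpolys {1..d}" "q \<in> mpolys {1..d}" "f = Fract p q" "mpoly_eval x q \<noteq> 0"
    using assms unfolding regular_at_def by blast
  have "rvalue d f x = mpoly_eval x p / mpoly_eval x q"
    unfolding rvalue_def
  proof (rule the_equality)
    fix v assume "\<exists>p\<in>mpolys {1..d}. \<exists>q\<in>mpolys {1..d}.
        f = Fract p q \<and> mpoly_eval x q \<noteq> 0 \<and> v = mpoly_eval x p / mpoly_eval x q"
    then have "has_value x f v"
      unfolding has_value_def by blast
    moreover have "has_value x f (mpoly_eval x p / mpoly_eval x q)"
      unfolding has_value_def using pq by blast
    ultimately show "v = mpoly_eval x p / mpoly_eval x q"
      by (rule has_value_unique)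
  qed (use pq in blast)
  then show ?thesis
    unfolding has_value_def using pq by blast
qed

text \<open>A relation among the components vanishes on the image; density spreads this to the whole
  affine space, where only the zero polynomial vanishes.\<close>

lemma dominant_imp_alg_indep:
  assumes "dominant_ratmap r s \<Psi>"
  shows "alg_indep {1..s} \<Psi>"
  unfolding alg_indep_def
proof (intro ballI impI notI)
  fix R assume R: "R \<in> mpolys {1..s}" "R \<noteq> 0" and R0: "mpoly_subst \<Psi> R = 0"
  have "ratmap_image r s \<Psi> \<subseteq> zero_set s R"
  proof
    fix y assume "y \<in> ratmap_image r s \<Psi>"
    then obtain x where y: "y = (\<lambda>i. if i \<in> {1..s} then rvalue r (\<Psi> i) x else 0)"
      and reg: "\<forall>i\<in>{1..s}. regular_at r x (\<Psi> i)"
      unfolding ratmap_image_def by blast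
    have "has_value x (mpoly_subst \<Psi> R) (mpoly_eval y R)"
      using R(1) by (rule has_value_mpoly_subst) (use reg in \<open>simp add: y has_value_rvalue\<close>)
    then have "mpoly_eval y R = 0"
      using has_value_unique has_value_to_fract[of x 0] R0 by auto
    then show "y \<in> zero_set s R"
      by (simp add: zero_set_def affine_space_def y)
  qed
  then have "zero_set s R = affine_space s"
    using assms R(1) unfolding dominant_ratmap_def zariski_dense_def by blast
  then have "mpoly_eval y R = 0" if "\<forall>i. i \<notin> {1..s} \<longrightarrow> y i = 0" for y
    using that by (auto simp: zero_set_def affine_space_def)
  then have "R = 0"
    by (intro mpolys_zero_set[OF _ R(1)]) auto
  with R(2) show False
    by blast
qed

lemma to_fract_rfuns: "p \<in> mpolys A \<Longrightarrow> to_fract p \<in> rfuns A"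
  unfolding rfuns_def to_fract_def by (force intro: exI[of _ p] exI[of _ 1])

lemma semiring_closed_rfuns: "semiring_closed (rfuns A)"
proof -
  have "u + v \<in> rfuns A" "u * v \<in> rfuns A" if "u \<in> rfuns A" "v \<in> rfuns A" for u v
  proof -
    obtain p q where u: "u = Fract p q" "q \<noteq> 0" "p \<in> mpolys A" "q \<in> mpolys A"
      using \<open>u \<in> rfuns A\<close> unfolding rfuns_def by blast
    obtain p' q' where v: "v = Fract p' q'" "q' \<noteq> 0" "p' \<in> mpolys A" "q' \<in> mpolys A"
      using \<open>v \<in> rfuns A\<close> unfolding rfuns_def by blast
    note pq = u v
    then have eqs: "u + v = Fract (p * q' + p' * q) (q * q')" "u * v = Fract (p * p') (q * q')"
      by simp_all
    have "q * q' \<noteq> 0"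
      using pq by simp
    then show "u + v \<in> rfuns A" "u * v \<in> rfuns A"
      unfolding eqs rfuns_def using pq by (blast intro: mpolys_add mpolys_mult)+
  qed
  moreover have "0 \<in> rfuns A" "1 \<in> rfuns A"
    using to_fract_rfuns[OF mpolys_0] to_fract_rfuns[OF mpolys_1] by simp_all
  ultimately show ?thesis
    unfolding semiring_closed_def by blast
qed

lemma mpoly_subst_rfuns:
  "p \<in> mpolys B \<Longrightarrow> (\<And>i. i \<in> B \<Longrightarrow> \<phi> i \<in> rfuns A) \<Longrightarrow> mpoly_subst \<phi> p \<in> rfuns A"
  unfolding mpoly_subst_def
  by (intro insertion_closed[where A = B] semiring_closed_rfuns to_fract_rfuns) auto

lemma rsubst_dom_rfuns:
  assumes "alg_indep A \<phi>" "f \<in> rfuns A"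
  shows "rsubst_dom \<phi> f" and "f \<noteq> 0 \<Longrightarrow> rsubst \<phi> f \<noteq> 0"
proof -
  obtain p q where f: "f = Fract p q" "q \<noteq> 0" "p \<in> mpolys A" "q \<in> mpolys A"
    using assms(2) unfolding rfuns_def by blast
  then have q: "mpoly_subst \<phi> q \<noteq> 0"
    using assms(1) by (simp add: alg_indep_def)
  then show "rsubst_dom \<phi> f"
    using f by (simp add: rsubst_dom_Fract)
  assume "f \<noteq> 0"
  then have "p \<noteq> 0"
    using f by (auto simp: fract_collapse)
  then show "rsubst \<phi> f \<noteq> 0"
    using f q assms(1) by (simp add: rsubst_Fract alg_indep_def)
qed


section \<open>Algebraic independence\<close>

text \<open>If one of two irreducible polynomials divides the other, they differ by a constant
  factor, and this proportionality is a linear relation.\<close>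

lemma alg_indep_irreducible_prime_family:
  assumes ind: "alg_indep A \<phi>" and A: "finite A"
    and f: "\<And>i. i \<in> A \<Longrightarrow> \<phi> i = to_fract (f i)" "\<And>i. i \<in> A \<Longrightarrow> irreducible (f i)"
  shows "prime_family A f"
proof -
  have "i = j" if ij: "i \<in> A" "j \<in> A" "f i dvd f j" for i j
  proof (rule ccontr)
    assume ne: "i \<noteq> j"
    obtain c where c: "f j = f i * c"
      using ij(3) by blast
    moreover have "\<not> f i dvd 1"
      using f(2)[OF ij(1)] by (simp add: irreducible_def)
    ultimately have "c dvd 1"
      using f(2)[OF ij(2)] irreducibleD by blast
    then obtain a where a: "c = Const a"
      by (auto simp: mpoly_unit_iff)
    let ?R = "Var j - Const a * Var i"
    have "mpoly_eval (\<lambda>k. if k = j then 1 else 0) ?R = 1"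
      using ne by (simp add: ring_map.diff[OF ring_map_mpoly_eval])
    then have "?R \<noteq> 0"
      by auto
    moreover have "?R \<in> mpolys A"
      using ij by (intro mpolys_diff mpolys_mult) auto
    ultimately have "mpoly_subst \<phi> ?R \<noteq> 0"
      using ind by (simp add: alg_indep_def)
    then show False
      using f(1) ij c a by (simp add: mpoly_subst_diff mpoly_subst_mult)
  qed
  then show ?thesis
    unfolding prime_family_def using A f(2) mpoly_irreducible_imp_prime_elem by blast
qed

lemma prime_elem_Var: "prime_elem (Var k :: mpoly)"
proof -
  have "Var k \<noteq> (0 :: mpoly)"
  proof
    assume "Var k = (0 :: mpoly)"
    then have "mpoly_eval (\<lambda>_. 1) (Var k) = 0"
      by (simp only: mpoly_eval_0)
    then show False
      by simp
  qed
  then show ?thesis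
    by (auto simp: prime_elem_def Var_dvd_iff coeff_mult)
qed

lemma Var_dvd_Var_iff: "(Var k :: mpoly) dvd Var l \<longleftrightarrow> k = l"
proof -
  have "(Var l :: mpoly) \<noteq> 0"
    using prime_elem_Var[of l] by (auto simp: prime_elem_def)
  then show ?thesis
    by (auto simp: Var_dvd_iff upoly_Var)
qed

lemma prime_family_Var: "finite K \<Longrightarrow> prime_family K Var"
  by (simp add: prime_family_def prime_elem_Var Var_dvd_Var_iff)

lemma mpoly_eval_at_0:
  assumes "y k = 0"
  shows "mpoly_eval y p = mpoly_eval y (coeff (upoly k p) 0)"
proof -
  have "y(k := 0) = y"
    using assms by auto
  then show ?thesis
    using mpoly_eval_upd[of y k 0 p] by (simp add: poly_0_coeff_0 coeff_map_poly)
qed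

text \<open>Where \<open>\<phi> k\<close> vanishes, \<open>R\<close> may be replaced by its constant
  coefficient in \<open>Var k\<close>. That coefficient is nonzero as \<open>Var k\<close> does not
  divide \<open>R\<close>, and it involves only the variables that are independent on
  \<open>W\<close>.\<close>

lemma alg_indep_on_boundary:
  assumes ind: "alg_indep_on W (A - {k}) \<phi>" and W: "\<And>x. x \<in> W \<Longrightarrow> mpoly_eval x (\<phi> k) = 0"
    and R: "R \<in> mpolys A" "\<not> Var k dvd R"
  shows "\<exists>x\<in>W. mpoly_eval x (psubst \<phi> R) \<noteq> 0"
proof -
  let ?R = "coeff (upoly k R) 0"
  have "?R \<in> mpolys (A - {k})" "?R \<noteq> 0"
    using R coeff_upoly_mpolys by (auto simp: Var_dvd_iff)
  then obtain x where x: "x \<in> W" "mpoly_eval (\<lambda>l. mpoly_eval x (\<phi> l)) ?R \<noteq> 0"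
    using ind unfolding alg_indep_on_def by blast
  then have "mpoly_eval x (psubst \<phi> R) \<noteq> 0"
    using W mpoly_eval_at_0[of "\<lambda>l. mpoly_eval x (\<phi> l)" k R] by (simp add: mpoly_eval_psubst)
  with x(1) show ?thesis
    by blast
qed

text \<open>A relation for the exchanged family is homogenized: multiplying it by a power of \<open>\<phi> m\<close>
  turns the powers of \<open>t\<close> into powers of \<open>P\<close>, that is, into a relation for \<open>\<phi>\<close>.\<close>

lemma alg_indep_on_exchange:
  assumes ind: "alg_indep_on W A \<phi>" and m: "m \<in> A"
    and P: "P \<in> mpolys (A - {m})" "P \<noteq> 0"
    and ex: "\<And>x. x \<in> W \<Longrightarrow> mpoly_eval x (\<phi> m) * mpoly_eval x t = mpoly_eval x (psubst \<phi> P)"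
  shows "alg_indep_on W A (\<phi>(m := t))"
  unfolding alg_indep_on_def
proof (intro ballI impI notI)
  fix R assume R: "R \<in> mpolys A" "R \<noteq> 0"
    and R0: "\<forall>x\<in>W. mpoly_eval (\<lambda>l. mpoly_eval x ((\<phi>(m := t)) l)) R = 0"
  let ?c = "\<lambda>j. coeff (upoly m R) j" and ?d = "deg_in m R"
  define R' where "R' = (\<Sum>j\<le>?d. ?c j * P ^ j * Var m ^ (?d - j))"
  have c: "?c j \<in> mpolys (A - {m})" for j
    using R(1) by (rule coeff_upoly_mpolys)
  have "R' \<in> mpolys A"
    unfolding R'_def using c P(1) m
    by (intro mpolys_sum mpolys_mult mpolys_power) (auto intro: mpolys_mono)
  moreover have "R' \<noteq> 0"
  proof -
    have "upoly m (?c j * P ^ j) = [:?c j * P ^ j:]" for j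
      using c P(1) by (intro upoly_free[where A = "A - {m}"] mpolys_mult mpolys_power) auto
    moreover have "upoly m (Var m) = monom 1 1"
      by (simp add: upoly_Var monom_altdef)
    ultimately have "upoly m R' = (\<Sum>j\<le>?d. monom (?c j * P ^ j) (?d - j))"
      unfolding R'_def
      by (simp add: upoly_sum upoly_power monom_power smult_monom del: upoly_mult)
        (simp add: ring_map.mult[OF ring_map_upoly, of _ "_ * _"] ring_map.mult[OF ring_map_upoly] upoly_power monom_power smult_monom)
    \<comment> \<open>Setting \<open>Var m\<close> to 0 leaves only the summand with
      \<open>j = ?d\<close>, the leading coefficient of \<open>R\<close> times a power of
      \<open>P\<close>; so homogenizing has not produced the zero polynomial.\<close>
    then have "coeff (upoly m R') 0 = (\<Sum>j\<le>?d. if j = ?d then ?c j * P ^ j else 0)"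
      by (auto simp: coeff_sum intro!: sum.cong)
    then have "coeff (upoly m R') 0 \<noteq> 0"
      using R(2) P(2) by simp
    then show ?thesis
      by auto
  qed
  ultimately obtain x where x: "x \<in> W" "mpoly_eval (\<lambda>l. mpoly_eval x (\<phi> l)) R' \<noteq> 0"
    using ind unfolding alg_indep_on_def by blast
  let ?y = "\<lambda>l. mpoly_eval x (\<phi> l)" and ?t = "mpoly_eval x t"
  have t: "?y m * ?t = mpoly_eval ?y P"
    using ex[OF x(1)] by (simp add: mpoly_eval_psubst)
  have "(\<lambda>l. mpoly_eval x ((\<phi>(m := t)) l)) = ?y(m := ?t)"
    by auto
  then have "mpoly_eval (?y(m := ?t)) R = 0"
    using R0 x(1) by metis
  then have "0 = ?y m ^ ?d * mpoly_eval (?y(m := ?t)) R"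
    by simp
  also have "\<dots> = ?y m ^ ?d * (\<Sum>j\<le>?d. mpoly_eval ?y (?c j) * ?t ^ j)"
    by (simp only: mpoly_eval_upd_sum)
  also have "\<dots> = (\<Sum>j\<le>?d. mpoly_eval ?y (?c j) * mpoly_eval ?y P ^ j * ?y m ^ (?d - j))"
    unfolding sum_distrib_left
  proof (rule sum.cong)
    fix j assume "j \<in> {..?d}"
    then have "?y m ^ ?d = ?y m ^ j * ?y m ^ (?d - j)"
      by (simp flip: power_add)
    then show "?y m ^ ?d * (mpoly_eval ?y (?c j) * ?t ^ j) =
        mpoly_eval ?y (?c j) * mpoly_eval ?y P ^ j * ?y m ^ (?d - j)"
      by (simp add: t[symmetric] power_mult_distrib mult_ac)
  qed simp
  also have "\<dots> = mpoly_eval ?y R'"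
    by (simp add: R'_def mpoly_eval_sum)
  finally show False
    using x(2) by simp
qed

text \<open>A relation that holds everywhere might vanish on the hypersurface merely through a
  factor \<open>Var k\<close>. With these factors removed it is nonzero somewhere on the
  hypersurface, and restoring them multiplies a nonzero polynomial by a power of
  \<open>\<phi> k\<close>.\<close>

lemma alg_indep_on_hypersurface_imp_indep:
  assumes ind: "alg_indep_on (zero_set r (\<phi> k)) ({1..r} - {k}) \<phi>" and k: "k \<in> {1..r}"
    and \<phi>: "\<And>l. l \<in> {1..r} \<Longrightarrow> \<phi> l \<in> mpolys {1..r}" "\<phi> k \<noteq> 0"
  shows "alg_indep_on (affine_space r) {1..r} \<phi>"
  unfolding alg_indep_on_def
proof (intro ballI impI notI)
  fix R assume R: "R \<in> mpolys {1..r}" "R \<noteq> 0"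
    and R0: "\<forall>x\<in>affine_space r. mpoly_eval (\<lambda>l. mpoly_eval x (\<phi> l)) R = 0"
  have "\<not> (Var k :: mpoly) dvd 1"
    using prime_elem_Var[of k] by (auto simp: prime_elem_def)
  then obtain T c where T: "R = T * (\<Prod>i\<in>{k}. Var i ^ c i)" "\<not> Var k dvd T"
    using ex_primitive_factorization[OF R(2), of "{k}" Var] by auto
  have "T \<in> mpolys {1..r}"
    using T(1) R by (metis dvd_mpolys dvd_triv_left)
  then obtain x where "mpoly_eval x (psubst \<phi> T) \<noteq> 0"
    using alg_indep_on_boundary[OF ind _ _ T(2)] unfolding zero_set_def by blast
  then have "psubst \<phi> T \<noteq> 0"
    by auto
  moreover have "psubst \<phi> R = psubst \<phi> T * \<phi> k ^ c k"
    unfolding T(1) psubst_def by (simp add: insertion_mult ring_map_Const insertion_Var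
        ring_map.power[OF ring_map_insertion[OF ring_map_Const]])
  ultimately have "psubst \<phi> R \<noteq> 0"
    using \<phi>(2) by simp
  moreover have "psubst \<phi> R \<in> mpolys {1..r}"
    using R(1) \<phi>(1) by (rule psubst_mpolys)
  ultimately obtain x where "\<forall>i. i \<notin> {1..r} \<longrightarrow> x i = 0" "mpoly_eval x (psubst \<phi> R) \<noteq> 0"
    using ex_nonzero_value by blast
  then show False
    using R0 by (simp add: affine_space_def mpoly_eval_psubst)
qed


section \<open>Pulling back regular functions\<close>

lemma prod_powi:
  fixes f :: "'i \<Rightarrow> 'a::field"
  shows "(\<Prod>k\<in>K. f k) powi z = (\<Prod>k\<in>K. f k powi z)"
  by (induction K rule: infinite_finite_induct) (auto simp: power_int_mult_distrib)

lemma prod_powi_uminus: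
  fixes f :: "'i \<Rightarrow> 'a::field"
  shows "(\<Prod>k\<in>K. f k powi (- e k)) = inverse (\<Prod>k\<in>K. f k powi e k)"
  by (simp add: power_int_minus prod_inversef[symmetric] o_def)

lemma semiring_closed_to_fract_mpolys: "semiring_closed (to_fract ` mpolys A)"
  unfolding semiring_closed_def
proof (intro conjI ballI)
  fix u v assume "u \<in> to_fract ` mpolys A" "v \<in> to_fract ` mpolys A"
  then obtain p q where "p \<in> mpolys A" "q \<in> mpolys A" "u = to_fract p" "v = to_fract q"
    by blast
  then show "u + v \<in> to_fract ` mpolys A" "u * v \<in> to_fract ` mpolys A"
    using mpolys_add[of p A q] mpolys_mult[of p A q]
    by (metis imageI to_fract_add, metis imageI to_fract_mult)
next
  show "0 \<in> to_fract ` mpolys A" "1 \<in> to_fract ` mpolys A"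
    using imageI[OF mpolys_0, of to_fract A] imageI[OF mpolys_1, of to_fract A] by simp_all
qed

lemma semiring_closed_mpoly_subst_mpolys: "semiring_closed (mpoly_subst \<phi> ` mpolys A)"
  unfolding semiring_closed_def
proof (intro conjI ballI)
  fix u v assume "u \<in> mpoly_subst \<phi> ` mpolys A" "v \<in> mpoly_subst \<phi> ` mpolys A"
  then obtain p q where "p \<in> mpolys A" "q \<in> mpolys A" "u = mpoly_subst \<phi> p" "v = mpoly_subst \<phi> q"
    by blast
  then show "u + v \<in> mpoly_subst \<phi> ` mpolys A" "u * v \<in> mpoly_subst \<phi> ` mpolys A"
    using mpolys_add[of p A q] mpolys_mult[of p A q]
    by (metis imageI mpoly_subst_add, metis imageI mpoly_subst_mult)
next
  show "0 \<in> mpoly_subst \<phi> ` mpolys A" "1 \<in> mpoly_subst \<phi> ` mpolys A"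
    using imageI[OF mpolys_0, of "mpoly_subst \<phi>" A] imageI[OF mpolys_1, of "mpoly_subst \<phi>" A] by simp_all
qed

abbreviation poly_localization :: "nat set \<Rightarrow> 'i set \<Rightarrow> ('i \<Rightarrow> mpoly) \<Rightarrow> rfun set" where
  "poly_localization A K q \<equiv> localization (to_fract ` mpolys A) (\<Prod>k\<in>K. to_fract (q k))"

lemma poly_localization_form:
  assumes q: "prime_family K q" and u: "u \<in> poly_localization A K q" "u \<noteq> 0"
  shows "\<exists>p e. p \<in> mpolys A \<and> (\<forall>k\<in>K. \<not> q k dvd p) \<and> (\<forall>k. k \<notin> K \<longrightarrow> e k = 0) \<and>
    u = to_fract p * (\<Prod>k\<in>K. to_fract (q k) powi (- e k))"
proof -
  have fin: "finite K"
    using q by (simp add: prime_family_def)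
  have nz: "to_fract (q k) \<noteq> 0" if "k \<in> K" for k
    using prime_family_nonzero[OF q that] by simp
  obtain t M where t: "t \<in> to_fract ` mpolys A" "u = t * (\<Prod>k\<in>K. to_fract (q k) powi (- int M))"
    using localizationE[OF u(1) fin nz] by blast
  then obtain a where a: "a \<in> mpolys A" "t = to_fract a"
    by blast
  show ?thesis
  proof (rule ex_form[OF fin])
    show "u = to_fract a * (\<Prod>k\<in>K. to_fract (q k) powi (- int M))"
      using t(2) a(2) by simp
    then show "a \<noteq> 0"
      using u(2) by auto
  qed (use q a(1) in \<open>auto simp: prime_family_def prime_elem_def\<close>)
qed

lemma
  assumes q: "finite K" "\<And>k. k \<in> K \<Longrightarrow> q k \<in> mpolys A" "\<And>k. k \<in> K \<Longrightarrow> q k \<noteq> 0"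
  shows semiring_closed_poly_localization: "semiring_closed (poly_localization A K q)"
    and to_fract_poly_localization: "p \<in> mpolys A \<Longrightarrow> to_fract p \<in> poly_localization A K q"
    and powi_poly_localization: "k \<in> K \<Longrightarrow> to_fract (q k) powi e \<in> poly_localization A K q"
proof -
  have Q: "(\<Prod>k\<in>K. to_fract (q k)) \<in> to_fract ` mpolys A"
    using q(2) by (intro semiring_closed_prod semiring_closed_to_fract_mpolys) auto
  show cl: "semiring_closed (poly_localization A K q)"
    by (rule semiring_closed_localization[OF semiring_closed_to_fract_mpolys Q])
  show "to_fract p \<in> poly_localization A K q" if "p \<in> mpolys A"
    using subset_localization[OF semiring_closed_to_fract_mpolys Q] that by blast
  show "to_fract (q k) powi e \<in> poly_localization A K q" if "k \<in> K"
    by (rule localization_prod_powi[OF semiring_closed_to_fract_mpolys q(1) _ that]) (use q in auto)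
qed

lemma pole_form_the:
  assumes "prime_family K q" "pole_form d K q u p e"
  shows "(THE p. \<exists>e. pole_form d K q u p e) = p" "(THE e. \<exists>p. pole_form d K q u p e) = e"
  by (rule the_equality; use assms(2) pole_form_unique[OF assms] in blast)+

section \<open>The setting of the theorem; existence and uniqueness of pullback forms\<close>

locale regular_pullback =
  fixes n :: nat and D :: pullback_data and S0 :: seed
  assumes valid: "valid_pullback_data D"
    and cluster_structure: "gen_cluster_structure n (sdim D) (gind D) S0"
    and gind_frozen: "gind D \<subseteq> {n<..sdim D}"
    and cluster_g: "\<forall>i \<in> gind D. cluster S0 i = to_fract (gpol D i)"
    and regular: "\<forall>S \<in> seeds n (sdim D) S0. \<forall>l \<in> {1..sdim D}.
           regular_on (sdim D) (quasi_affine D) (cluster S l)"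
    and independent: "\<forall>k \<in> kind D. alg_indep_on (zero_set (rdim D) (qpol D k)) ({1..rdim D} - {k})
           (pullback_family D S0)"
begin

abbreviation "ds \<equiv> sdim D"
abbreviation "dr \<equiv> rdim D"
abbreviation "G \<equiv> gind D"
abbreviation "H \<equiv> hind D"
abbreviation "K \<equiv> kind D"
abbreviation "g \<equiv> gpol D"
abbreviation "h \<equiv> hpol D"
abbreviation "q \<equiv> qpol D"
abbreviation "\<Psi> \<equiv> psi D"
abbreviation "all_seeds \<equiv> seeds n ds S0"

lemma ds_le_dr: "ds \<le> dr"
  using valid by (simp add: valid_pullback_data_def)

lemma H_eq: "H = {ds<..dr}"
  by (simp add: hind_def)

lemma K_eq: "K = G \<union> H"
  by (simp add: kind_def)

lemma fin: "finite G" "finite H" "finite K"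
proof -
  show "finite G"
    using gind_frozen by (rule finite_subset) simp
  then show "finite H" "finite K"
    by (simp_all add: H_eq K_eq)
qed

lemma GH: "G \<inter> H = {}" "G \<subseteq> {1..ds}"
proof -
  show "G \<subseteq> {1..ds}"
    using gind_frozen by auto
  then show "G \<inter> H = {}"
    by (auto simp: H_eq)
qed

lemma K_sub: "K \<subseteq> {1..dr}" "K \<inter> {1..n} = {}" "K \<inter> {1..ds} = G"
proof -
  have n: "n \<le> ds"
    using cluster_structure seeds.initial[of S0 n ds] by (auto simp: gen_cluster_structure_def is_seed_def)
  show "K \<subseteq> {1..dr}" "K \<inter> {1..ds} = G"
    using GH(2) ds_le_dr by (auto simp: K_eq H_eq)
  show "K \<inter> {1..n} = {}"
    using gind_frozen n by (auto simp: K_eq H_eq)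
qed

lemma prod_K: "(\<Prod>k\<in>K. f k) = (\<Prod>k\<in>G. f k) * (\<Prod>k\<in>H. f k)"
  unfolding K_eq by (rule prod.union_disjoint) (use fin GH in auto)

lemma g_irreducible: "i \<in> G \<Longrightarrow> irreducible (g i)" "i \<in> G \<Longrightarrow> g i \<in> mpolys {1..ds}"
  and h_irreducible: "j \<in> H \<Longrightarrow> irreducible (h j)" "j \<in> H \<Longrightarrow> h j \<in> mpolys {1..dr}"
  using valid by (auto simp: valid_pullback_data_def)

lemma seed: "S \<in> all_seeds \<Longrightarrow> is_seed n ds G S"
  using cluster_structure by (simp add: gen_cluster_structure_def)

lemma cluster_frozen: "S \<in> all_seeds \<Longrightarrow> i \<in> G \<Longrightarrow> cluster S i = to_fract (g i)"
proof (induction S rule: seeds.induct)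
  case (adjacent S m)
  then have "i \<noteq> m"
    using gind_frozen by auto
  then show ?case
    using adjacent by (simp add: mutate_def)
qed (use cluster_g in simp)

lemma alg_indep_cluster: "S \<in> all_seeds \<Longrightarrow> alg_indep {1..ds} (cluster S)"
  using seed by (simp add: is_seed_def)

lemma alg_indep_nonzero:
  assumes "alg_indep A \<phi>" "i \<in> A"
  shows "\<phi> i \<noteq> 0"
proof -
  have "Var i \<noteq> (0 :: mpoly)"
    using prime_elem_Var[of i] by (auto simp: prime_elem_def)
  then show ?thesis
    using assms unfolding alg_indep_def by (metis Var_mpolys mpoly_subst_Var)
qed

lemma cluster_nonzero: "S \<in> all_seeds \<Longrightarrow> l \<in> {1..ds} \<Longrightarrow> cluster S l \<noteq> 0"
  using alg_indep_cluster alg_indep_nonzero by blast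

lemma cluster_rfuns: "S \<in> all_seeds \<Longrightarrow> l \<in> {1..ds} \<Longrightarrow> cluster S l \<in> rfuns {1..ds}"
  using seed by (simp add: is_seed_def)

text \<open>Distinct irreducible polynomials may still be proportional; here that is excluded
  because the \<open>g i\<close> belong to the initial cluster and are thus independent.\<close>

lemma prime_family_g: "prime_family G g"
proof (rule alg_indep_irreducible_prime_family[where \<phi> = "cluster S0"])
  show "alg_indep G (cluster S0)"
    using alg_indep_cluster[OF seeds.initial] GH(2) unfolding alg_indep_def
    by (blast intro: mpolys_mono)
qed (use fin cluster_g g_irreducible in auto)

lemma prime_family_h: "prime_family H h"
proof (rule alg_indep_irreducible_prime_family[where \<phi> = "\<lambda>j. to_fract (h j)"])
  show "alg_indep H (\<lambda>j. to_fract (h j))"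
    using valid by (simp add: valid_pullback_data_def)
qed (use fin h_irreducible in auto)

lemma alg_indep_psi: "alg_indep {1..ds} \<Psi>"
  using valid dominant_imp_alg_indep unfolding valid_pullback_data_def by blast

lemma pullback_dom: "f \<in> rfuns {1..ds} \<Longrightarrow> rsubst_dom \<Psi> f"
  and pullback_nonzero: "f \<in> rfuns {1..ds} \<Longrightarrow> f \<noteq> 0 \<Longrightarrow> pullback D f \<noteq> 0"
  unfolding pullback_def using rsubst_dom_rfuns[OF alg_indep_psi] by auto

text \<open>The polynomials on the source with all \<open>h j\<close> inverted. The pullbacks of the
  coordinates lie here, hence those of all polynomials.\<close>

abbreviation "LH \<equiv> poly_localization {1..dr} H h"

lemma h_nonzero: "j \<in> H \<Longrightarrow> h j \<noteq> 0"
  using prime_family_nonzero[OF prime_family_h] .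

lemma semiring_closed_LH: "semiring_closed LH"
  and to_fract_LH: "p \<in> mpolys {1..dr} \<Longrightarrow> to_fract p \<in> LH"
  and powi_LH: "j \<in> H \<Longrightarrow> to_fract (h j) powi e \<in> LH"
  by (rule semiring_closed_poly_localization to_fract_poly_localization powi_poly_localization;
      use fin h_irreducible(2) h_nonzero in blast)+

lemma pullback_poly_LH:
  assumes "p \<in> mpolys {1..ds}"
  shows "mpoly_subst \<Psi> p \<in> LH"
  unfolding mpoly_subst_def
proof (rule insertion_closed[OF semiring_closed_LH _ _ assms])
  fix m assume "m \<in> {1..ds}"
  then obtain y \<kappa> where "pole_form dr H h (\<Psi> m) y \<kappa>"
    using valid unfolding valid_pullback_data_def by blast
  then have y: "y \<in> mpolys {1..dr}" and eq: "\<Psi> m = to_fract y * (\<Prod>j\<in>H. to_fract (h j) powi (- \<kappa> j))"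
    by (simp_all add: pole_form_def)
  show "\<Psi> m \<in> LH"
    unfolding eq using y by (intro semiring_closed_mult[OF semiring_closed_LH]
        semiring_closed_prod[OF semiring_closed_LH] to_fract_LH powi_LH)
qed (rule to_fract_LH, rule Const_mpolys)

lemma pullback_poly_form:
  assumes "p \<in> mpolys {1..ds}" "p \<noteq> 0"
  shows "pole_form dr H h (pullback D (to_fract p)) (pullback_poly D p) (kappa D p)"
proof -
  have "mpoly_subst \<Psi> p \<noteq> 0"
    using alg_indep_psi assms by (simp add: alg_indep_def)
  then obtain y \<kappa> where "pole_form dr H h (pullback D (to_fract p)) y \<kappa>"
    using poly_localization_form[OF prime_family_h pullback_poly_LH[OF assms(1)]]
    unfolding pole_form_def pullback_def rsubst_to_fract by blast
  with pole_form_the[OF prime_family_h this] show ?thesis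
    unfolding pullback_poly_def kappa_def by simp
qed

lemma q_h: "j \<in> H \<Longrightarrow> q j = h j"
  using GH(1) by (auto simp: qpol_def)

lemma q_g_form: "i \<in> G \<Longrightarrow> pole_form dr H h (pullback D (to_fract (g i))) (q i) (kappa D (g i))"
  using pullback_poly_form[OF g_irreducible(2)] prime_family_nonzero[OF prime_family_g]
  by (simp add: qpol_def)

lemma pullback_g: "i \<in> G \<Longrightarrow>
    pullback D (to_fract (g i)) = to_fract (q i) * (\<Prod>j\<in>H. to_fract (h j) powi (- kappa D (g i) j))"
  using q_g_form by (simp add: pole_form_def)

lemma pullback_g_nonzero: "i \<in> G \<Longrightarrow> pullback D (to_fract (g i)) \<noteq> 0"
  using prime_family_nonzero[OF prime_family_g]
  by (intro pullback_nonzero to_fract_rfuns g_irreducible(2)) auto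

lemma q_nonzero: "k \<in> K \<Longrightarrow> q k \<noteq> 0"
  using pullback_g pullback_g_nonzero q_h h_nonzero by (fastforce simp: K_eq)

lemma q_mpolys: "k \<in> K \<Longrightarrow> q k \<in> mpolys {1..dr}"
  using q_g_form q_h h_irreducible(2) by (auto simp: K_eq pole_form_def)

text \<open>Exponents along \<open>G\<close> are determined on the target, where the
  \<open>g i\<close> are prime. Once they agree, the powers of the \<open>q i\<close> cancel on the
  source and only the primes \<open>h j\<close> remain.\<close>

lemma pullback_form_unique:
  assumes "pullback_form D f p e" "pullback_form D f p' e'"
  shows "p = p' \<and> e = e'"
proof -
  have *: "p \<in> mpolys {1..dr}" "\<forall>j\<in>H. \<not> h j dvd p" "\<forall>k. k \<notin> K \<longrightarrow> e k = 0"
    "p' \<in> mpolys {1..dr}" "\<forall>j\<in>H. \<not> h j dvd p'" "\<forall>k. k \<notin> K \<longrightarrow> e' k = 0"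
    using assms by (simp_all add: pullback_form_def)
  have eG: "e i = e' i" if "i \<in> G" for i
    using assms that pole_form_unique[OF prime_family_g] unfolding pullback_form_def by metis
  have "to_fract p * (\<Prod>k\<in>K. to_fract (q k) powi (- e k)) = to_fract p' * (\<Prod>k\<in>K. to_fract (q k) powi (- e' k))"
    using assms by (simp add: pullback_form_def)
  moreover have "(\<Prod>k\<in>G. to_fract (q k) powi (- e k)) = (\<Prod>k\<in>G. to_fract (q k) powi (- e' k))"
    by (rule prod.cong) (simp_all add: eG)
  moreover have "(\<Prod>k\<in>G. to_fract (q k) powi (- e' k)) \<noteq> 0"
    using q_nonzero fin by (auto simp: K_eq)
  ultimately have "to_fract p * (\<Prod>j\<in>H. to_fract (q j) powi (- e j)) = to_fract p' * (\<Prod>j\<in>H. to_fract (q j) powi (- e' j))"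
    by (simp add: prod_K)
  then have "to_fract p * (\<Prod>j\<in>H. to_fract (h j) powi (- e j)) = to_fract p' * (\<Prod>j\<in>H. to_fract (h j) powi (- e' j))"
    by (simp add: q_h)
  then have "p = p' \<and> (\<forall>j\<in>H. e j = e' j)"
    using * by (intro prime_family_form_unique[OF prime_family_h]) auto
  then have "e k = e' k" for k
    using eG *(3,6) by (cases "k \<in> K") (auto simp: K_eq)
  then show ?thesis
    using \<open>p = p' \<and> _\<close> by blast
qed

lemma pullback_form_the:
  assumes "pullback_form D f p e"
  shows "hat D f = p" "lam D f = e"
  unfolding hat_def lam_def
  by (rule the_equality; use assms pullback_form_unique[OF assms] in blast)+

lemma ex_pullback_form:
  assumes f: "f \<in> rfuns {1..ds}" "f \<noteq> 0" "regular_on ds (quasi_affine D) f"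
  shows "pullback_form D f (hat D f) (lam D f)"
proof -
  obtain f' e' where f': "pole_form ds G g f f' e'"
    using regular_pole_form[where g = g, OF f(1,2) fin(1) g_irreducible(2,1)] f(3) unfolding quasi_affine_def by blast
  then have fe: "f = to_fract f' * (\<Prod>i\<in>G. to_fract (g i) powi (- e' i))" and f'm: "f' \<in> mpolys {1..ds}"
    by (simp_all add: pole_form_def)
  \<comment> \<open>The pullback of each \<open>g i\<close> is \<open>q i\<close> times a monomial
    in the \<open>h j\<close>. Removing the powers of the \<open>q i\<close> therefore leaves an
    element of \<open>LH\<close>.\<close>
  define w where "w = pullback D f * (\<Prod>i\<in>G. to_fract (q i) powi e' i)"
  have gdom: "rsubst_dom \<Psi> (to_fract (g i))" "rsubst \<Psi> (to_fract (g i)) \<noteq> 0" if "i \<in> G" for i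
    using pullback_g_nonzero[OF that] unfolding pullback_def by simp_all
  have "pullback D f = mpoly_subst \<Psi> f' * (\<Prod>i\<in>G. pullback D (to_fract (g i)) powi (- e' i))"
    unfolding fe pullback_def
    by (subst rsubst_mult) (use gdom in \<open>auto simp: rsubst_dom_prod rsubst_prod rsubst_dom_powi rsubst_powi
        rsubst_to_fract[of \<Psi> f'] simp del: rsubst_to_fract\<close>)
  then have "w = mpoly_subst \<Psi> f' * (\<Prod>i\<in>G. pullback D (to_fract (g i)) powi (- e' i) * to_fract (q i) powi e' i)"
    by (simp add: w_def prod.distrib mult.assoc)
  also have "(\<Prod>i\<in>G. pullback D (to_fract (g i)) powi (- e' i) * to_fract (q i) powi e' i) =
      (\<Prod>i\<in>G. \<Prod>j\<in>H. to_fract (h j) powi (kappa D (g i) j * e' i))"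
  proof (rule prod.cong)
    fix i assume i: "i \<in> G"
    then have "to_fract (q i) \<noteq> 0"
      using q_nonzero by (simp add: K_eq)
    then have "to_fract (q i) powi (- e' i) * to_fract (q i) powi e' i = 1"
      by (simp add: power_int_minus)
    then have "pullback D (to_fract (g i)) powi (- e' i) * to_fract (q i) powi e' i =
        (\<Prod>j\<in>H. to_fract (h j) powi (- kappa D (g i) j)) powi (- e' i)"
      by (simp add: pullback_g[OF i] power_int_mult_distrib mult_ac)
    also have "\<dots> = (\<Prod>j\<in>H. to_fract (h j) powi (kappa D (g i) j * e' i))"
      by (simp add: prod_powi flip: power_int_mult)
    finally show "pullback D (to_fract (g i)) powi (- e' i) * to_fract (q i) powi e' i = \<dots>" .
  qed simp
  finally have weq: "w = mpoly_subst \<Psi> f' *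
      (\<Prod>i\<in>G. \<Prod>j\<in>H. to_fract (h j) powi (kappa D (g i) j * e' i))" .
  have "w \<in> LH"
    unfolding weq by (intro semiring_closed_mult[OF semiring_closed_LH]
        semiring_closed_prod[OF semiring_closed_LH] pullback_poly_LH[OF f'm] powi_LH)
  moreover have qG: "(\<Prod>i\<in>G. to_fract (q i) powi z i) \<noteq> 0" for z
    using q_nonzero fin by (auto simp: K_eq)
  then have "w \<noteq> 0"
    using pullback_nonzero[OF f(1,2)] by (simp add: w_def)
  ultimately obtain p e0 where p: "p \<in> mpolys {1..dr}" "\<forall>j\<in>H. \<not> h j dvd p"
    and w: "w = to_fract p * (\<Prod>j\<in>H. to_fract (h j) powi (- e0 j))"
    using poly_localization_form[OF prime_family_h] by blast
  define e where "e k = (if k \<in> G then e' k else if k \<in> H then e0 k else 0)" for k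
  have "(\<Prod>i\<in>G. to_fract (q i) powi (- e i)) = inverse (\<Prod>i\<in>G. to_fract (q i) powi e' i)"
    by (simp add: e_def flip: prod_powi_uminus)
  then have "pullback D f = w * (\<Prod>i\<in>G. to_fract (q i) powi (- e i))"
    using qG by (simp add: w_def)
  moreover have "(\<Prod>j\<in>H. to_fract (h j) powi (- e0 j)) = (\<Prod>j\<in>H. to_fract (q j) powi (- e j))"
    using GH(1) by (intro prod.cong) (auto simp: e_def q_h)
  ultimately have "pullback D f = to_fract p * (\<Prod>k\<in>K. to_fract (q k) powi (- e k))"
    by (simp add: w prod_K mult_ac)
  moreover have "\<forall>i\<in>G. e i = e' i" "\<forall>k. k \<notin> K \<longrightarrow> e k = 0"
    by (auto simp: e_def K_eq)
  ultimately have "pullback_form D f p e"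
    unfolding pullback_form_def using p f' by blast
  then show ?thesis
    using pullback_form_the by simp
qed

lemma cluster_pullback_form:
  "S \<in> all_seeds \<Longrightarrow> l \<in> {1..ds} \<Longrightarrow> pullback_form D (cluster S l) (hat D (cluster S l)) (lam D (cluster S l))"
  using regular by (intro ex_pullback_form cluster_rfuns cluster_nonzero) auto

text \<open>The pullback of \<open>g i\<close> is absorbed entirely by the monomial: as exponents
  count poles, the one at \<open>i\<close> is -1, and those along \<open>H\<close> are given by
  \<open>kappa\<close>.\<close>

lemma hat_g:
  assumes i: "i \<in> G"
  shows "hat D (to_fract (g i)) = 1"
proof -
  define e where "e k = (if k = i then - 1 else if k \<in> H then kappa D (g i) k else 0)" for k
  define e' where "e' k = (if k = i then - 1 else 0 :: int)" for k
  have "(\<Prod>k\<in>G. to_fract (g k) powi (- e' k)) = (\<Prod>k\<in>G. if k = i then to_fract (g k) else 1)"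
    by (rule prod.cong) (auto simp: e'_def)
  then have pe: "pole_form ds G g (to_fract (g i)) 1 e'"
    using i g_irreducible(1) fin unfolding pole_form_def
    by (auto simp: e'_def irreducible_def)
  have "i \<notin> H"
    using i GH(1) by blast
  then have "(\<Prod>j\<in>H. to_fract (h j) powi (- kappa D (g i) j)) = (\<Prod>j\<in>H. to_fract (q j) powi (- e j))"
    by (intro prod.cong) (auto simp: e_def q_h)
  moreover have "(\<Prod>k\<in>G. to_fract (q k) powi (- e k)) = (\<Prod>k\<in>G. if k = i then to_fract (q k) else 1)"
    using GH(1) by (intro prod.cong) (auto simp: e_def)
  ultimately have "pullback D (to_fract (g i)) = to_fract 1 * (\<Prod>k\<in>K. to_fract (q k) powi (- e k))"
    using i fin by (simp add: pullback_g prod_K)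
  moreover have "\<forall>k\<in>G. e k = e' k" "\<forall>k. k \<notin> K \<longrightarrow> e k = 0"
    using GH(1) i by (auto simp: e_def e'_def K_eq)
  moreover have "\<forall>j\<in>H. \<not> h j dvd 1"
    using h_irreducible(1) by (auto simp: irreducible_def)
  ultimately have "pullback_form D (to_fract (g i)) 1 e"
    unfolding pullback_form_def using pe mpolys_1 by blast
  then show ?thesis
    by (rule pullback_form_the)
qed

end


section \<open>Exchange relations\<close>

context regular_pullback
begin

abbreviation "W k \<equiv> zero_set dr (q k)"
abbreviation "fam \<equiv> pullback_family D"
abbreviation "adj m S \<equiv> mutate n ds m S"

lemma mutable: "m \<in> {1..n} \<Longrightarrow> m \<in> {1..ds} \<and> m \<notin> K"
proof -
  assume m: "m \<in> {1..n}"
  have "n \<le> ds"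
    using seed[OF seeds.initial] by (simp add: is_seed_def)
  then show ?thesis
    using m K_sub(2) by auto
qed

lemma cluster_pullback:
  assumes "S \<in> all_seeds" "l \<in> {1..ds}"
  shows "hat D (cluster S l) \<in> mpolys {1..dr}" "j \<in> H \<Longrightarrow> \<not> h j dvd hat D (cluster S l)"
    "k \<notin> K \<Longrightarrow> lam D (cluster S l) k = 0"
    "pullback D (cluster S l) = to_fract (hat D (cluster S l)) *
      (\<Prod>k\<in>K. to_fract (q k) powi (- lam D (cluster S l) k))"
  using cluster_pullback_form[OF assms] by (auto simp: pullback_form_def)

text \<open>The same exponents \<open>lam\<close> along \<open>G\<close> are visible on the target;
  this link between the two levels is built into \<open>pullback_form\<close>.\<close>

lemma cluster_regular_form:
  assumes "S \<in> all_seeds" "l \<in> {1..ds}"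
  shows "\<exists>f. f \<in> mpolys {1..ds} \<and> (\<forall>k\<in>G. \<not> g k dvd f) \<and>
    cluster S l = to_fract f * (\<Prod>k\<in>G. to_fract (g k) powi (- lam D (cluster S l) k))"
proof -
  obtain f e where f: "pole_form ds G g (cluster S l) f e" and e: "\<forall>i\<in>G. lam D (cluster S l) i = e i"
    using cluster_pullback_form[OF assms] unfolding pullback_form_def by blast
  have "(\<Prod>k\<in>G. to_fract (g k) powi (- e k)) = (\<Prod>k\<in>G. to_fract (g k) powi (- lam D (cluster S l) k))"
    using e by (intro prod.cong) auto
  then show ?thesis
    using f unfolding pole_form_def by (intro exI[of _ f]) auto
qed

lemma fam_mpolys: "S \<in> all_seeds \<Longrightarrow> l \<in> {1..dr} \<Longrightarrow> fam S l \<in> mpolys {1..dr}"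
  using q_mpolys cluster_pullback(1) by (auto simp: pullback_family_def K_eq H_eq)

text \<open>The family \<open>\<sigma>\<close> is kept arbitrary because two specializations are
  used: \<open>fam S\<close> recovers the actual pullbacks, and another one, with value 1 along
  \<open>H\<close>, recovers the cluster variables on the target.\<close>

lemma formal_pullback_transfer:
  assumes S: "S \<in> all_seeds" and \<sigma>: "\<And>k. k \<in> K \<Longrightarrow> \<sigma> k \<noteq> 0" and l: "l \<in> {1..ds}"
  shows "rsubst_dom (\<lambda>i. to_fract (\<sigma> i)) (formal_pullback D S l)"
    and "rsubst (\<lambda>i. to_fract (\<sigma> i)) (formal_pullback D S l) = to_fract (\<sigma> l) *
      (if l \<in> G then \<Prod>j\<in>H. to_fract (\<sigma> j) powi (- kappa D (g l) j)
       else \<Prod>k\<in>K. to_fract (\<sigma> k) powi (- lam D (cluster S l) k))"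
proof -
  let ?\<phi> = "\<lambda>i. to_fract (\<sigma> i)"
  have V: "rsubst_dom ?\<phi> (\<Prod>k\<in>A. to_fract (Var k) powi e k)"
    "rsubst ?\<phi> (\<Prod>k\<in>A. to_fract (Var k) powi e k) = (\<Prod>k\<in>A. to_fract (\<sigma> k) powi e k)" if "A \<subseteq> K" for A e
    using that \<sigma> by (auto simp: rsubst_dom_prod rsubst_prod rsubst_dom_powi rsubst_powi subset_eq
        intro!: prod.cong)
  have HK: "H \<subseteq> K"
    by (auto simp: K_eq)
  show "rsubst_dom ?\<phi> (formal_pullback D S l)"
    unfolding formal_pullback_def by (intro rsubst_dom_mult) (auto intro!: V HK)
  show "rsubst ?\<phi> (formal_pullback D S l) = to_fract (\<sigma> l) *
      (if l \<in> G then \<Prod>j\<in>H. to_fract (\<sigma> j) powi (- kappa D (g l) j)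
       else \<Prod>k\<in>K. to_fract (\<sigma> k) powi (- lam D (cluster S l) k))"
    unfolding formal_pullback_def using HK by (subst rsubst_mult) (auto simp: V)
qed

text \<open>Together with \<open>formal_value_transfer\<close> this evaluates the two sides of the
  formal identity in \<open>exchange_form\<close> at \<open>\<sigma>\<close>.\<close>

lemma formal_expression_transfer:
  assumes S: "S \<in> all_seeds" and \<sigma>: "\<And>k. k \<in> K \<Longrightarrow> \<sigma> k \<noteq> 0"
    and w: "\<And>l. l \<in> {1..ds} \<Longrightarrow> w l = rsubst (\<lambda>i. to_fract (\<sigma> i)) (formal_pullback D S l)"
    and N: "N \<in> mpolys {1..ds}"
  shows "rsubst (\<lambda>i. to_fract (\<sigma> i))
      (mpoly_subst (formal_pullback D S) N * (\<Prod>i\<in>G. formal_pullback D S i powi a i)) =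
    mpoly_subst w N * (\<Prod>i\<in>G. w i powi a i)"
proof -
  let ?\<phi> = "\<lambda>i. to_fract (\<sigma> i)" and ?F = "formal_pullback D S"
  note dom = formal_pullback_transfer(1)[of S \<sigma>, OF S \<sigma>]
  have nz: "rsubst ?\<phi> (?F i) \<noteq> 0" if "i \<in> G" for i
    using formal_pullback_transfer(2)[of S \<sigma>, OF S \<sigma>] that GH(2) \<sigma> fin
    by (auto simp: K_eq)
  have G: "i \<in> {1..ds}" if "i \<in> G" for i
    using that GH(2) by blast
  have "rsubst ?\<phi> (mpoly_subst ?F N) = mpoly_subst w N"
    using rsubst_mpoly_subst[OF N dom] mpoly_subst_cong[OF N w] by simp
  moreover have "rsubst ?\<phi> (\<Prod>i\<in>G. ?F i powi a i) = (\<Prod>i\<in>G. w i powi a i)"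
    using dom G nz w by (subst rsubst_prod) (auto simp: rsubst_dom_powi rsubst_powi intro!: prod.cong)
  moreover have "rsubst_dom ?\<phi> (\<Prod>i\<in>G. ?F i powi a i)"
    using dom G nz by (intro rsubst_dom_prod rsubst_dom_powi) auto
  moreover have "rsubst_dom ?\<phi> (mpoly_subst ?F N)"
    using dom by (rule rsubst_dom_mpoly_subst[OF N])
  ultimately show ?thesis
    by (simp add: rsubst_mult)
qed

lemma formal_value_transfer:
  assumes \<sigma>: "\<And>k. k \<in> K \<Longrightarrow> \<sigma> k \<noteq> 0"
  shows "rsubst (\<lambda>i. to_fract (\<sigma> i)) (to_fract P / (\<Prod>k\<in>K. to_fract (Var k) powi e k)) =
    to_fract (psubst \<sigma> P) * (\<Prod>k\<in>K. to_fract (\<sigma> k) powi (- e k))"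
proof -
  let ?\<phi> = "\<lambda>i. to_fract (\<sigma> i)"
  have "to_fract P / (\<Prod>k\<in>K. to_fract (Var k) powi e k) = to_fract P * (\<Prod>k\<in>K. to_fract (Var k) powi (- e k))"
    by (simp only: divide_inverse prod_powi_uminus)
  moreover have "rsubst_dom ?\<phi> (\<Prod>k\<in>K. to_fract (Var k) powi (- e k))"
    using \<sigma> by (intro rsubst_dom_prod rsubst_dom_powi) auto
  moreover have "rsubst ?\<phi> (\<Prod>k\<in>K. to_fract (Var k) powi (- e k)) = (\<Prod>k\<in>K. to_fract (\<sigma> k) powi (- e k))"
    using \<sigma> by (subst rsubst_prod) (auto simp: rsubst_dom_powi rsubst_powi intro!: prod.cong)
  ultimately show ?thesis
    by (simp add: rsubst_mult mpoly_subst_to_fract)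
qed

lemma formal_pullback_family:
  assumes S: "S \<in> all_seeds" and l: "l \<in> {1..ds}"
  shows "pullback D (cluster S l) = rsubst (\<lambda>i. to_fract (fam S i)) (formal_pullback D S l)"
proof -
  have fam0: "fam S k \<noteq> 0" if "k \<in> K" for k
    using that q_nonzero by (simp add: pullback_family_def)
  have t: "rsubst (\<lambda>i. to_fract (fam S i)) (formal_pullback D S l) = to_fract (fam S l) *
      (if l \<in> G then \<Prod>j\<in>H. to_fract (fam S j) powi (- kappa D (g l) j)
       else \<Prod>k\<in>K. to_fract (fam S k) powi (- lam D (cluster S l) k))"
    using S fam0 l by (rule formal_pullback_transfer(2))
  show ?thesis
  proof (cases "l \<in> G")
    case True
    have p: "(\<Prod>j\<in>H. to_fract (fam S j) powi (- kappa D (g l) j)) = (\<Prod>j\<in>H. to_fract (h j) powi (- kappa D (g l) j))"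
      by (rule prod.cong) (auto simp: pullback_family_def K_eq q_h)
    have ql: "fam S l = q l"
      using True by (simp add: pullback_family_def K_eq)
    show ?thesis
      unfolding t if_P[OF True] p ql cluster_frozen[OF S True] by (rule pullback_g[OF True])
  next
    case False
    then have "l \<notin> K"
      using l K_sub(3) by blast
    then have hl: "fam S l = hat D (cluster S l)"
      by (simp add: pullback_family_def)
    have p: "(\<Prod>k\<in>K. to_fract (fam S k) powi (- lam D (cluster S l) k)) =
        (\<Prod>k\<in>K. to_fract (q k) powi (- lam D (cluster S l) k))"
      by (rule prod.cong) (auto simp: pullback_family_def)
    show ?thesis
      unfolding t if_not_P[OF False] p hl by (rule cluster_pullback(4)[OF S l])
  qed
qed

section \<open>Exchange polynomials and their formal expressions\<close>

lemma adj_seed: "S \<in> all_seeds \<Longrightarrow> m \<in> {1..n} \<Longrightarrow> adj m S \<in> all_seeds"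
  by (rule seeds.adjacent)

lemma exchange_relation:
  assumes "S \<in> all_seeds" "m \<in> {1..n}"
  shows "exchange_poly n ds S m = cluster S m * cluster (adj m S) m"
  using cluster_nonzero[OF assms(1)] mutable[OF assms(2)] by (simp add: mutate_def)

lemma pullback_mult: "u \<in> rfuns {1..ds} \<Longrightarrow> v \<in> rfuns {1..ds} \<Longrightarrow> pullback D (u * v) = pullback D u * pullback D v"
  unfolding pullback_def using pullback_dom by (simp add: rsubst_mult)

lemma pullback_exchange_poly:
  assumes "S \<in> all_seeds" "m \<in> {1..n}"
  shows "pullback D (exchange_poly n ds S m) = pullback D (cluster S m) * pullback D (cluster (adj m S) m)"
    and "pullback D (exchange_poly n ds S m) \<noteq> 0"
proof -
  have r: "cluster S m \<in> rfuns {1..ds}" "cluster (adj m S) m \<in> rfuns {1..ds}"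
    "cluster S m \<noteq> 0" "cluster (adj m S) m \<noteq> 0"
    using assms adj_seed cluster_rfuns cluster_nonzero mutable by blast+
  then show eq: "pullback D (exchange_poly n ds S m) = pullback D (cluster S m) * pullback D (cluster (adj m S) m)"
    by (simp add: exchange_relation[OF assms] pullback_mult)
  show "pullback D (exchange_poly n ds S m) \<noteq> 0"
    unfolding eq using r pullback_nonzero by simp
qed

lemma pullback_cluster_expression:
  assumes S: "S \<in> all_seeds" and N: "N \<in> mpolys {1..ds}"
  shows "pullback D (mpoly_subst (cluster S) N * (\<Prod>i\<in>G. cluster S i powi a i)) =
    mpoly_subst (\<lambda>l. pullback D (cluster S l)) N * (\<Prod>i\<in>G. pullback D (cluster S i) powi a i)"
proof -
  have dom: "rsubst_dom \<Psi> (cluster S l)" "rsubst \<Psi> (cluster S l) \<noteq> 0" if "l \<in> {1..ds}" for l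
    using pullback_dom pullback_nonzero cluster_rfuns[OF S that] cluster_nonzero[OF S that]
    unfolding pullback_def by auto
  have G: "i \<in> {1..ds}" if "i \<in> G" for i
    using that GH(2) by blast
  have "rsubst_dom \<Psi> (\<Prod>i\<in>G. cluster S i powi a i)"
    by (intro rsubst_dom_prod rsubst_dom_powi dom G)
  moreover have "rsubst \<Psi> (\<Prod>i\<in>G. cluster S i powi a i) = (\<Prod>i\<in>G. rsubst \<Psi> (cluster S i) powi a i)"
    using dom G by (subst rsubst_prod) (auto simp: rsubst_dom_powi rsubst_powi intro!: prod.cong)
  moreover have "rsubst_dom \<Psi> (mpoly_subst (cluster S) N)"
    using N dom(1) by (rule rsubst_dom_mpoly_subst)
  moreover have "rsubst \<Psi> (mpoly_subst (cluster S) N) = mpoly_subst (\<lambda>l. rsubst \<Psi> (cluster S l)) N"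
    using N dom(1) by (rule rsubst_mpoly_subst)
  ultimately show ?thesis
    unfolding pullback_def by (simp add: rsubst_mult)
qed

text \<open>The quiver has no loops, so the exchanged variable enters every exchange term with
  exponent 0; inverses come only from the coefficients, and only along \<open>G\<close>.\<close>

lemma exchange_poly_localization:
  assumes S: "S \<in> all_seeds" and m: "m \<in> {1..n}"
  shows "exchange_poly n ds S m \<in>
    localization (mpoly_subst (cluster S) ` mpolys ({1..ds} - {m})) (\<Prod>i\<in>G. cluster S i)"
    (is "_ \<in> localization ?R ?Q")
proof -
  have R: "semiring_closed ?R"
    by (rule semiring_closed_mpoly_subst_mpolys)
  have cR: "cluster S l \<in> ?R" if "l \<in> {1..ds}" "l \<noteq> m" for l
    using that by (intro image_eqI[of _ _ "Var l"]) auto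
  have G: "i \<in> {1..ds}" "i \<noteq> m" if "i \<in> G" for i
    using that GH(2) mutable[OF m] by (auto simp: K_eq)
  have Q: "?Q \<in> ?R"
    by (intro semiring_closed_prod[OF R] cR G)
  note L = semiring_closed_localization[OF R Q]
  have RL: "u \<in> localization ?R ?Q" if "u \<in> ?R" for u
    using subset_localization[OF R Q] that by blast
  have sd: "is_seed n ds G S"
    using seed[OF S] .
  \<comment> \<open>The products over mutable vertices include \<open>m\<close> itself, hence the
    case \<open>l = m\<close> with exponent 0.\<close>
  have pow: "cluster S l ^ e \<in> localization ?R ?Q" if "l \<in> {1..ds}" "l = m \<Longrightarrow> e = 0" for l e
  proof (cases "l = m")
    case True
    then show ?thesis
      using that(2) semiring_closed_1[OF L] by simp
  next
    case False
    then show ?thesis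
      by (intro semiring_closed_power[OF L] RL cR that(1))
  qed
  have mm: "arrows S m m = 0" and n: "n \<le> ds"
    using sd mutable[OF m] by (auto simp: is_seed_def)
  have "coef S m k \<in> localization ?R ?Q" if "k \<le> mult S m" for k
  proof -
    have "coef S m k \<in> localized_ring {n<..ds} G (cluster S)"
      using sd m that by (simp add: is_seed_def)
    then obtain N e where N: "N \<in> mpolys {n<..ds}"
        "coef S m k = mpoly_subst (cluster S) N * (\<Prod>i\<in>G. cluster S i powi e i)"
      unfolding localized_ring_def by blast
    have "N \<in> mpolys ({1..ds} - {m})"
      using N(1) m by (auto elim: mpolys_mono)
    then have "mpoly_subst (cluster S) N \<in> localization ?R ?Q"
      by (intro RL imageI)
    moreover have "cluster S i powi e i \<in> localization ?R ?Q" if "i \<in> G" for i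
      using localization_prod_powi[where q = "cluster S", OF R fin(1) _ that] cR G cluster_nonzero[OF S] by blast
    ultimately show ?thesis
      unfolding N(2) by (intro semiring_closed_mult[OF L] semiring_closed_prod[OF L])
  qed
  then show ?thesis
    unfolding exchange_poly_def exchange_term_def
    by (intro semiring_closed_sum[OF L] semiring_closed_mult[OF L] semiring_closed_prod[OF L] pow)
      (use n m mm in auto)
qed

text \<open>The formal expression lies in the polynomials free of \<open>m\<close> with the
  variables in \<open>K\<close> inverted. These variables are primes, so a normal form exists as
  soon as the expression is nonzero.\<close>

lemma ex_exchange_form:
  assumes S: "S \<in> all_seeds" and m: "m \<in> {1..n}"
  shows "\<exists>P e. exchange_form n D S m P e"
proof -
  let ?cl = "cluster S" and ?F = "formal_pullback D S" and ?A = "{1..dr} - {m}"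
  have G: "i \<in> {1..ds}" if "i \<in> G" for i
    using that GH(2) by blast
  have Gm: "i \<noteq> m" if "i \<in> K" for i
    using that mutable[OF m] by auto
  obtain t M where t: "t \<in> mpoly_subst ?cl ` mpolys ({1..ds} - {m})"
    "exchange_poly n ds S m = t * (\<Prod>i\<in>G. ?cl i powi (- int M))"
    using localizationE[OF exchange_poly_localization[OF S m] fin(1)] cluster_nonzero[OF S G] by blast
  then obtain N where N: "N \<in> mpolys ({1..ds} - {m})" "t = mpoly_subst ?cl N"
    by blast
  have N': "N \<in> mpolys {1..ds}"
    using N(1) by (rule mpolys_mono) auto
  define U where "U = mpoly_subst ?F N * (\<Prod>i\<in>G. ?F i powi (- int M))"
  let ?L = "poly_localization ?A K Var"
  have VA: "Var k \<in> mpolys ?A" if "k \<in> K" for k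
    using that Gm K_sub(1) by auto
  have V0: "(Var k :: mpoly) \<noteq> 0" for k
    using prime_elem_Var[of k] by (auto simp: prime_elem_def)
  have L: "semiring_closed ?L"
    by (rule semiring_closed_poly_localization[where q = Var, OF fin(3) VA V0])
  have toL: "to_fract p \<in> ?L" if "p \<in> mpolys ?A" for p
    by (rule to_fract_poly_localization[where q = Var, OF fin(3) VA V0 that])
  have VL: "to_fract (Var k) powi e \<in> ?L" if "k \<in> K" for k e
    by (rule powi_poly_localization[where q = Var, OF fin(3) VA V0 that])
  have HK: "H \<subseteq> K"
    by (auto simp: K_eq)
  have FL: "?F l \<in> ?L" if "l \<in> {1..ds} - {m}" for l
  proof -
    have "to_fract (Var l) \<in> ?L"
      using that ds_le_dr by (intro toL) auto
    moreover have "(\<Prod>j\<in>B. to_fract (Var j) powi e j) \<in> ?L" if "B \<subseteq> K" for B e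
      using that by (intro semiring_closed_prod[OF L] VL) auto
    ultimately show ?thesis
      unfolding formal_pullback_def using HK by (intro semiring_closed_mult[OF L]) auto
  qed
  have "mpoly_subst ?F N \<in> ?L"
    unfolding mpoly_subst_def by (rule insertion_closed[OF L _ FL N(1)]) (rule toL, simp)
  moreover have "?F i powi z \<in> ?L" if "i \<in> G" for i z
  proof -
    have "?F i powi z = to_fract (Var i) powi z * (\<Prod>j\<in>H. (to_fract (Var j) powi (- kappa D (g i) j)) powi z)"
      using that by (simp add: formal_pullback_def power_int_mult_distrib prod_powi)
    also have "\<dots> = to_fract (Var i) powi z * (\<Prod>j\<in>H. to_fract (Var j) powi (- kappa D (g i) j * z))"
      by (simp only: power_int_mult)
    finally have eq: "?F i powi z = \<dots>" .
    have "i \<in> K"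
      using that by (simp add: K_eq)
    then show ?thesis
      unfolding eq using HK by (intro semiring_closed_mult[OF L] semiring_closed_prod[OF L] VL) auto
  qed
  ultimately have UL: "U \<in> ?L"
    unfolding U_def by (intro semiring_closed_mult[OF L] semiring_closed_prod[OF L])
  have fam0: "fam S k \<noteq> 0" if "k \<in> K" for k
    using that q_nonzero by (simp add: pullback_family_def)
  \<comment> \<open>That \<open>U\<close> is nonzero is seen from its specialization at
    \<open>fam S\<close>, the pullback of a nonzero function under a dominant map.\<close>
  have "rsubst (\<lambda>i. to_fract (fam S i)) U =
      mpoly_subst (\<lambda>l. pullback D (?cl l)) N * (\<Prod>i\<in>G. pullback D (?cl i) powi (- int M))"
    unfolding U_def
    by (rule formal_expression_transfer[where \<sigma> = "fam S", OF S fam0 formal_pullback_family[OF S] N'])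
  also have "\<dots> = pullback D (exchange_poly n ds S m)"
    unfolding t(2) N(2) by (rule pullback_cluster_expression[OF S N', symmetric])
  also have "\<dots> \<noteq> 0"
    by (rule pullback_exchange_poly(2)[OF S m])
  finally have "rsubst (\<lambda>i. to_fract (fam S i)) U \<noteq> 0" .
  then have "U \<noteq> 0"
    using rsubst_to_fract[of "\<lambda>i. to_fract (fam S i)" 0] by auto
  then obtain P e where P: "P \<in> mpolys ?A" "\<forall>k\<in>K. \<not> Var k dvd P" "\<forall>k. k \<notin> K \<longrightarrow> e k = 0"
    and U: "U = to_fract P * (\<Prod>k\<in>K. to_fract (Var k) powi (- e k))"
    using poly_localization_form[OF prime_family_Var[OF fin(3)] UL] by blast
  have "U = to_fract P / (\<Prod>k\<in>K. to_fract (Var k) powi e k)"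
    unfolding U by (simp only: divide_inverse prod_powi_uminus)
  then have "mpoly_subst ?F N * (\<Prod>i\<in>G. ?F i powi (- int M)) = to_fract P / (\<Prod>k\<in>K. to_fract (Var k) powi e k)"
    by (simp only: U_def)
  moreover have "exchange_poly n ds S m = mpoly_subst ?cl N * (\<Prod>i\<in>G. ?cl i powi (- int M))"
    using t(2) by (simp only: N(2))
  ultimately have "exchange_form n D S m P e"
    unfolding exchange_form_def using P
    by (intro conjI bexI[OF _ N(1)] exI[of _ "\<lambda>_. - int M"])
  then show ?thesis
    by blast
qed

lemma exchange_form_pullback:
  assumes S: "S \<in> all_seeds" and m: "m \<in> {1..n}" and P: "exchange_form n D S m P e"
  shows "pullback D (exchange_poly n ds S m) =
    to_fract (psubst (fam S) P) * (\<Prod>k\<in>K. to_fract (q k) powi (- e k))"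
proof -
  obtain N a where N: "N \<in> mpolys ({1..ds} - {m})"
    and ex: "exchange_poly n ds S m = mpoly_subst (cluster S) N * (\<Prod>i\<in>G. cluster S i powi a i)"
    and fo: "mpoly_subst (formal_pullback D S) N * (\<Prod>i\<in>G. formal_pullback D S i powi a i) =
      to_fract P / (\<Prod>k\<in>K. to_fract (Var k) powi e k)"
    using P unfolding exchange_form_def by blast
  have N': "N \<in> mpolys {1..ds}"
    using N by (rule mpolys_mono) auto
  have fam0: "fam S k \<noteq> 0" if "k \<in> K" for k
    using that q_nonzero by (simp add: pullback_family_def)
  have "pullback D (exchange_poly n ds S m) =
      mpoly_subst (\<lambda>l. pullback D (cluster S l)) N * (\<Prod>i\<in>G. pullback D (cluster S i) powi a i)"
    unfolding ex by (rule pullback_cluster_expression[OF S N'])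
  also have "\<dots> = rsubst (\<lambda>i. to_fract (fam S i)) (to_fract P / (\<Prod>k\<in>K. to_fract (Var k) powi e k))"
    unfolding fo[symmetric]
    by (rule formal_expression_transfer[where \<sigma> = "fam S", OF S fam0 formal_pullback_family[OF S] N', symmetric])
  also have "\<dots> = to_fract (psubst (fam S) P) * (\<Prod>k\<in>K. to_fract (fam S k) powi (- e k))"
    by (rule formal_value_transfer[OF fam0])
  also have "(\<Prod>k\<in>K. to_fract (fam S k) powi (- e k)) = (\<Prod>k\<in>K. to_fract (q k) powi (- e k))"
    by (rule prod.cong) (auto simp: pullback_family_def)
  finally show ?thesis .
qed

text \<open>The formal expression specializes not only to the pullback but also, with the \<open>h\<^sub>j\<close>
  replaced by 1, to the exchange polynomial itself. This bounds its poles along the \<open>g\<^sub>i\<close>,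
  which are prime, unlike their pullbacks.\<close>

lemma exchange_form_regular:
  assumes S: "S \<in> all_seeds" and m: "m \<in> {1..n}" and P: "exchange_form n D S m P e"
  shows "\<exists>p. exchange_poly n ds S m = to_fract p * (\<Prod>k\<in>G. to_fract (g k) powi (- e k))"
proof -
  obtain N a where N: "N \<in> mpolys ({1..ds} - {m})"
    and ex: "exchange_poly n ds S m = mpoly_subst (cluster S) N * (\<Prod>i\<in>G. cluster S i powi a i)"
    and fo: "mpoly_subst (formal_pullback D S) N * (\<Prod>i\<in>G. formal_pullback D S i powi a i) =
      to_fract P / (\<Prod>k\<in>K. to_fract (Var k) powi e k)"
    using P unfolding exchange_form_def by blast
  have N': "N \<in> mpolys {1..ds}"
    using N by (rule mpolys_mono) auto
  have "\<forall>l\<in>{1..ds}. \<exists>f. cluster S l = to_fract f * (\<Prod>k\<in>G. to_fract (g k) powi (- lam D (cluster S l) k))"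
    using cluster_regular_form[OF S] by blast
  then obtain f where f: "\<And>l. l \<in> {1..ds} \<Longrightarrow>
      cluster S l = to_fract (f l) * (\<Prod>k\<in>G. to_fract (g k) powi (- lam D (cluster S l) k))"
    by metis
  \<comment> \<open>Outside \<open>G\<close> and \<open>H\<close> the value is the numerator of the
    cluster variable on the target.\<close>
  define \<sigma> where "\<sigma> l = (if l \<in> G then g l else if l \<in> H then 1 else f l)" for l
  have \<sigma>0: "\<sigma> k \<noteq> 0" if "k \<in> K" for k
    using that prime_family_nonzero[OF prime_family_g] by (auto simp: \<sigma>_def K_eq)
  have \<sigma>H: "(\<Prod>j\<in>H. to_fract (\<sigma> j) powi z j) = 1" for z
    using GH(1) by (intro prod.neutral) (auto simp: \<sigma>_def)
  have \<sigma>G: "(\<Prod>k\<in>G. to_fract (\<sigma> k) powi z k) = (\<Prod>k\<in>G. to_fract (g k) powi z k)" for z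
    by (rule prod.cong) (auto simp: \<sigma>_def)
  have w: "cluster S l = rsubst (\<lambda>i. to_fract (\<sigma> i)) (formal_pullback D S l)" if l: "l \<in> {1..ds}" for l
  proof (cases "l \<in> G")
    case True
    then show ?thesis
      using formal_pullback_transfer(2)[where \<sigma> = \<sigma>, OF S \<sigma>0 l] cluster_frozen[OF S True]
      by (simp add: \<sigma>H) (simp add: \<sigma>_def)
  next
    case False
    moreover have "l \<notin> H"
      using l by (simp add: H_eq)
    ultimately have "\<sigma> l = f l"
      by (simp add: \<sigma>_def)
    then show ?thesis
      using formal_pullback_transfer(2)[where \<sigma> = \<sigma>, OF S \<sigma>0 l] f[OF l] False
      by (simp add: prod_K \<sigma>H \<sigma>G)
  qed
  have "exchange_poly n ds S m = rsubst (\<lambda>i. to_fract (\<sigma> i)) (to_fract P / (\<Prod>k\<in>K. to_fract (Var k) powi e k))"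
    unfolding ex fo[symmetric]
    by (rule formal_expression_transfer[where \<sigma> = \<sigma>, OF S \<sigma>0 w N', symmetric])
  also have "\<dots> = to_fract (psubst \<sigma> P) * (\<Prod>k\<in>K. to_fract (\<sigma> k) powi (- e k))"
    by (rule formal_value_transfer[OF \<sigma>0])
  finally show ?thesis
    by (auto simp: prod_K \<sigma>H \<sigma>G)
qed

section \<open>Exponents of exchange relations, and invariance under mutation\<close>

definition boundary_independent :: "seed \<Rightarrow> bool" where
  "boundary_independent S \<longleftrightarrow> (\<forall>k\<in>K. alg_indep_on (W k) ({1..dr} - {k}) (fam S))"

lemma boundary_nonzero:
  assumes "boundary_independent S" "k \<in> K" "R \<in> mpolys {1..dr}" "\<not> Var k dvd R"
  shows "\<exists>x\<in>W k. mpoly_eval x (psubst (fam S) R) \<noteq> 0"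
proof (rule alg_indep_on_boundary[OF _ _ assms(3,4)])
  show "alg_indep_on (W k) ({1..dr} - {k}) (fam S)"
    using assms by (simp add: boundary_independent_def)
  show "mpoly_eval x (fam S k) = 0" if "x \<in> W k" for x
    using that assms(2) by (simp add: zero_set_def pullback_family_def)
qed

lemma exchange_exponents:
  assumes S: "S \<in> all_seeds" and m: "m \<in> {1..n}" and P: "exchange_form n D S m P e"
    and ind: "boundary_independent S"
  shows "e = (\<lambda>k. lam D (cluster S m) k + lam D (cluster (adj m S) m) k)"
    and "psubst (fam S) P = hat D (cluster S m) * hat D (cluster (adj m S) m)"
proof -
  let ?f = "cluster S m" and ?f' = "cluster (adj m S) m"
  let ?F = "hat D ?f" and ?F' = "hat D ?f'"
  let ?\<epsilon> = "\<lambda>k. lam D ?f k + lam D ?f' k - e k"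
  have S': "adj m S \<in> all_seeds" and ms: "m \<in> {1..ds}" and mK: "m \<notin> K"
    using adj_seed[OF S m] mutable[OF m] by auto
  have PA: "P \<in> mpolys ({1..dr} - {m})" "\<And>k. k \<in> K \<Longrightarrow> \<not> Var k dvd P" "\<And>k. k \<notin> K \<Longrightarrow> e k = 0"
    using P by (auto simp: exchange_form_def)
  \<comment> \<open>Stated for a general index set because it is used twice: on the target with the
    \<open>g k\<close> over \<open>G\<close>, and on the source with the \<open>q k\<close> over
    \<open>K\<close>.\<close>
  have bal: "c * (\<Prod>k\<in>A. to_fract (r k) powi (?\<epsilon> k)) = b * b'"
    if r: "\<And>k. k \<in> A \<Longrightarrow> r k \<noteq> 0" "finite A"
      and eq: "(b * (\<Prod>k\<in>A. to_fract (r k) powi (- lam D ?f k))) * (b' * (\<Prod>k\<in>A. to_fract (r k) powi (- lam D ?f' k))) =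
        c * (\<Prod>k\<in>A. to_fract (r k) powi (- e k))"
    for b b' c and r :: "nat \<Rightarrow> mpoly" and A
  proof -
    let ?p = "\<lambda>z. \<Prod>k\<in>A. to_fract (r k) powi z k"
    have add: "?p (\<lambda>k. y k + z k) = ?p y * ?p z" for y z
      using r by (intro prod_powi_add) auto
    have nz: "?p z \<noteq> 0" for z
      using r by simp
    have inv: "?p z * ?p (\<lambda>k. - z k) = 1" for z
      using add[of z "\<lambda>k. - z k"] by simp
    have "?p ?\<epsilon> = ?p (\<lambda>k. - e k) * (?p (lam D ?f) * ?p (lam D ?f'))"
      using add[of "\<lambda>k. - e k" "\<lambda>k. lam D ?f k + lam D ?f' k"] add[of "lam D ?f" "lam D ?f'"]
      by (simp add: add.commute)
    then have "c * ?p ?\<epsilon> = c * ?p (\<lambda>k. - e k) * (?p (lam D ?f) * ?p (lam D ?f'))"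
      by (simp only: mult.assoc)
    also have "\<dots> = b * b' * (?p (lam D ?f) * ?p (\<lambda>k. - lam D ?f k)) * (?p (lam D ?f') * ?p (\<lambda>k. - lam D ?f' k))"
      unfolding eq[symmetric] by (simp only: mult_ac)
    finally show ?thesis
      by (simp only: inv mult_1_right)
  qed
  have \<epsilon>G: "?\<epsilon> k \<le> 0" if k: "k \<in> G" for k
  proof -
    obtain f where f: "\<forall>k\<in>G. \<not> g k dvd f" "?f = to_fract f * (\<Prod>k\<in>G. to_fract (g k) powi (- lam D ?f k))"
      using cluster_regular_form[OF S ms] by blast
    obtain f' where f': "\<forall>k\<in>G. \<not> g k dvd f'" "?f' = to_fract f' * (\<Prod>k\<in>G. to_fract (g k) powi (- lam D ?f' k))"
      using cluster_regular_form[OF S' ms] by blast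
    obtain p where "exchange_poly n ds S m = to_fract p * (\<Prod>k\<in>G. to_fract (g k) powi (- e k))"
      using exchange_form_regular[OF S m P] by blast
    then have "to_fract p * (\<Prod>k\<in>G. to_fract (g k) powi (?\<epsilon> k)) = to_fract f * to_fract f'"
      using prime_family_nonzero[OF prime_family_g] fin(1) f(2) f'(2) exchange_relation[OF S m]
      by (intro bal) auto
    then have "to_fract p * (\<Prod>k\<in>G. to_fract (g k) powi (?\<epsilon> k)) = to_fract (f * f')"
      by simp
    then show ?thesis
    proof (rule prime_family_exponent_nonpos[OF prime_family_g k])
      show "\<not> g k dvd f * f'"
        using f(1) f'(1) k mpoly_irreducible_imp_prime_elem[OF g_irreducible(1)[OF k]]
        by (auto dest: prime_elem_dvd_multD)
    qed
  qed
  have "pullback D ?f * pullback D ?f' = to_fract (psubst (fam S) P) * (\<Prod>k\<in>K. to_fract (q k) powi (- e k))"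
    using exchange_form_pullback[OF S m P] pullback_exchange_poly(1)[OF S m] by simp
  then have "to_fract (psubst (fam S) P) * (\<Prod>k\<in>K. to_fract (q k) powi (?\<epsilon> k)) = to_fract ?F * to_fract ?F'"
    using q_nonzero fin(3) cluster_pullback(4)[OF S ms] cluster_pullback(4)[OF S' ms]
    by (intro bal) auto
  then have up: "to_fract (psubst (fam S) P) * (\<Prod>k\<in>K. to_fract (q k) powi (?\<epsilon> k)) = to_fract (?F * ?F')"
    by simp
  have \<epsilon>K: "?\<epsilon> k \<ge> 0" if k: "k \<in> K" for k
  proof (rule ccontr)
    assume neg: "\<not> ?\<epsilon> k \<ge> 0"
    \<comment> \<open>\<open>T\<close> gathers formally all factors that stay on the left when
      denominators are cleared. The exponent of \<open>Var k\<close> in the added product is 0 as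
      \<open>?\<epsilon> k\<close> is negative, so \<open>Var k\<close> does not divide
      \<open>T\<close>.\<close>
    define T where "T = P * (\<Prod>l\<in>K. Var l ^ nat (?\<epsilon> l))"
    have "\<not> Var k dvd (\<Prod>l\<in>K. Var l ^ nat (?\<epsilon> l) :: mpoly)"
    proof
      assume dvd: "Var k dvd (\<Prod>l\<in>K. Var l ^ nat (?\<epsilon> l) :: mpoly)"
      obtain l where l: "Var k dvd (Var l ^ nat (?\<epsilon> l) :: mpoly)"
        using prime_elem_dvd_prodD[OF prime_elem_Var dvd] by blast
      have "l = k"
        using prime_elem_dvd_power[OF prime_elem_Var l] by (simp add: Var_dvd_Var_iff)
      then show False
        using l neg prime_elem_Var[of k] by (simp add: prime_elem_def)
    qed
    then have "\<not> Var k dvd T"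
      using PA(2)[OF k] prime_elem_dvd_multD[OF prime_elem_Var] unfolding T_def by blast
    moreover have "T \<in> mpolys {1..dr}"
      unfolding T_def using PA(1) K_sub(1)
      by (intro mpolys_mult mpolys_prod mpolys_power) (auto elim: mpolys_mono)
    ultimately obtain x where x: "x \<in> W k" "mpoly_eval x (psubst (fam S) T) \<noteq> 0"
      using boundary_nonzero[OF ind k] by blast
    have "psubst (fam S) T = psubst (fam S) P * (\<Prod>l\<in>K. q l ^ nat (?\<epsilon> l))"
      unfolding T_def psubst_def
      by (simp add: insertion_mult ring_map_Const insertion_Var ring_map.prod[OF ring_map_insertion[OF ring_map_Const]]
          ring_map.power[OF ring_map_insertion[OF ring_map_Const]] pullback_family_def)
    \<comment> \<open>After clearing denominators the right side contains a positive power of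
      \<open>q k\<close>, so it vanishes on \<open>W k\<close>, where the left side was just found
      nonzero at \<open>x\<close>.\<close>
    also have "\<dots> = ?F * ?F' * (\<Prod>l\<in>K. q l ^ nat (- ?\<epsilon> l))"
      by (rule clear_denominators[OF q_nonzero up])
    finally have "mpoly_eval x (\<Prod>l\<in>K. q l ^ nat (- ?\<epsilon> l)) \<noteq> 0"
      using x(2) by auto
    then have "mpoly_eval x (q k) ^ nat (- ?\<epsilon> k) \<noteq> 0"
      using k fin(3) by (simp add: mpoly_eval_prod)
    then show False
      using x(1) neg by (simp add: zero_set_def)
  qed
  have \<epsilon>0G: "?\<epsilon> k = 0" if "k \<in> G" for k
    using \<epsilon>G[OF that] \<epsilon>K[of k] that by (simp add: K_eq)
  \<comment> \<open>Only now that the exponents along \<open>G\<close> are 0 do the remaining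
    factors form a family of primes, to which the divisibility bound applies.\<close>
  have upH: "to_fract (psubst (fam S) P) * (\<Prod>k\<in>H. to_fract (h k) powi (?\<epsilon> k)) = to_fract (?F * ?F')"
  proof -
    have "(\<Prod>k\<in>G. to_fract (q k) powi (?\<epsilon> k)) = 1"
      by (rule prod.neutral) (simp add: \<epsilon>0G)
    moreover have "(\<Prod>k\<in>H. to_fract (q k) powi (?\<epsilon> k)) = (\<Prod>k\<in>H. to_fract (h k) powi (?\<epsilon> k))"
      by (rule prod.cong) (simp_all add: q_h)
    ultimately show ?thesis
      using up by (simp only: prod_K mult_1_left)
  qed
  have "?\<epsilon> j \<le> 0" if j: "j \<in> H" for j
  proof (rule prime_family_exponent_nonpos[OF prime_family_h j upH])
    show "\<not> h j dvd ?F * ?F'"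
      using cluster_pullback(2)[OF S ms j] cluster_pullback(2)[OF S' ms j]
        mpoly_irreducible_imp_prime_elem[OF h_irreducible(1)[OF j]]
      by (auto dest: prime_elem_dvd_multD)
  qed
  then have \<epsilon>0H: "?\<epsilon> j = 0" if "j \<in> H" for j
    using \<epsilon>K[of j] that by (force simp: K_eq)
  have "?\<epsilon> k = 0" for k
    using \<epsilon>0G \<epsilon>0H PA(3) cluster_pullback(3)[OF S ms] cluster_pullback(3)[OF S' ms]
    by (cases "k \<in> K") (auto simp: K_eq)
  then show "e = (\<lambda>k. lam D ?f k + lam D ?f' k)"
    by (auto simp: algebra_simps)
  have "(\<Prod>k\<in>H. to_fract (h k) powi (?\<epsilon> k)) = 1"
    by (rule prod.neutral) (simp add: \<epsilon>0H)
  then have "to_fract (psubst (fam S) P) = to_fract (?F * ?F')"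
    using upH by (simp only: mult_1_right)
  then show "psubst (fam S) P = ?F * ?F'"
    by (simp only: to_fract_eq_iff)
qed

lemma Lam_eq:
  assumes "S \<in> all_seeds" "m \<in> {1..n}" "boundary_independent S"
  shows "Lam n D S m = (\<lambda>k. lam D (cluster S m) k + lam D (cluster (adj m S) m) k)"
  unfolding Lam_def
proof (rule the_equality)
  show "\<exists>P. exchange_form n D S m P (\<lambda>k. lam D (cluster S m) k + lam D (cluster (adj m S) m) k)"
    using ex_exchange_form[OF assms(1,2)] exchange_exponents(1)[OF assms(1,2) _ assms(3)] by blast
qed (use exchange_exponents(1)[OF assms(1,2) _ assms(3)] in blast)

text \<open>On \<open>W k\<close> the exchange polynomial may be replaced by its constant
  coefficient in \<open>Var k\<close>, which is nonzero and free of both \<open>k\<close> and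
  \<open>m\<close>. The exchange argument for independent families then applies with index
  \<open>k\<close> left out.\<close>

lemma boundary_independent_adj:
  assumes S: "S \<in> all_seeds" and m: "m \<in> {1..n}" and ind: "boundary_independent S"
  shows "boundary_independent (adj m S)"
  unfolding boundary_independent_def
proof
  fix k assume k: "k \<in> K"
  obtain P e where P: "exchange_form n D S m P e"
    using ex_exchange_form[OF S m] by blast
  have mK: "m \<notin> K" and ms: "m \<in> {1..ds}"
    using mutable[OF m] by auto
  let ?P = "coeff (upoly k P) 0" and ?t = "hat D (cluster (adj m S) m)"
  have fam: "fam (adj m S) = (fam S)(m := ?t)"
    using mK by (auto simp: fun_eq_iff pullback_family_def mutate_def)
  show "alg_indep_on (W k) ({1..dr} - {k}) (fam (adj m S))"
    unfolding fam
  proof (rule alg_indep_on_exchange)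
    show "alg_indep_on (W k) ({1..dr} - {k}) (fam S)"
      using ind k by (simp add: boundary_independent_def)
    show "m \<in> {1..dr} - {k}"
      using ms mK k ds_le_dr by auto
    have "P \<in> mpolys ({1..dr} - {m})" "\<not> Var k dvd P"
      using P k by (auto simp: exchange_form_def)
    then show "?P \<in> mpolys ({1..dr} - {k} - {m})" "?P \<noteq> 0"
      using coeff_upoly_mpolys[of P "{1..dr} - {m}" k 0] by (auto simp: Var_dvd_iff elim: mpolys_mono)
    fix x assume x: "x \<in> W k"
    let ?y = "\<lambda>l. mpoly_eval x (fam S l)"
    have "?y k = 0"
      using x k by (simp add: zero_set_def pullback_family_def)
    then have "mpoly_eval ?y P = mpoly_eval ?y ?P"
      by (rule mpoly_eval_at_0)
    moreover have "fam S m = hat D (cluster S m)"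
      using mK by (simp add: pullback_family_def)
    ultimately show "mpoly_eval x (fam S m) * mpoly_eval x ?t = mpoly_eval x (psubst (fam S) ?P)"
      using arg_cong[OF exchange_exponents(2)[OF S m P ind], of "mpoly_eval x"]
      by (simp add: mpoly_eval_psubst)
  qed
qed

section \<open>Conclusions for all seeds\<close>

lemma boundary_independent_seeds: "S \<in> all_seeds \<Longrightarrow> boundary_independent S"
proof (induction S rule: seeds.induct)
  case initial
  then show ?case
    using independent by (simp add: boundary_independent_def)
qed (rule boundary_independent_adj)

text \<open>Divisibility by the possibly reducible \<open>q k\<close> is ruled out by values: every
  hatted variable is the value of \<open>1\<close> or of some \<open>Var l\<close> with
  \<open>l \<noteq> k\<close>, hence nonzero somewhere on \<open>W k\<close>.\<close>

lemma cluster_pole_form: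
  assumes S: "S \<in> all_seeds" and l: "l \<in> {1..ds}"
  shows "pole_form dr K q (pullback D (cluster S l)) (hat D (cluster S l)) (lam D (cluster S l))"
proof -
  have "\<not> q k dvd hat D (cluster S l)" if k: "k \<in> K" for k
  proof
    assume dvd: "q k dvd hat D (cluster S l)"
    define R where "R = (if l \<in> K then 1 else Var l :: mpoly)"
    have "\<not> Var k dvd R" "R \<in> mpolys {1..dr}"
      using prime_elem_Var[of k] l ds_le_dr k by (auto simp: R_def prime_elem_def Var_dvd_Var_iff)
    then obtain x where x: "x \<in> W k" "mpoly_eval x (psubst (fam S) R) \<noteq> 0"
      using boundary_nonzero[OF boundary_independent_seeds[OF S] k] by blast
    have "psubst (fam S) R = hat D (cluster S l)"
    proof (cases "l \<in> K")
      case True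
      then have "l \<in> G"
        using K_sub(3) l by blast
      then show ?thesis
        using True hat_g cluster_frozen[OF S] ring_map.one[OF ring_map_insertion[OF ring_map_Const]]
        by (simp add: R_def psubst_def)
    next
      case False
      then show ?thesis
        by (simp add: R_def psubst_def insertion_Var ring_map_Const pullback_family_def)
    qed
    then show False
      using dvd x by (auto simp: dvd_def zero_set_def)
  qed
  then show ?thesis
    using cluster_pullback[OF S l] unfolding pole_form_def by blast
qed

lemma family_independent:
  assumes S: "S \<in> all_seeds"
  shows "alg_indep_on (affine_space dr) {1..dr} (fam S)"
proof (cases "K = {}")
  case False
  then obtain k where k: "k \<in> K"
    by blast
  then have fk: "fam S k = q k"
    by (simp add: pullback_family_def)
  show ?thesis
  proof (rule alg_indep_on_hypersurface_imp_indep)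
    show "alg_indep_on (zero_set dr (fam S k)) ({1..dr} - {k}) (fam S)"
      using boundary_independent_seeds[OF S] k fk by (simp add: boundary_independent_def)
  qed (use k fk K_sub(1) q_nonzero fam_mpolys[OF S] in auto)
next
  \<comment> \<open>Without distinguished polynomials there are no denominators and the dimensions
    agree. The hatted variables are the pullbacks themselves, and pulling back along a dominant map
    keeps the cluster independent.\<close>
  case True
  then have H: "H = {}" and G: "G = {}" and r: "dr = ds"
    using ds_le_dr by (auto simp: K_eq H_eq)
  show ?thesis
    unfolding alg_indep_on_def
  proof (intro ballI impI notI)
    fix R assume R: "R \<in> mpolys {1..dr}" "R \<noteq> 0"
      and R0: "\<forall>x\<in>affine_space dr. mpoly_eval (\<lambda>l. mpoly_eval x (fam S l)) R = 0"
    have "to_fract (fam S l) = pullback D (cluster S l)" if "l \<in> {1..ds}" for l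
      using cluster_pullback(4)[OF S that] True by (simp add: pullback_family_def)
    then have "to_fract (psubst (fam S) R) = mpoly_subst (\<lambda>l. pullback D (cluster S l)) R"
      using R(1) unfolding r by (subst mpoly_subst_to_fract[symmetric]) (rule mpoly_subst_cong)
    also have "\<dots> = pullback D (mpoly_subst (cluster S) R)"
      using pullback_cluster_expression[OF S, of R "\<lambda>_. 0"] R(1) by (simp add: r)
    also have "\<dots> \<noteq> 0"
    proof (rule pullback_nonzero)
      show "mpoly_subst (cluster S) R \<in> rfuns {1..ds}"
        using R(1) cluster_rfuns[OF S] unfolding r by (rule mpoly_subst_rfuns)
      show "mpoly_subst (cluster S) R \<noteq> 0"
        using R alg_indep_cluster[OF S] by (simp add: alg_indep_def r)
    qed
    finally have "psubst (fam S) R \<noteq> 0"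
      by auto
    moreover have "psubst (fam S) R \<in> mpolys {1..dr}"
      using R(1) fam_mpolys[OF S] by (rule psubst_mpolys)
    ultimately obtain x where "\<forall>i. i \<notin> {1..dr} \<longrightarrow> x i = 0" "mpoly_eval x (psubst (fam S) R) \<noteq> 0"
      using ex_nonzero_value by blast
    then show False
      using R0 by (simp add: affine_space_def mpoly_eval_psubst)
  qed
qed

lemma coherent: "coherent_pullback n D S0"
  unfolding coherent_pullback_def
  using Lam_eq boundary_independent_seeds family_independent by simp

end

theorem theorem3p1:
  fixes n :: nat and D :: pullback_data and S0 :: seed
  assumes "valid_pullback_data D"
    and "gen_cluster_structure n (sdim D) (gind D) S0"
    and "gind D \<subseteq> {n<..sdim D}"
    and "\<forall>i \<in> gind D. cluster S0 i = to_fract (gpol D i)"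
    and "\<forall>S \<in> seeds n (sdim D) S0. \<forall>l \<in> {1..sdim D}.
           regular_on (sdim D) (quasi_affine D) (cluster S l)"
    and "\<forall>k \<in> kind D. alg_indep_on (zero_set (rdim D) (qpol D k)) ({1..rdim D} - {k})
           (pullback_family D S0)"
  shows "(\<forall>S \<in> seeds n (sdim D) S0. \<forall>l \<in> {1..sdim D}.
           pole_form (rdim D) (kind D) (qpol D) (pullback D (cluster S l))
             (hat D (cluster S l)) (lam D (cluster S l))) \<and>
         coherent_pullback n D S0"
proof -
  interpret regular_pullback n D S0
    using assms by unfold_locales
  show ?thesis
    using cluster_pole_form coherent by blast
qed

end
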